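(* (1) For the formal potential $\mathcal V_e^{\mathrm{ev}}(x)=\frac{x^2}{2}+\frac12\log(1-tx^2)=\frac{x^2}{2}-\sum_{n\ge1}\frac{t^nx^{2n}}{2n}$, the associated formal series are $$\mathcal S(t)=0,\qquad \mathcal R(t)=\frac{1+4t-\sqrt{1-8t}}{8t},$$ $$\mathcal F_0(t)=\frac{1-24t+72t^2-(1-20t)\sqrt{1-8t}}{128t^2}-\frac38\log\frac{1-4t+\sqrt{1-8t}}{2}$$ $$=\frac t2+\frac{3t^2}{4}+2t^3+7t^4+\frac{144t^5}{5}+132t^6+\frac{4576t^7}{7}+3432t^8+O(t^9).$$ (2) For the formal potential $\mathcal V_e(x)=\frac{x^2}{2}+\log(1-\sqrt t\,x)=\frac{x^2}{2}-\sum_{n\ge1}\frac{t^{n/2}x^n}{n}$, the associated formal series are $$\mathcal S(t)=\frac{1-\sqrt{1-12t}}{6\sqrt t},\qquad \mathcal R(t)=\frac{1+12t-\sqrt{1-12t}}{18t},$$ $$\mathcal F_0(t)=\frac{1-36t+162t^2-(1-30t)\sqrt{1-12t}}{216t^2}-\frac12\log\frac{1-6t+\sqrt{1-12t}}{2}$$ $$=t+\frac{9t^2}{4}+9t^3+\frac{189t^4}{4}+\frac{1458t^5}{5}+\frac{8019t^6}{4}+\frac{104247t^7}{7}+O(t^8).$$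
   Context: For a formal potential $\frac{x^2}2-\sum_{n\ge1}\frac{a_n}{n}x^n$ with indeterminate $a_n$, let $\mathcal A=\mathbb Q[[a_1,a_2,\dots]]$ and $\mathcal A^+$ the series with zero constant term. $(\mathcal R,\mathcal S)\in(1+\mathcal A^+)\times\mathcal A^+$ is the unique solution of $$\mathcal R=1+\sum_{n\ge1}a_n\sum_{j\ge1}\binom{n-1}{j-1}\binom{n-j}{j}\mathcal R^j\mathcal S^{n-2j},\qquad \mathcal S=\sum_{n\ge1}a_n\sum_{j\ge0}\binom{n-1}{2j}\binom{2j}{j}\mathcal R^j\mathcal S^{n-2j-1}.$$ With $\mathcal H_N$ the $N\times N$ Hermitian matrices, put $$\mathcal Z=\frac{\int_{\mathcal H_N}\exp\!\big(-N\,\mathrm{Tr}(M^2/2)+N\sum_{n\ge1}\frac{a_n}{n}\mathrm{Tr}(M^n)\big)dM}{\int_{\mathcal H_N}\exp(-N\,\mathrm{Tr}(M^2/2))dM},$$ expanded in powers of the $a_n$ and integrated coefficientwise; $\log\mathcal Z=\sum_{g\ge0}N^{2-2g}\mathcal F_g$ with $\mathcal F_g\in\mathcal A$, and $\mathcal F_0$ is the formal planar limit. For a specific potential whose coefficients $a_n$ depend on $t$, the series $\mathcal R(t),\mathcal S(t),\mathcal F_0(t)\in\mathbb Q[[t^{1/2}]]$ are obtained by substituting those coefficients: in (1), $a_{2n}=t^n$ and $a_{2n-1}=0$ for $n\ge1$; in (2), $a_n=t^{n/2}$ for $n\ge1$. Square roots and logarithms are expanded at $t=0$ with $\sqrt{1}=1$,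 $\log 1=0$. *)

theory Defs
  imports
    "HOL-Analysis.Analysis"
    "HOL-Library.Poly_Mapping"
    "HOL-Computational_Algebra.Computational_Algebra"
    "Jordan_Normal_Form.Matrix"
begin

section \<open>Power series in countably many indeterminates\<close>

text \<open>
  A monomial is a finitely supported exponent function. The indeterminates are
  \<open>a\<^sub>1, a\<^sub>2, \<dots>\<close>; the exponent of \<open>a\<^sub>n\<close> is stored at index \<open>n - 1\<close>, so that there is no \<open>a\<^sub>0\<close>.
  The ring \<open>\<rat>[[a\<^sub>1, a\<^sub>2, \<dots>]]\<close> is \<open>rat mps\<close>.
\<close>

type_synonym monomial = "nat \<Rightarrow>\<^sub>0 nat"

typedef 'a mps = "UNIV :: (monomial \<Rightarrow> 'a) set"
  morphisms mps_coeff Abs_mps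
  by simp

lemma mps_eqI: "(\<And>m. mps_coeff f m = mps_coeff g m) \<Longrightarrow> f = g"
  by (metis ext mps_coeff_inject)

lemma mps_coeff_Abs [simp]: "mps_coeff (Abs_mps f) = f"
  by (simp add: Abs_mps_inverse)

lemma finite_monomial_splits: "finite {(p, q). p + q = (m :: monomial)}"
proof -
  let ?F = "{f :: nat \<Rightarrow> nat. \<forall>k. (k \<in> Poly_Mapping.keys m \<longrightarrow> f k \<in> {..Max (range (Poly_Mapping.lookup m))})
              \<and> (k \<notin> Poly_Mapping.keys m \<longrightarrow> f k = 0)}"
  have fin_range: "finite (range (Poly_Mapping.lookup m))"
  proof -
    have "range (Poly_Mapping.lookup m) \<subseteq> insert 0 (Poly_Mapping.lookup m ` Poly_Mapping.keys m)"
      by (auto simp: in_keys_iff)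
    then show ?thesis
      by (rule finite_subset) simp
  qed
  have "finite ?F"
    by (rule finite_set_of_finite_funs) auto
  moreover have "Poly_Mapping.lookup ` {p. \<exists>q. p + q = m} \<subseteq> ?F"
  proof (clarsimp, intro conjI impI allI)
    fix p q :: monomial and k
    assume m: "m = p + q"
    then have "Poly_Mapping.lookup p k \<le> Poly_Mapping.lookup m k"
      by (simp add: lookup_add)
    also have "\<dots> \<le> Max (range (Poly_Mapping.lookup m))"
      using fin_range by (intro Max_ge) auto
    finally show "Poly_Mapping.lookup p k \<le> Max (range (Poly_Mapping.lookup (p + q)))"
      using m by simp
  next
    fix p q :: monomial and k
    assume "k \<notin> Poly_Mapping.keys (p + q)"
    then show "Poly_Mapping.lookup p k = 0"
      by (simp add: in_keys_iff lookup_add)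
  qed
  ultimately have "finite (Poly_Mapping.lookup ` {p. \<exists>q. p + q = m})"
    by (rule rev_finite_subset)
  then have fin: "finite {p. \<exists>q. p + q = m}"
    by (rule finite_imageD) (auto intro!: inj_onI simp: lookup_inject)
  have "{(p, q). p + q = m} \<subseteq> (\<lambda>p. (p, m - p)) ` {p. \<exists>q. p + q = m}"
    by auto
  then show ?thesis
    using fin by (meson finite_imageI finite_subset)
qed

instantiation mps :: (comm_ring_1) comm_ring_1
begin

definition zero_mps :: "'a mps" where "0 = Abs_mps (\<lambda>_. 0)"

definition one_mps :: "'a mps" where "1 = Abs_mps (\<lambda>m. if m = 0 then 1 else 0)"

definition plus_mps :: "'a mps \<Rightarrow> 'a mps \<Rightarrow> 'a mps" where
  "f + g = Abs_mps (\<lambda>m. mps_coeff f m + mps_coeff g m)"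

definition minus_mps :: "'a mps \<Rightarrow> 'a mps \<Rightarrow> 'a mps" where
  "f - g = Abs_mps (\<lambda>m. mps_coeff f m - mps_coeff g m)"

definition uminus_mps :: "'a mps \<Rightarrow> 'a mps" where
  "- f = Abs_mps (\<lambda>m. - mps_coeff f m)"

definition times_mps :: "'a mps \<Rightarrow> 'a mps \<Rightarrow> 'a mps" where
  "f * g = Abs_mps (\<lambda>m. \<Sum>(p, q) | p + q = m. mps_coeff f p * mps_coeff g q)"

instance
proof
  fix f g h :: "'a mps"
  show "f * g * h = f * (g * h)"
  proof (rule mps_eqI)
    fix m :: monomial
    let ?S = "\<lambda>m :: monomial. {(p, q). p + q = m}"
    have "mps_coeff (f * g * h) m =
        (\<Sum>x\<in>?S m. \<Sum>y\<in>?S (fst x). mps_coeff f (fst y) * mps_coeff g (snd y) * mps_coeff h (snd x))"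
      by (simp add: times_mps_def case_prod_unfold sum_distrib_right)
    also have "\<dots> = (\<Sum>(x, y)\<in>Sigma (?S m) (\<lambda>x. ?S (fst x)).
        mps_coeff f (fst y) * mps_coeff g (snd y) * mps_coeff h (snd x))"
      by (rule sum.Sigma) (use finite_monomial_splits in auto)
    also have "\<dots> = (\<Sum>(x, y)\<in>Sigma (?S m) (\<lambda>x. ?S (snd x)).
        mps_coeff f (fst x) * (mps_coeff g (fst y) * mps_coeff h (snd y)))"
      by (rule sum.reindex_bij_witness
          [where i = "\<lambda>(x, y). ((fst x + fst y, snd y), (fst x, fst y))"
             and j = "\<lambda>(x, y). ((fst y, snd y + snd x), (snd y, snd x))"])
         (auto simp: ac_simps)
    also have "\<dots> = (\<Sum>x\<in>?S m. \<Sum>y\<in>?S (snd x).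
        mps_coeff f (fst x) * (mps_coeff g (fst y) * mps_coeff h (snd y)))"
      by (rule sum.Sigma [symmetric]) (use finite_monomial_splits in auto)
    also have "\<dots> = mps_coeff (f * (g * h)) m"
      by (simp add: times_mps_def case_prod_unfold sum_distrib_left)
    finally show "mps_coeff (f * g * h) m = mps_coeff (f * (g * h)) m" .
  qed
  show "f * g = g * f"
    unfolding times_mps_def
    by (intro arg_cong [where f = Abs_mps] ext
          sum.reindex_bij_witness [where i = prod.swap and j = prod.swap])
       (auto simp: ac_simps)
  show "1 * f = f"
  proof (rule mps_eqI)
    fix m
    have "mps_coeff (1 * f) m =
        (\<Sum>x | fst x + snd x = m. if x = (0, m) then mps_coeff f m else 0)"
      by (auto simp: times_mps_def one_mps_def case_prod_unfold prod_eq_iff intro!: sum.cong)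
    also have "\<dots> = mps_coeff f m"
      using finite_monomial_splits [of m] by (simp add: case_prod_unfold)
    finally show "mps_coeff (1 * f) m = mps_coeff f m" .
  qed
  show "(f + g) * h = f * h + g * h"
    by (simp add: times_mps_def plus_mps_def case_prod_unfold sum.distrib distrib_right)
  show "(0 :: 'a mps) \<noteq> 1"
  proof
    assume "(0 :: 'a mps) = 1"
    then have "mps_coeff (0 :: 'a mps) 0 = mps_coeff 1 0"
      by simp
    then show False
      by (simp add: zero_mps_def one_mps_def)
  qed
qed (auto intro!: mps_eqI simp: plus_mps_def minus_mps_def uminus_mps_def zero_mps_def)

end

definition mps_const :: "'a::comm_ring_1 \<Rightarrow> 'a mps" where
  "mps_const c = Abs_mps (\<lambda>m. if m = 0 then c else 0)"

text \<open>The indeterminate \<open>a\<^sub>n\<close>, for \<open>n \<ge> 1\<close>.\<close>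

definition indet :: "nat \<Rightarrow> 'a::comm_ring_1 mps" where
  "indet n = Abs_mps (\<lambda>m. if m = Poly_Mapping.single (n - 1) 1 then 1 else 0)"

text \<open>
  Sum of a locally finite family: for each monomial only finitely many members may have a nonzero
  coefficient (otherwise that coefficient of the sum is the default value 0). This is satisfied
  wherever the operation is used below.
\<close>

definition mps_Sum :: "nat set \<Rightarrow> (nat \<Rightarrow> 'a::comm_ring_1 mps) \<Rightarrow> 'a mps" where
  "mps_Sum I f = Abs_mps (\<lambda>m. \<Sum>n | n \<in> I \<and> mps_coeff (f n) m \<noteq> 0. mps_coeff (f n) m)"

text \<open>Exponential of a series with constant term 0, logarithm of a series with constant term 1.\<close>

definition mps_exp :: "'a::field_char_0 mps \<Rightarrow> 'a mps" where
  "mps_exp f = mps_Sum {0..} (\<lambda>k. mps_const (1 / fact k) * f ^ k)"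

definition mps_log :: "'a::field_char_0 mps \<Rightarrow> 'a mps" where
  "mps_log f = mps_Sum {1..} (\<lambda>k. mps_const ((- 1) ^ (k - 1) / of_nat k) * (f - 1) ^ k)"


section \<open>The series R and S\<close>

text \<open>
  The inner sums are cut off where the binomial coefficients vanish, which also keeps the
  exponents of \<open>S\<close> nonnegative.
\<close>

definition solves_RS :: "rat mps \<Rightarrow> rat mps \<Rightarrow> bool" where
  "solves_RS R S \<longleftrightarrow>
     mps_coeff R 0 = 1 \<and> mps_coeff S 0 = 0 \<and>
     R = 1 + mps_Sum {1..} (\<lambda>n. indet n *
           (\<Sum>j = 1..n div 2. of_nat (((n - 1) choose (j - 1)) * ((n - j) choose j))
              * R ^ j * S ^ (n - 2 * j))) \<and>
     S = mps_Sum {1..} (\<lambda>n. indet n *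
           (\<Sum>j = 0..(n - 1) div 2. of_nat (((n - 1) choose (2 * j)) * ((2 * j) choose j))
              * R ^ j * S ^ (n - 2 * j - 1)))"

definition RS_solution :: "rat mps \<times> rat mps" where
  "RS_solution = (THE (R, S). solves_RS R S)"

definition R_series :: "rat mps" where "R_series = fst RS_solution"

definition S_series :: "rat mps" where "S_series = snd RS_solution"


section \<open>The Hermitian matrix integral\<close>

text \<open>
  Real coordinates \<open>x (i, j)\<close> (\<open>i, j < N\<close>) on the space of \<open>N \<times> N\<close> Hermitian matrices: \<open>x (i, i)\<close> is a
  diagonal entry, and for \<open>i < j\<close> the real and imaginary parts of the entry \<open>(i, j)\<close> are \<open>x (i, j)\<close>
  and \<open>x (j, i)\<close>. The measure \<open>dM\<close> is the Lebesgue measure in these \<open>N\<^sup>2\<close> coordinates.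
\<close>

definition hermitian_mat :: "nat \<Rightarrow> (nat \<times> nat \<Rightarrow> real) \<Rightarrow> complex mat" where
  "hermitian_mat N x = mat N N (\<lambda>(i, j).
     if i = j then complex_of_real (x (i, i))
     else if i < j then Complex (x (i, j)) (x (j, i))
     else Complex (x (j, i)) (- x (i, j)))"

lemma bij_betw_hermitian_mat:
  "bij_betw (hermitian_mat N) (({..<N} \<times> {..<N}) \<rightarrow>\<^sub>E UNIV)
     {M \<in> carrier_mat N N. \<forall>i<N. \<forall>j<N. M $$ (j, i) = cnj (M $$ (i, j))}"
proof (rule bij_betwI [where g = "\<lambda>M. \<lambda>(i, j) \<in> {..<N} \<times> {..<N}.
         if i \<le> j then Re (M $$ (i, j)) else Im (M $$ (j, i))"])
  show "hermitian_mat N \<in> (({..<N} \<times> {..<N}) \<rightarrow>\<^sub>E UNIV) \<rightarrow>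
      {M \<in> carrier_mat N N. \<forall>i<N. \<forall>j<N. M $$ (j, i) = cnj (M $$ (i, j))}"
    by (auto simp: hermitian_mat_def complex_eq_iff)
next
  fix x :: "nat \<times> nat \<Rightarrow> real"
  assume "x \<in> ({..<N} \<times> {..<N}) \<rightarrow>\<^sub>E UNIV"
  then show "(\<lambda>(i, j) \<in> {..<N} \<times> {..<N}. if i \<le> j then Re (hermitian_mat N x $$ (i, j))
      else Im (hermitian_mat N x $$ (j, i))) = x"
    by (auto simp: hermitian_mat_def fun_eq_iff restrict_def PiE_def extensional_def)
next
  fix M :: "complex mat"
  assume "M \<in> {M \<in> carrier_mat N N. \<forall>i<N. \<forall>j<N. M $$ (j, i) = cnj (M $$ (i, j))}"
  then have dim: "dim_row M = N" "dim_col M = N"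
    and sym: "\<And>i j. i < N \<Longrightarrow> j < N \<Longrightarrow> M $$ (j, i) = cnj (M $$ (i, j))"
    by blast+
  show "hermitian_mat N (\<lambda>(i, j) \<in> {..<N} \<times> {..<N}.
      if i \<le> j then Re (M $$ (i, j)) else Im (M $$ (j, i))) = M"
  proof (rule eq_matI)
    fix i j
    assume "i < dim_row M" "j < dim_col M"
    then have ij: "i < N" "j < N"
      using dim by simp_all
    have "Re (M $$ (j, i)) = Re (M $$ (i, j))" "Im (M $$ (j, i)) = - Im (M $$ (i, j))"
      "Im (M $$ (i, i)) = - Im (M $$ (i, i))"
      using sym [OF ij] sym [OF ij(1) ij(1)] by (metis cnj.sel)+
    then show "hermitian_mat N (\<lambda>(i, j) \<in> {..<N} \<times> {..<N}.
        if i \<le> j then Re (M $$ (i, j)) else Im (M $$ (j, i))) $$ (i, j) = M $$ (i, j)"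
      using ij by (cases i j rule: linorder_cases) (simp_all add: hermitian_mat_def complex_eq_iff)
  qed (use dim in \<open>auto simp: hermitian_mat_def\<close>)
qed auto

definition hermitian_integral :: "nat \<Rightarrow> (complex mat \<Rightarrow> complex) \<Rightarrow> complex" where
  "hermitian_integral N f =
     integral\<^sup>L (PiM ({..<N} \<times> {..<N}) (\<lambda>_. lborel)) (\<lambda>x. f (hermitian_mat N x))"

definition mat_trace :: "'a::comm_monoid_add mat \<Rightarrow> 'a" where
  "mat_trace M = (\<Sum>i<dim_row M. M $$ (i, i))"

definition gauss_weight :: "nat \<Rightarrow> complex mat \<Rightarrow> complex" where
  "gauss_weight N M = exp (- of_nat N * (mat_trace (M ^\<^sub>m 2) / 2))"

text \<open>The formal series \<open>N \<Sum>\<^sub>n (a\<^sub>n / n) Tr (M\<^sup>n)\<close> attached to a matrix \<open>M\<close>.\<close>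

definition interaction :: "nat \<Rightarrow> complex mat \<Rightarrow> complex mps" where
  "interaction N M =
     of_nat N * mps_Sum {1..} (\<lambda>n. mps_const (mat_trace (M ^\<^sub>m n) / of_nat n) * indet n)"

definition partition_function :: "nat \<Rightarrow> complex mps" where
  "partition_function N = Abs_mps (\<lambda>m.
     hermitian_integral N (\<lambda>M. gauss_weight N M * mps_coeff (mps_exp (interaction N M)) m) /
     hermitian_integral N (gauss_weight N))"

text \<open>
  The identity \<open>log Z = \<Sum>\<^sub>g N\<^bsup>2 - 2 g\<^esup> F\<^sub>g\<close> is understood monomial by monomial, where only finitely many
  genera contribute; as an identity in \<open>N\<close> it determines the family \<open>F\<close>.
\<close>

definition genus_expansion :: "(nat \<Rightarrow> rat mps) \<Rightarrow> bool" where
  "genus_expansion F \<longleftrightarrow> (\<forall>m.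
     finite {g. mps_coeff (F g) m \<noteq> 0} \<and>
     (\<forall>N\<ge>1. mps_coeff (mps_log (partition_function N)) m =
        (\<Sum>g | mps_coeff (F g) m \<noteq> 0.
           of_nat N powi (2 - 2 * int g) * of_rat (mps_coeff (F g) m))))"

definition free_energy :: "nat \<Rightarrow> rat mps" where
  "free_energy = (THE F. genus_expansion F)"


section \<open>Specific potentials\<close>

text \<open>
  \<open>\<rat>[[t\<^bsup>1/2\<^esup>]]\<close> is \<open>rat fps\<close> with \<open>fps_X\<close> in the role of \<open>t\<^bsup>1/2\<^esup>\<close>. The substitution \<open>a\<^sub>n \<mapsto> c n\<close> is
  meaningful when \<open>c n\<close> has order at least \<open>n\<close>: then only finitely many monomials contribute to
  each coefficient.
\<close>

definition mps_subst :: "(nat \<Rightarrow> rat fps) \<Rightarrow> rat mps \<Rightarrow> rat fps" where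
  "mps_subst c f =
     (let term = (\<lambda>m. fps_const (mps_coeff f m)
                  * (\<Prod>i\<in>Poly_Mapping.keys m. c (i + 1) ^ Poly_Mapping.lookup m i))
      in Abs_fps (\<lambda>k. \<Sum>m | fps_nth (term m) k \<noteq> 0. fps_nth (term m) k))"

definition even_coeffs :: "nat \<Rightarrow> rat fps" where
  "even_coeffs n = (if even n then (fps_X ^ 2) ^ (n div 2) else 0)"

definition all_coeffs :: "nat \<Rightarrow> rat fps" where
  "all_coeffs n = fps_X ^ n"

text \<open>
  The potential \<open>x\<^sup>2 / 2 - \<Sum>\<^sub>n (c n / n) x\<^sup>n\<close> as a power series in \<open>x\<close>; its coefficients are embedded
  into the field of Laurent series in \<open>t\<^bsup>1/2\<^esup>\<close>, over which the library logarithm is available.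
\<close>

definition formal_potential :: "(nat \<Rightarrow> rat fps) \<Rightarrow> rat fls fps" where
  "formal_potential c = fps_const (1 / 2) * fps_X ^ 2
     - Abs_fps (\<lambda>n. if n = 0 then 0 else fps_to_fls (c n) / of_nat n)"

text \<open>
  Square root and logarithm of a series with constant term 1, normalised by \<open>\<surd>1 = 1\<close> and
  \<open>log 1 = 0\<close>. The first argument of \<^const>\<open>fps_radical\<close> only selects the root of the constant term.
\<close>

definition fps_sqrt :: "'a::field_char_0 fps \<Rightarrow> 'a fps" where
  "fps_sqrt f = fps_radical (\<lambda>_ _. 1) 2 f"

definition fps_log :: "'a::field_char_0 fps \<Rightarrow> 'a fps" where
  "fps_log f = fps_compose (fps_ln 1) (f - 1)"

end

theory Submission
  imports Defs "HOL-Probability.Distributions"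
begin

text \<open>
  Gaussian integration by parts gives the Schwinger--Dyson equations of the matrix integral. For
  \<open>U\<^sub>n = (n / N\<^sup>2) \<partial> log Z / \<partial>a\<^sub>n\<close> and \<open>U\<^sub>0 = 1\<close> they read
  \<open>U\<^sub>k\<^sub>+\<^sub>1 = \<Sum>\<^sub>p\<^sub><\<^sub>k (U\<^sub>p U\<^sub>k\<^sub>-\<^sub>1\<^sub>-\<^sub>p + (p / N\<^sup>2) \<partial>U\<^sub>k\<^sub>-\<^sub>1\<^sub>-\<^sub>p / \<partial>a\<^sub>p) + \<Sum>\<^sub>n a\<^sub>n U\<^sub>n\<^sub>+\<^sub>k\<^sub>-\<^sub>1\<close>. By induction on \<open>n\<close> plus the weight of the
  monomial, every coefficient of \<open>U\<^sub>n\<close> is a rational polynomial in \<open>1 / N\<^sup>2\<close>, which is the genus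
  expansion, and the limit \<open>N \<longlongrightarrow> \<infinity>\<close> gives the planar loop equations for \<open>W\<^sub>n = n \<partial>F\<^sub>0 / \<partial>a\<^sub>n\<close>.
  After specialisation \<open>a\<^sub>n\<close> is a multiple of \<open>X\<^sup>n\<close> with \<open>X = t\<^bsup>1/2\<^esup>\<close>, and Euler's relation together with
  the loop equation for \<open>W\<^sub>2\<close> yields \<open>X F\<^sub>0' = W\<^sub>2 - 1\<close>. For the two potentials the geometric series in the loop
  equations telescopes to a recursion with a unique solution; a rational parametrisation of the
  spectral curve exhibits this solution, hence \<open>W\<^sub>2\<close>, in terms of \<open>y = R - 1\<close> with
  \<open>t = y / (1 + c y)\<^sup>2\<close>, \<open>c = 2\<close> and \<open>c = 3\<close> respectively, and \<open>F\<^sub>0\<close> is found by integration.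
\<close>

text \<open>The free energy is characterised by the matrix integral alone, so existence and
  uniqueness of the expansion of log Z must be proved before \<open>free_energy\<close> can be used;
  R and S enter only at the end, as parameters of a solution of the loop equations. After
  specialisation and telescoping, W_(k+1) still depends on later moments, so the moments cannot be
  computed one after the other. The later moments carry a factor X, however, and a double induction,
  on the order in X and then on the index, gives uniqueness; it is then enough to guess a solution.
  The generating series of the moments obeys a quadratic equation with one unknown coefficient. The
  guess is a rational function on the curve x = q + S + R / q, and the unknown coefficient takes the
  value for which the resulting polynomial identities hold. The relation between t and y is
  quadratic in y with discriminant 1 - 4 c t, which is where the square roots of 1 - 8 t and 1 - 12
  t come from.\<close>

abbreviation expo :: "monomial \<Rightarrow> nat \<Rightarrow> nat" where
  "expo \<equiv> Poly_Mapping.lookup"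

abbreviation supp :: "monomial \<Rightarrow> nat set" where
  "supp \<equiv> Poly_Mapping.keys"

section \<open>Power series in countably many indeterminates\<close>

lemma mps_coeff_zero [simp]: "mps_coeff 0 m = 0"
  by (simp add: zero_mps_def)

lemma mps_coeff_one: "mps_coeff 1 m = (if m = 0 then 1 else 0)"
  by (simp add: one_mps_def)

lemma mps_coeff_one_0 [simp]: "mps_coeff 1 0 = 1"
  by (simp add: mps_coeff_one)

lemma mps_coeff_add [simp]: "mps_coeff (f + g) m = mps_coeff f m + mps_coeff g m"
  by (simp add: plus_mps_def)

lemma mps_coeff_diff [simp]: "mps_coeff (f - g) m = mps_coeff f m - mps_coeff g m"
  by (simp add: minus_mps_def)

lemma mps_coeff_uminus [simp]: "mps_coeff (- f) m = - mps_coeff f m"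
  by (simp add: uminus_mps_def)

lemma mps_coeff_mult: "mps_coeff (f * g) m = (\<Sum>(p, q) | p + q = m. mps_coeff f p * mps_coeff g q)"
  by (simp add: times_mps_def)

lemma mps_coeff_sum: "mps_coeff (\<Sum>i\<in>I. f i) m = (\<Sum>i\<in>I. mps_coeff (f i) m)"
  by (induction I rule: infinite_finite_induct) auto

lemma mps_coeff_const_mult [simp]: "mps_coeff (mps_const c * f) m = c * mps_coeff f m"
proof -
  have "mps_coeff (mps_const c * f) m =
      (\<Sum>x | fst x + snd x = m. if x = (0, m) then c * mps_coeff f m else 0)"
    by (auto simp: times_mps_def mps_const_def case_prod_unfold prod_eq_iff intro!: sum.cong)
  also have "\<dots> = c * mps_coeff f m"
    using finite_monomial_splits [of m] by (simp add: case_prod_unfold)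
  finally show ?thesis .
qed

lemma coeff_mps_const: "mps_coeff (mps_const c) m = (if m = 0 then c else 0)"
  by (simp add: mps_const_def)

lemma mps_const_1 [simp]: "mps_const 1 = 1"
  by (rule mps_eqI) (simp add: coeff_mps_const mps_coeff_one)

lemma mps_const_mult: "mps_const a * mps_const b = mps_const (a * b)"
  by (rule mps_eqI) (simp add: coeff_mps_const)

lemma mps_const_power: "mps_const a ^ k = mps_const (a ^ k)"
  by (induction k) (simp_all add: mps_const_mult)

lemma of_nat_mps: "of_nat n = (mps_const (of_nat n) :: 'a::comm_ring_1 mps)"
  by (rule mps_eqI, induction n) (auto simp: mps_const_def mps_coeff_one)

lemma mps_coeff_of_nat_mult [simp]: "mps_coeff (of_nat n * f) m = of_nat n * mps_coeff f m"
  by (simp add: of_nat_mps)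

lemma monomial_add_eq_0: "(p :: monomial) + q = 0 \<longleftrightarrow> p = 0 \<and> q = 0"
  by (auto simp: poly_mapping_eq_iff fun_eq_iff lookup_add)

lemma mps_coeff_mult_0 [simp]: "mps_coeff (f * g) 0 = mps_coeff f 0 * mps_coeff g 0"
proof -
  have "{(p, q). p + q = (0 :: monomial)} = {(0, 0)}"
    by (auto simp: monomial_add_eq_0)
  then show ?thesis
    by (simp add: mps_coeff_mult)
qed

section \<open>The weight grading and its filtration\<close>

abbreviation var_mon :: "nat \<Rightarrow> monomial" where
  "var_mon i \<equiv> Poly_Mapping.single i (Suc 0)"

text \<open>The grading in which a_n has degree n; \<open>Suc i\<close> undoes the storage of a_n at
  index n - 1. Once a_n becomes a multiple of X^n, the weight is the order in X.\<close>

definition wt :: "monomial \<Rightarrow> nat" where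
  "wt m = (\<Sum>i\<in>supp m. Suc i * expo m i)"

lemma wt_superset:
  assumes "finite A" "supp m \<subseteq> A"
  shows "wt m = (\<Sum>i\<in>A. Suc i * expo m i)"
  unfolding wt_def using assms by (intro sum.mono_neutral_left) (auto simp: in_keys_iff)

lemma wt_add [simp]: "wt (p + q) = wt p + wt q"
proof -
  let ?A = "supp p \<union> supp q"
  have "wt (p + q) = (\<Sum>i\<in>?A. Suc i * expo (p + q) i)"
    by (rule wt_superset) (use Poly_Mapping.keys_add [of p q] in auto)
  also have "\<dots> = (\<Sum>i\<in>?A. Suc i * expo p i) + (\<Sum>i\<in>?A. Suc i * expo q i)"
    by (simp add: lookup_add algebra_simps sum.distrib)
  also have "\<dots> = wt p + wt q"
    by (subst (1 2) wt_superset [of ?A]) auto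
  finally show ?thesis .
qed

lemma wt_0 [simp]: "wt 0 = 0"
  by (simp add: wt_def)

lemma wt_eq_0_iff [simp]: "wt m = 0 \<longleftrightarrow> m = 0"
proof
  assume "wt m = 0"
  then have "\<forall>i\<in>supp m. expo m i = 0"
    by (simp add: wt_def)
  then show "m = 0"
    by (metis in_keys_iff lookup_zero poly_mapping_eqI)
qed auto

lemma wt_var_mon [simp]: "wt (var_mon i) = Suc i"
  by (simp add: wt_def)

lemma lookup_le_wt: "Suc i * expo m i \<le> wt m"
proof (cases "i \<in> supp m")
  case True
  then show ?thesis
    unfolding wt_def by (intro member_le_sum) auto
qed (simp add: in_keys_iff)

lemma monomial_split:
  assumes "expo m i > 0"
  obtains m' where "m = m' + var_mon i" "expo m' i + 1 = expo m i"
proof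
  show "m = (m - var_mon i) + var_mon i"
    by (rule poly_mapping_eqI) (use assms in \<open>auto simp: lookup_add lookup_minus lookup_single when_def\<close>)
  show "expo (m - var_mon i) i + 1 = expo m i"
    using assms by (simp add: lookup_minus)
qed

lemma monomial_nonzero_key:
  assumes "(m :: monomial) \<noteq> 0"
  obtains i where "expo m i > 0"
  using assms by (metis gr0I lookup_zero poly_mapping_eqI)

text \<open>The indices that occur in a monomial and their exponents are all bounded by the
  weight.\<close>

lemma finite_wt_le: "finite {m. wt m \<le> k}"
proof -
  let ?F = "{f :: nat \<Rightarrow> nat. \<forall>i. (i \<in> {..k} \<longrightarrow> f i \<in> {..k}) \<and> (i \<notin> {..k} \<longrightarrow> f i = 0)}"
  have "finite ?F"
    by (rule finite_set_of_finite_funs) auto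
  moreover have "expo ` {m. wt m \<le> k} \<subseteq> ?F"
  proof clarsimp
    fix m :: monomial and i
    assume k: "wt m \<le> k"
    then have *: "Suc i * expo m i \<le> k"
      using lookup_le_wt [of i m] by linarith
    show "(i \<le> k \<longrightarrow> expo m i \<le> k) \<and> (\<not> i \<le> k \<longrightarrow> expo m i = 0)"
    proof (cases "expo m i")
      case (Suc l)
      then show ?thesis using * by simp
    qed simp
  qed
  ultimately have "finite (expo ` {m. wt m \<le> k})"
    by (rule rev_finite_subset)
  then show ?thesis
    by (rule finite_imageD) (auto intro!: inj_onI simp: lookup_inject)
qed

lemma mps_coeff_indet: "mps_coeff (indet (Suc i)) m = (if m = var_mon i then 1 else 0)"
  by (simp add: indet_def)

lemma mps_coeff_indet_mult:
  "mps_coeff (indet (Suc i) * f) (m + var_mon i) = mps_coeff f m"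
proof -
  have "mps_coeff (indet (Suc i) * f) (m + var_mon i) =
      (\<Sum>x | fst x + snd x = m + var_mon i. if x = (var_mon i, m) then mps_coeff f m else 0)"
    unfolding mps_coeff_mult
    by (auto simp: mps_coeff_indet case_prod_unfold prod_eq_iff add.commute intro!: sum.cong)
  also have "\<dots> = mps_coeff f m"
    using finite_monomial_splits [of "m + var_mon i"] by (simp add: case_prod_unfold add.commute)
  finally show ?thesis .
qed

lemma mps_coeff_indet_mult_eq_0:
  assumes "expo m i = 0"
  shows "mps_coeff (indet (Suc i) * f) m = 0"
proof -
  have "p \<noteq> var_mon i" if "p + q = m" for p q
    using that assms by (auto simp: lookup_add)
  then show ?thesis
    unfolding mps_coeff_mult by (intro sum.neutral) (auto simp: mps_coeff_indet)
qed

text \<open>The filtration belonging to the weight. Infinite sums of series are handled by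
  calculating modulo a sufficiently high step of it.\<close>

definition vanish_below :: "nat \<Rightarrow> 'a::comm_ring_1 mps \<Rightarrow> bool" where
  "vanish_below k f \<longleftrightarrow> (\<forall>m. wt m < k \<longrightarrow> mps_coeff f m = 0)"

lemma vanish_belowD: "vanish_below k f \<Longrightarrow> wt m < k \<Longrightarrow> mps_coeff f m = 0"
  by (simp add: vanish_below_def)

lemma vanish_below_0 [simp]: "vanish_below 0 f"
  by (simp add: vanish_below_def)

lemma vanish_below_zero [simp]: "vanish_below k 0"
  by (simp add: vanish_below_def)

lemma vanish_below_mono: "vanish_below k f \<Longrightarrow> j \<le> k \<Longrightarrow> vanish_below j f"
  by (auto simp: vanish_below_def)

lemma vanish_below_add: "vanish_below k f \<Longrightarrow> vanish_below k g \<Longrightarrow> vanish_below k (f + g)"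
  by (simp add: vanish_below_def)

lemma vanish_below_mult:
  assumes "vanish_below j f" "vanish_below k g"
  shows "vanish_below (j + k) (f * g)"
  unfolding vanish_below_def mps_coeff_mult
proof (intro allI impI sum.neutral, clarify)
  fix p q :: monomial
  assume "wt (p + q) < j + k"
  then have "wt p < j \<or> wt q < k"
    by auto
  then show "mps_coeff f p * mps_coeff g q = 0"
    using assms by (auto simp: vanish_below_def)
qed

lemma vanish_below_mult_right: "vanish_below k g \<Longrightarrow> vanish_below k (f * g)"
  using vanish_below_mult [of 0 f k g] by simp

lemma vanish_below_mult_left: "vanish_below k f \<Longrightarrow> vanish_below k (f * g)"
  using vanish_below_mult [of k f 0 g] by simp

lemma vanish_below_1: "mps_coeff f 0 = 0 \<Longrightarrow> vanish_below 1 f"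
  by (simp add: vanish_below_def)

lemma vanish_below_power:
  assumes "mps_coeff f 0 = 0"
  shows "vanish_below k (f ^ k)"
  by (induction k) (use vanish_below_mult [OF vanish_below_1 [OF assms]] in auto)

lemma vanish_below_indet: "vanish_below n (indet n)"
  by (cases n) (auto simp: vanish_below_def mps_coeff_indet)

lemma vanish_below_all: "(\<And>k. vanish_below k f) \<Longrightarrow> f = 0"
  by (rule mps_eqI) (auto simp: vanish_below_def)

text \<open>From h = - (Z - 1) h each pass raises the order of h by one. This gives cancellation
  without constructing an inverse of Z.\<close>

lemma unit_mult_eq_0:
  assumes "mps_coeff Z 0 = 1" "Z * h = 0"
  shows "h = 0"
proof (rule vanish_below_all)
  fix k
  show "vanish_below k h"
  proof (induction k)
    case (Suc k)
    have "vanish_below (1 + k) ((Z - 1) * h)"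
      by (rule vanish_below_mult [OF vanish_below_1 Suc]) (use assms in simp)
    moreover have "h = - ((Z - 1) * h)"
      using assms(2) by (simp add: left_diff_distrib)
    ultimately show ?case
      by (metis Suc_eq_plus1_left mps_coeff_uminus neg_equal_0_iff_equal vanish_below_def)
  qed simp
qed

lemma unit_mult_cancel:
  assumes "mps_coeff Z 0 = 1" "Z * f = Z * g"
  shows "f = g"
  using unit_mult_eq_0 [of Z "f - g"] assms by (simp add: right_diff_distrib)

text \<open>The order of the n-th member bounds the indices that contribute. The cutoff
  \<open>K\<close> is left free so that one cutoff can serve all monomials occurring in a
  product.\<close>

lemma coeff_mps_Sum:
  assumes "\<And>n. vanish_below n (f n)" "wt m \<le> K"
  shows "mps_coeff (mps_Sum I f) m = (\<Sum>n\<in>I \<inter> {..K}. mps_coeff (f n) m)"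
proof -
  have "n \<le> K" if "mps_coeff (f n) m \<noteq> 0" for n
    using that assms vanish_belowD [OF assms(1), of m n] by (meson leI le_trans not_le)
  then show ?thesis
    unfolding mps_Sum_def mps_coeff_Abs
    by (intro sum.mono_neutral_left) auto
qed

section \<open>Formal partial derivatives; index i stands for the indeterminate a_(i+1)\<close>

definition pd :: "nat \<Rightarrow> 'a::comm_ring_1 mps \<Rightarrow> 'a mps" where
  "pd i f = Abs_mps (\<lambda>m. of_nat (expo m i + 1) * mps_coeff f (m + var_mon i))"

lemma mps_coeff_pd: "mps_coeff (pd i f) m =
    of_nat (expo m i + 1) * mps_coeff f (m + var_mon i)"
  by (simp add: pd_def)

lemma pd_add: "pd i (f + g) = pd i f + pd i g"
  by (rule mps_eqI) (simp add: mps_coeff_pd algebra_simps)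

lemma pd_diff: "pd i (f - g) = pd i f - pd i g"
  by (rule mps_eqI) (simp add: mps_coeff_pd algebra_simps)

lemma pd_zero [simp]: "pd i 0 = 0"
  by (rule mps_eqI) (simp add: mps_coeff_pd)

lemma pd_sum: "pd i (\<Sum>k\<in>A. f k) = (\<Sum>k\<in>A. pd i (f k))"
  by (induction A rule: infinite_finite_induct) (simp_all add: pd_add)

lemma pd_const_mult: "pd i (mps_const c * f) = mps_const c * pd i f"
  by (rule mps_eqI) (simp add: mps_coeff_pd)

lemma var_mon_neq_0 [simp]: "m + var_mon i \<noteq> 0" "var_mon i + m \<noteq> 0"
  by (metis add_is_0 nat.distinct(1) wt_0 wt_add wt_var_mon)+

lemma pd_one [simp]: "pd i 1 = 0"
  by (rule mps_eqI) (simp add: mps_coeff_pd mps_coeff_one)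

text \<open>One half of the Leibniz rule. In a splitting p + q of the monomial the exponents of
  a_(i+1) add up; the share of p comes from differentiating the first factor, and the share of q
  follows by symmetry.\<close>

lemma pd_mult_half:
  fixes f g :: "'a::comm_ring_1 mps"
  shows "(\<Sum>(p, q) | p + q = m + var_mon i.
            of_nat (expo p i) * (mps_coeff f p * mps_coeff g q)) = mps_coeff (pd i f * g) m"
proof -
  let ?S = "{x. fst x + snd x = m + var_mon i \<and> expo (fst x) i > 0}"
  have "(\<Sum>(p, q) | p + q = m + var_mon i.
            of_nat (expo p i) * (mps_coeff f p * mps_coeff g q))
     = (\<Sum>(p, q)\<in>?S. of_nat (expo p i) * (mps_coeff f p * mps_coeff g q))"
    using finite_monomial_splits [of "m + var_mon i"]
    by (intro sum.mono_neutral_right) (auto simp: case_prod_unfold)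
  also have "\<dots> = (\<Sum>(p, q) | p + q = m. mps_coeff (pd i f) p * mps_coeff g q)"
  proof (rule sum.reindex_bij_witness [where i = "\<lambda>(p, q). (p + var_mon i, q)"
        and j = "\<lambda>(p, q). (p - var_mon i, q)"])
    fix a assume a: "a \<in> ?S"
    obtain p q where pq: "a = (p, q)" by (cases a)
    then obtain p' where p': "p = p' + var_mon i"
      using monomial_split [of p i] a by auto
    have "p' + q = m"
      using a p' pq by (simp add: ac_simps) (metis add_right_cancel add.commute add.left_commute)
    then show "(case case a of (p, q) \<Rightarrow> (p - var_mon i, q) of (p, q) \<Rightarrow> (p + var_mon i, q)) = a"
      "(case a of (p, q) \<Rightarrow> (p - var_mon i, q)) \<in> {(p, q). p + q = m}"
      "(case case a of (p, q) \<Rightarrow> (p - var_mon i, q) of (p, q) \<Rightarrow> mps_coeff (pd i f) p * mps_coeff g q)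
        = (case a of (p, q) \<Rightarrow> of_nat (expo p i) * (mps_coeff f p * mps_coeff g q))"
      using pq p' by (auto simp: mps_coeff_pd lookup_add algebra_simps)
  next
    fix a :: "monomial \<times> monomial" assume a: "a \<in> {(p, q). p + q = m}"
    then show "(case case a of (p, q) \<Rightarrow> (p + var_mon i, q) of (p, q) \<Rightarrow> (p - var_mon i, q)) = a"
      "(case a of (p, q) \<Rightarrow> (p + var_mon i, q)) \<in> ?S"
      by (auto simp: lookup_add ac_simps)
  qed
  finally show ?thesis
    by (simp add: mps_coeff_mult)
qed

lemma pd_mult: "pd i (f * g) = pd i f * g + f * pd i g"
proof (rule mps_eqI)
  fix m
  let ?T = "{(p, q). p + q = m + var_mon i}"
  have "mps_coeff (pd i (f * g)) m =
      (\<Sum>(p, q)\<in>?T. of_nat (expo m i + 1) * (mps_coeff f p * mps_coeff g q))"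
    by (simp only: mps_coeff_pd mps_coeff_mult sum_distrib_left case_prod_unfold)
  also have "\<dots> = (\<Sum>(p, q)\<in>?T. of_nat (expo p i) * (mps_coeff f p * mps_coeff g q)
         + of_nat (expo q i) * (mps_coeff g q * mps_coeff f p))"
  proof (intro sum.cong refl, clarsimp)
    fix p q assume "p + q = m + var_mon i"
    then have "expo (p + q) i = expo (m + var_mon i) i"
      by simp
    then have "expo m i + 1 = expo p i + expo q i"
      by (simp add: lookup_add)
    then have "of_nat (expo m i + 1) =
        (of_nat (expo p i + expo q i) :: 'a)"
      by simp
    then have "1 + of_nat (expo m i) =
        (of_nat (expo p i) + of_nat (expo q i) :: 'a)"
      by simp
    then show "(1 + of_nat (expo m i)) * (mps_coeff f p * mps_coeff g q) =
         of_nat (expo p i) * (mps_coeff f p * mps_coeff g q) +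
         of_nat (expo q i) * (mps_coeff g q * mps_coeff f p)"
      by (simp add: algebra_simps)
  qed
  also have "\<dots> = (\<Sum>(p, q)\<in>?T. of_nat (expo p i) * (mps_coeff f p * mps_coeff g q))
      + (\<Sum>(p, q)\<in>?T. of_nat (expo q i) * (mps_coeff g q * mps_coeff f p))"
    by (simp add: case_prod_unfold sum.distrib)
  also have "(\<Sum>(p, q)\<in>?T. of_nat (expo q i) * (mps_coeff g q * mps_coeff f p))
     = (\<Sum>(p, q)\<in>?T. of_nat (expo p i) * (mps_coeff g p * mps_coeff f q))"
    by (rule sum.reindex_bij_witness [where i = prod.swap and j = prod.swap]) (auto simp: ac_simps)
  finally show "mps_coeff (pd i (f * g)) m = mps_coeff (pd i f * g + f * pd i g) m"
    by (simp only: pd_mult_half mps_coeff_add mult.commute [of f])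
qed

lemma pd_power: "pd i (f ^ Suc k) = of_nat (Suc k) * f ^ k * pd i f"
  by (induction k) (simp_all add: pd_mult algebra_simps)

text \<open>Differentiation shifts the exponential series by one place. Both sides are compared
  through a partial sum, whose last term contributes only beyond the weight of m.\<close>

lemma pd_mps_exp:
  fixes f :: "'a::field_char_0 mps"
  assumes "mps_coeff f 0 = 0"
  shows "pd i (mps_exp f) = pd i f * mps_exp f"
proof (rule mps_eqI)
  fix m
  let ?e = "\<lambda>k. mps_const (1 / fact k) * f ^ k"
  \<comment> \<open>The weight of \<open>m + var_mon i\<close>, the monomial that the derivative
    reads at m.\<close>
  let ?K = "wt m + Suc i"
  have vb: "vanish_below k (?e k)" for k
    by (intro vanish_below_mult_right vanish_below_power assms)
  have pd_e: "pd i (?e (Suc k)) = pd i f * ?e k" for k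
  proof -
    have "pd i (?e (Suc k)) = (mps_const (1 / fact (Suc k)) * mps_const (of_nat (Suc k))) * (f ^ k * pd i f)"
      by (simp only: pd_const_mult pd_power of_nat_mps mult.assoc)
    also have "mps_const (1 / fact (Suc k)) * mps_const (of_nat (Suc k)) = mps_const (1 / fact k :: 'a)"
      by (simp add: mps_const_mult field_simps del: of_nat_Suc)
    finally show ?thesis
      by (simp only: mult_ac)
  qed
  define E where "E = (\<Sum>k\<le>?K. ?e k)"
  have E: "mps_coeff (mps_exp f) p = mps_coeff E p" if "wt p \<le> ?K" for p
    unfolding mps_exp_def E_def by (simp add: coeff_mps_Sum [OF vb that] mps_coeff_sum)
  have "mps_coeff (pd i (mps_exp f)) m = mps_coeff (pd i E) m"
    by (simp add: mps_coeff_pd E)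
  also have "pd i E = (\<Sum>k\<le>?K. pd i (?e k))"
    unfolding E_def by (rule pd_sum)
  also have "\<dots> = (\<Sum>k<?K. pd i f * ?e k)"
  proof -
    have "pd i (?e 0) = 0"
      by (rule mps_eqI) (simp add: pd_const_mult)
    then show ?thesis
      unfolding lessThan_Suc_atMost [symmetric] sum.lessThan_Suc_shift pd_e by simp
  qed
  also have "mps_coeff \<dots> m = mps_coeff (pd i f * E) m"
  proof -
    have "pd i f * E = (\<Sum>k<?K. pd i f * ?e k) + pd i f * ?e ?K"
      unfolding E_def lessThan_Suc_atMost [symmetric] by (simp add: sum_distrib_left algebra_simps)
    moreover have "mps_coeff (pd i f * ?e ?K) m = 0"
      by (rule vanish_belowD [OF vanish_below_mult_right [OF vb]]) simp
    ultimately show ?thesis by simp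
  qed
  also have "\<dots> = mps_coeff (pd i f * mps_exp f) m"
    unfolding mps_coeff_mult by (intro sum.cong) (auto simp: E)
  finally show "mps_coeff (pd i (mps_exp f)) m = mps_coeff (pd i f * mps_exp f) m" .
qed

lemma coeff_mps_exp_0:
  assumes "mps_coeff f 0 = 0"
  shows "mps_coeff (mps_exp f) 0 = 1"
proof -
  have vb: "vanish_below k (mps_const (1 / fact k) * f ^ k)" for k
    by (intro vanish_below_mult_right vanish_below_power assms)
  show ?thesis
    unfolding mps_exp_def by (subst coeff_mps_Sum [OF vb, of 0 0]) simp_all
qed

lemma coeff_mps_log_0:
  assumes "mps_coeff f 0 = 1"
  shows "mps_coeff (mps_log f) 0 = 0"
proof -
  have vb: "vanish_below k (mps_const ((- 1) ^ (k - 1) / of_nat k) * (f - 1) ^ k)" for k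
    by (intro vanish_below_mult_right vanish_below_power) (use assms in simp)
  show ?thesis
    unfolding mps_log_def by (subst coeff_mps_Sum [OF vb, of 0 0]) simp_all
qed

text \<open>The differentiated series is geometric in 1 - f, and the factor f = 1 - (1 - f)
  telescopes it up to a power of order above the weight of m. Keeping f on the left avoids
  division.\<close>

lemma pd_mps_log:
  fixes f :: "'a::field_char_0 mps"
  assumes "mps_coeff f 0 = 1"
  shows "f * pd i (mps_log f) = pd i f"
proof (rule mps_eqI)
  fix m
  let ?l = "\<lambda>k. mps_const ((- 1) ^ (k - 1) / of_nat k) * (f - 1) ^ k"
  let ?K = "wt m + Suc i"
  have vb: "vanish_below k (?l k)" for k
    by (intro vanish_below_mult_right vanish_below_power) (use assms in simp)
  have pd_l: "pd i (?l (Suc k)) = (1 - f) ^ k * pd i f" for k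
  proof (rule mps_eqI)
    fix m
    have "(1 - f) ^ k = mps_const ((- 1) ^ k) * (f - 1) ^ k"
    proof -
      have "1 - f = mps_const (- 1) * (f - 1)"
        by (rule mps_eqI) simp
      then show ?thesis
        by (simp only: power_mult_distrib mps_const_power)
    qed
    then show "mps_coeff (pd i (?l (Suc k))) m = mps_coeff ((1 - f) ^ k * pd i f) m"
      by (simp add: pd_const_mult pd_power pd_diff of_nat_mps mult.assoc del: of_nat_Suc power_Suc)
  qed
  define L where "L = (\<Sum>k<?K. ?l (Suc k))"
  have L: "mps_coeff (mps_log f) p = mps_coeff L p" if "wt p \<le> ?K" for p
  proof -
    have "{1..} \<inter> {..?K} = Suc ` {..<?K}"
      unfolding image_Suc_lessThan by auto
    then show ?thesis
      unfolding mps_log_def L_def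
      by (simp only: coeff_mps_Sum [OF vb that] mps_coeff_sum sum.reindex inj_Suc inj_on_subset o_def
          subset_UNIV)
  qed
  have "mps_coeff (f * pd i (mps_log f)) m = mps_coeff (f * pd i L) m"
    unfolding mps_coeff_mult by (intro sum.cong) (auto simp: mps_coeff_pd L)
  also have "pd i L = (\<Sum>k<?K. pd i (?l (Suc k)))"
    unfolding L_def by (rule pd_sum)
  also have "f * \<dots> = (1 - (1 - f)) * (\<Sum>k<?K. (1 - f) ^ k) * pd i f"
    by (simp only: pd_l sum_distrib_right [symmetric] mult.assoc diff_diff_eq2 add_diff_cancel_left')
  also have "\<dots> = pd i f - (1 - f) ^ ?K * pd i f"
  proof -
    have "1 - (1 - f) ^ ?K = (1 - (1 - f)) * (\<Sum>k<?K. (1 - f) ^ k)"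
      by (rule one_diff_power_eq)
    then show ?thesis
      by (metis left_diff_distrib mult_1_left)
  qed
  also have "mps_coeff \<dots> m = mps_coeff (pd i f) m"
  proof -
    have "vanish_below ?K ((1 - f) ^ ?K * pd i f)"
      by (intro vanish_below_mult_left vanish_below_power) (use assms in simp)
    then show ?thesis
      by (simp add: vanish_belowD)
  qed
  finally show "mps_coeff (f * pd i (mps_log f)) m = mps_coeff (pd i f) m" .
qed

section \<open>Gaussian integration by parts\<close>

definition gauss_moment :: "real \<Rightarrow> nat \<Rightarrow> real" where
  "gauss_moment \<sigma> k = (\<integral>x. normal_density 0 \<sigma> x * x ^ k \<partial>lborel)"

lemma gauss_moment_0 [simp]: "0 < \<sigma> \<Longrightarrow> gauss_moment \<sigma> 0 = 1"
  by (simp add: gauss_moment_def)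

text \<open>Gaussian integration by parts in one dimension, read off from the closed form of the
  moments. For \<open>k = 0\<close> the truncated \<open>k - 1\<close> is multiplied by
  zero.\<close>

lemma gauss_moment_Suc:
  assumes "0 < \<sigma>"
  shows "gauss_moment \<sigma> (Suc k) = real k * \<sigma>\<^sup>2 * gauss_moment \<sigma> (k - 1)"
proof (cases "even k")
  case True
  have odd: "gauss_moment \<sigma> j = 0" if "odd j" for j
    using that integral_normal_moment_odd [OF assms, of 0] by (auto simp: gauss_moment_def elim!: oddE)
  show ?thesis
    using True odd [of "Suc k"] odd [of "k - 1"] by (cases "k = 0") auto
next
  case False
  then obtain l where k: "k = 2 * l + 1"
    by (elim oddE)
  have even: "gauss_moment \<sigma> (2 * j) = fact (2 * j) / ((2 / \<sigma>\<^sup>2) ^ j * fact j)" for j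
    using integral_normal_moment_even [OF assms, of 0 j] by (simp add: gauss_moment_def)
  have alg: "(2 * r + 2) * (2 * r + 1) * F / ((2 / s * A) * ((r + 1) * G)) = (2 * r + 1) * s * (F / (A * G))"
    if "r \<ge> 0" "s > 0" "A \<noteq> 0" "G \<noteq> 0" for r s A F G :: real
    using that by (simp add: divide_simps)
  have "gauss_moment \<sigma> (Suc k) = gauss_moment \<sigma> (2 * Suc l)"
    using k by simp
  also have "\<dots> = (2 * real l + 2) * (2 * real l + 1) * fact (2 * l) /
      ((2 / \<sigma>\<^sup>2 * (2 / \<sigma>\<^sup>2) ^ l) * ((real l + 1) * fact l))"
    unfolding even by (simp add: algebra_simps)
  also have "\<dots> = (2 * real l + 1) * \<sigma>\<^sup>2 * gauss_moment \<sigma> (2 * l)"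
    unfolding even by (rule alg) (use assms in auto)
  also have "2 * real l + 1 = real k"
    using k by simp
  finally show ?thesis
    using k by simp
qed

type_synonym point = "nat \<times> nat \<Rightarrow> real"

locale gue =
  fixes N :: nat
  assumes N_pos: "1 \<le> N"
begin

definition coords :: "(nat \<times> nat) set" where
  "coords = {..<N} \<times> {..<N}"

lemma finite_coords [simp]: "finite coords"
  by (simp add: coords_def)

text \<open>In Tr M^2 the diagonal coordinates have coefficient 1 and the others coefficient 2, so
  exp(- N Tr M^2 / 2) yields variance 1 / N on the diagonal and 1 / (2 N) off it.\<close>

definition dev :: "nat \<times> nat \<Rightarrow> real" where
  "dev e = (if fst e = snd e then sqrt (1 / N) else sqrt (1 / (2 * N)))"

lemma dev_pos: "0 < dev e"
  using N_pos by (simp add: dev_def)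

lemma dev_sq: "(dev e)\<^sup>2 = (if fst e = snd e then 1 / N else 1 / (2 * N))"
  using N_pos by (simp add: dev_def)

abbreviation base :: "point measure" where
  "base \<equiv> PiM coords (\<lambda>_. lborel)"

definition dens :: "point \<Rightarrow> real" where
  "dens x = (\<Prod>e\<in>coords. normal_density 0 (dev e) (x e))"

definition mono_fun :: "(nat \<times> nat \<Rightarrow> nat) \<Rightarrow> point \<Rightarrow> real" where
  "mono_fun k x = (\<Prod>e\<in>coords. x e ^ k e)"

definition expect :: "(point \<Rightarrow> complex) \<Rightarrow> complex" where
  "expect f = (\<integral>x. complex_of_real (dens x) * f x \<partial>base)"

definition gint :: "(point \<Rightarrow> complex) \<Rightarrow> bool" where
  "gint f \<longleftrightarrow> integrable base (\<lambda>x. complex_of_real (dens x) * f x)"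

lemma gint_add: "gint f \<Longrightarrow> gint g \<Longrightarrow> gint (\<lambda>x. f x + g x)"
  by (simp add: gint_def distrib_left)

lemma expect_add: "gint f \<Longrightarrow> gint g \<Longrightarrow> expect (\<lambda>x. f x + g x) = expect f + expect g"
  by (simp add: gint_def expect_def distrib_left)

lemma gint_scale: "gint f \<Longrightarrow> gint (\<lambda>x. c * f x)"
  unfolding gint_def by (subst mult.left_commute) (rule integrable_mult_right)

lemma expect_scale: "expect (\<lambda>x. c * f x) = c * expect f"
  unfolding expect_def by (subst mult.left_commute) (rule integral_mult_right_zero)

lemma gint_0: "gint (\<lambda>x. 0)"
  by (simp add: gint_def)

lemma expect_0: "expect (\<lambda>x. 0) = 0"
  by (simp add: expect_def)

lemma gint_sum: "(\<And>a. a \<in> A \<Longrightarrow> gint (f a)) \<Longrightarrow> gint (\<lambda>x. \<Sum>a\<in>A. f a x)"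
  by (induction A rule: infinite_finite_induct) (auto intro: gint_add gint_0)

lemma expect_sum: "(\<And>a. a \<in> A \<Longrightarrow> gint (f a)) \<Longrightarrow> expect (\<lambda>x. \<Sum>a\<in>A. f a x) = (\<Sum>a\<in>A. expect (f a))"
  by (induction A rule: infinite_finite_induct) (auto simp: expect_add expect_0 gint_sum)

lemma mono_integrals:
  shows gint_mono: "gint (\<lambda>x. complex_of_real (mono_fun k x))"
    and expect_mono: "expect (\<lambda>x. complex_of_real (mono_fun k x)) =
      complex_of_real (\<Prod>e\<in>coords. gauss_moment (dev e) (k e))"
proof -
  interpret product_sigma_finite "\<lambda>_ :: nat \<times> nat. lborel :: real measure"
    by standard
  have int: "integrable lborel (\<lambda>x. normal_density 0 (dev e) x * x ^ k e)" for e
    using integrable_normal_moment [OF dev_pos, of 0] by simp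
  have eq: "dens x * mono_fun k x = (\<Prod>e\<in>coords. normal_density 0 (dev e) (x e) * x e ^ k e)" for x
    by (simp add: dens_def mono_fun_def prod.distrib)
  have int_prod: "integrable base (\<lambda>x. dens x * mono_fun k x)"
    unfolding eq by (rule product_integrable_prod) (use int in auto)
  then show "gint (\<lambda>x. complex_of_real (mono_fun k x))"
    unfolding gint_def of_real_mult [symmetric] by (rule integrable_of_real)
  have "(\<integral>x. dens x * mono_fun k x \<partial>base) = (\<Prod>e\<in>coords. gauss_moment (dev e) (k e))"
    unfolding eq gauss_moment_def by (rule product_integral_prod) (use int in auto)
  then show "expect (\<lambda>x. complex_of_real (mono_fun k x)) =
      complex_of_real (\<Prod>e\<in>coords. gauss_moment (dev e) (k e))"
    unfolding expect_def of_real_mult [symmetric] using int_prod by (subst integral_of_real) simp_all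
qed

lemma mono_fun_Suc:
  assumes "e \<in> coords"
  shows "mono_fun (k(e := Suc (k e))) x = x e * mono_fun k x"
proof -
  have "mono_fun (k(e := Suc (k e))) x = x e ^ Suc (k e) * (\<Prod>e'\<in>coords - {e}. x e' ^ k e')"
    unfolding mono_fun_def using assms by (subst prod.remove [of _ e]) (auto intro!: prod.cong)
  moreover have "mono_fun k x = x e ^ k e * (\<Prod>e'\<in>coords - {e}. x e' ^ k e')"
    unfolding mono_fun_def using assms by (subst prod.remove [of _ e]) auto
  ultimately show ?thesis
    by simp
qed

text \<open>The second argument carries the partial derivatives of the polynomial function.\<close>

inductive polyd :: "(point \<Rightarrow> complex) \<Rightarrow>
    (nat \<times> nat \<Rightarrow> point \<Rightarrow> complex) \<Rightarrow> bool" where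
  mono: "polyd (\<lambda>x. complex_of_real (mono_fun k x))
     (\<lambda>e x. of_nat (k e) * complex_of_real (mono_fun (k(e := k e - 1)) x))"
| add: "polyd f D \<Longrightarrow> polyd g D' \<Longrightarrow> polyd (\<lambda>x. f x + g x) (\<lambda>e x. D e x + D' e x)"
| scale: "polyd f D \<Longrightarrow> polyd (\<lambda>x. c * f x) (\<lambda>e x. c * D e x)"

lemma polyd_gint: "polyd f D \<Longrightarrow> gint f"
  by (induction rule: polyd.induct) (auto intro: gint_mono gint_add gint_scale)

lemma polyd_gint_deriv: "polyd f D \<Longrightarrow> gint (D e)"
  by (induction rule: polyd.induct) (auto intro: gint_mono gint_add gint_scale)

text \<open>On a monomial only the factor in coordinate \<open>e\<close> changes, and there the
  claim is \<open>gauss_moment_Suc\<close>; the rest is linearity. Integrability is part of the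
  induction because the expectation of a sum needs it.\<close>

lemma polyd_stein:
  assumes "polyd f D" "e \<in> coords"
  shows "gint (\<lambda>x. complex_of_real (x e) * f x) \<and>
    expect (\<lambda>x. complex_of_real (x e) * f x) = of_real ((dev e)\<^sup>2) * expect (D e)"
  using assms(1)
proof (induction rule: polyd.induct)
  case (mono k)
  have "(\<Prod>e'\<in>coords. gauss_moment (dev e') ((k(e := Suc (k e))) e'))
     = gauss_moment (dev e) (Suc (k e)) * (\<Prod>e'\<in>coords - {e}. gauss_moment (dev e') (k e'))"
    using assms(2) by (subst prod.remove [of _ e]) (auto intro!: prod.cong)
  also have "\<dots> = real (k e) * (dev e)\<^sup>2 * (gauss_moment (dev e) (k e - 1) *
      (\<Prod>e'\<in>coords - {e}. gauss_moment (dev e') (k e')))"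
    by (simp add: gauss_moment_Suc dev_pos)
  also have "gauss_moment (dev e) (k e - 1) * (\<Prod>e'\<in>coords - {e}. gauss_moment (dev e') (k e'))
     = (\<Prod>e'\<in>coords. gauss_moment (dev e') ((k(e := k e - 1)) e'))"
    using assms(2) by (subst (2) prod.remove [of _ e]) (auto intro!: prod.cong)
  finally show ?case
    unfolding of_real_mult [symmetric] mono_fun_Suc [OF assms(2), symmetric]
    by (simp only: gint_mono expect_mono expect_scale) simp
next
  case (add f D g D')
  then show ?case
    using polyd_gint_deriv by (simp add: distrib_left gint_add expect_add)
next
  case (scale f D c)
  then show ?case
    unfolding mult.left_commute [of _ c] by (simp add: gint_scale expect_scale)
qed

text \<open>Multipliers of the class \<^const>\<open>polyd\<close> are closed under products by construction.\<close>

definition multd :: "(point \<Rightarrow> complex) \<Rightarrow>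
    (nat \<times> nat \<Rightarrow> point \<Rightarrow> complex) \<Rightarrow> bool" where
  "multd f D \<longleftrightarrow> (\<forall>g D'. polyd g D' \<longrightarrow>
     polyd (\<lambda>x. f x * g x) (\<lambda>e x. D e x * g x + f x * D' e x))"

lemma multdD: "multd f D \<Longrightarrow> polyd g D' \<Longrightarrow>
     polyd (\<lambda>x. f x * g x) (\<lambda>e x. D e x * g x + f x * D' e x)"
  by (simp add: multd_def)

lemma polyd_one: "polyd (\<lambda>x. 1) (\<lambda>e x. 0)"
  using polyd.mono [of "\<lambda>_. 0"] by (simp add: mono_fun_def)

lemma multd_polyd: "multd f D \<Longrightarrow> polyd f D"
  using multdD [OF _ polyd_one] by simp

lemma multd_const: "multd (\<lambda>x. c) (\<lambda>e x. 0)"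
  unfolding multd_def using polyd.scale by simp

lemma multd_add: "multd f D \<Longrightarrow> multd g D' \<Longrightarrow> multd (\<lambda>x. f x + g x) (\<lambda>e x. D e x + D' e x)"
  unfolding multd_def
proof (intro allI impI)
  fix h D''
  assume *: "\<forall>g D'. polyd g D' \<longrightarrow> polyd (\<lambda>x. f x * g x) (\<lambda>e x. D e x * g x + f x * D' e x)"
    "\<forall>h D''. polyd h D'' \<longrightarrow> polyd (\<lambda>x. g x * h x) (\<lambda>e x. D' e x * h x + g x * D'' e x)"
    "polyd h D''"
  then have "polyd (\<lambda>x. f x * h x + g x * h x)
      (\<lambda>e x. (D e x * h x + f x * D'' e x) + (D' e x * h x + g x * D'' e x))"
    by (intro polyd.add) auto
  then show "polyd (\<lambda>x. (f x + g x) * h x) (\<lambda>e x. (D e x + D' e x) * h x + (f x + g x) * D'' e x)"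
    by (simp add: algebra_simps)
qed

lemma multd_mult:
  assumes "multd f D" "multd g D'"
  shows "multd (\<lambda>x. f x * g x) (\<lambda>e x. D e x * g x + f x * D' e x)"
  unfolding multd_def
proof (intro allI impI)
  fix h D''
  assume "polyd h D''"
  from multdD [OF assms(1) multdD [OF assms(2) this]]
  show "polyd (\<lambda>x. f x * g x * h x)
     (\<lambda>e x. (D e x * g x + f x * D' e x) * h x + f x * g x * D'' e x)"
    by (simp add: algebra_simps)
qed

text \<open>The Leibniz rule for multiplication by a coordinate, checked on monomials. Together with
  constants, sums and products it makes every polynomial in the coordinates a multiplier.\<close>

lemma multd_coord:
  assumes "e' \<in> coords"
  shows "multd (\<lambda>x. complex_of_real (x e')) (\<lambda>e x. if e = e' then 1 else 0)"
  unfolding multd_def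
proof (intro allI impI)
  fix g D'
  assume "polyd g D'"
  then show "polyd (\<lambda>x. complex_of_real (x e') * g x)
      (\<lambda>e x. (if e = e' then 1 else 0) * g x + complex_of_real (x e') * D' e x)"
  proof (induction rule: polyd.induct)
    case (mono k)
    have "complex_of_real (mono_fun (k(e' := Suc (k e'))) x) =
       complex_of_real (x e') * complex_of_real (mono_fun k x)" for x
      using mono_fun_Suc [OF assms] by simp
    moreover have "of_nat ((k(e' := Suc (k e'))) e) *
        complex_of_real (mono_fun ((k(e' := Suc (k e')))(e := (k(e' := Suc (k e'))) e - 1)) x)
       = (if e = e' then 1 else 0) * complex_of_real (mono_fun k x) +
         complex_of_real (x e') * (of_nat (k e) * complex_of_real (mono_fun (k(e := k e - 1)) x))" for e x
    proof (cases "e = e'")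
      case True
      show ?thesis
      proof (cases "k e'")
        case (Suc j)
        have "x e' * mono_fun (k(e' := j)) x = mono_fun k x"
          using mono_fun_Suc [OF assms, of "k(e' := j)" x] Suc by (simp add: fun_upd_idem)
        then have "complex_of_real (x e') * complex_of_real (mono_fun (k(e' := j)) x) =
            complex_of_real (mono_fun k x)"
          by (metis of_real_mult)
        then show ?thesis
          using True Suc by (simp add: algebra_simps fun_upd_idem)
      qed (use True in \<open>simp add: fun_upd_idem\<close>)
    next
      case False
      have "(k(e' := Suc (k e')))(e := k e - 1) = (k(e := k e - 1))(e' := Suc ((k(e := k e - 1)) e'))"
        using False by (simp add: fun_upd_twist)
      then show ?thesis
        using False mono_fun_Suc [OF assms, of "k(e := k e - 1)" x] by simp
    qed
    ultimately show ?case
      using polyd.mono [of "k(e' := Suc (k e'))"] by presburger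
  next
    case (add f D g D')
    from polyd.add [OF add.IH] show ?case
      by (simp add: algebra_simps)
  next
    case (scale f D c)
    from polyd.scale [OF scale.IH, of c] show ?case
      by (simp add: algebra_simps)
  qed
qed

lemma multd_scale: "multd f D \<Longrightarrow> multd (\<lambda>x. c * f x) (\<lambda>e x. c * D e x)"
  using multd_mult [OF multd_const] by simp

lemma multd_sum:
  "(\<And>a. a \<in> A \<Longrightarrow> multd (f a) (D a)) \<Longrightarrow> multd (\<lambda>x. \<Sum>a\<in>A. f a x) (\<lambda>e x. \<Sum>a\<in>A. D a e x)"
proof (induction A rule: infinite_finite_induct)
  case (insert a A)
  then show ?case
    using multd_add [of "f a" "D a" "\<lambda>x. \<Sum>a\<in>A. f a x"] by simp
qed (simp_all add: multd_const)

section \<open>Matrix entries as linear forms in the coordinates, their covariance, and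
  derivatives\<close>

definition ent_coeff :: "nat \<Rightarrow> nat \<Rightarrow> nat \<times> nat \<Rightarrow> complex" where
  "ent_coeff i j e = (if i = j then (if e = (i, i) then 1 else 0)
     else if i < j then (if e = (i, j) then 1 else if e = (j, i) then \<i> else 0)
     else (if e = (j, i) then 1 else if e = (i, j) then - \<i> else 0))"

definition ent :: "nat \<Rightarrow> nat \<Rightarrow> point \<Rightarrow> complex" where
  "ent i j x = hermitian_mat N x $$ (i, j)"

lemma sum_two_points:
  fixes g :: "'b \<Rightarrow> complex"
  assumes "finite A" "a \<in> A" "b \<in> A" "a \<noteq> b"
  shows "(\<Sum>e\<in>A. (if e = a then u else if e = b then v else 0) * g e) = u * g a + v * g b"
proof -
  have "(\<Sum>e\<in>A. (if e = a then u else if e = b then v else 0) * g e) =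
    (\<Sum>e\<in>A. (if e = a then u * g e else 0) + (if e = b then v * g e else 0))"
    using assms(4) by (intro sum.cong) auto
  then show ?thesis
    using assms by (simp add: sum.distrib)
qed

lemma sum_ent_coeff:
  assumes "i < N" "j < N"
  shows "(\<Sum>e\<in>coords. ent_coeff i j e * g e) =
    (if i = j then g (i, i) else if i < j then g (i, j) + \<i> * g (j, i) else g (j, i) - \<i> * g (i, j))"
proof -
  have c: "(i, j) \<in> coords" "(j, i) \<in> coords" "(i, i) \<in> coords"
    using assms by (auto simp: coords_def)
  show ?thesis
  proof (cases i j rule: linorder_cases)
    case less
    then show ?thesis
      using sum_two_points [OF finite_coords c(1,2), of 1 "\<i>" g]
      by (simp add: ent_coeff_def)
  next
    case equal
    have "(\<Sum>e\<in>coords. ent_coeff i j e * g e) = (\<Sum>e\<in>coords. if e = (i, i) then g e else 0)"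
      using equal by (intro sum.cong) (auto simp: ent_coeff_def)
    then show ?thesis
      using c equal by simp
  next
    case greater
    then show ?thesis
      using sum_two_points [OF finite_coords c(2,1), of 1 "- \<i>" g]
      by (simp add: ent_coeff_def)
  qed
qed

lemma ent_eq:
  assumes "i < N" "j < N"
  shows "ent i j x = (\<Sum>e\<in>coords. ent_coeff i j e * complex_of_real (x e))"
  unfolding sum_ent_coeff [OF assms]
  using assms by (auto simp: ent_def hermitian_mat_def complex_eq_iff)

text \<open>The propagator of the ensemble. Off the diagonal the real and the imaginary part
  contribute 1 / (2 N) each up to sign: they cancel for the pair (i, j), (i, j) and add up for (i,
  j), (j, i).\<close>

lemma covariance:
  assumes "i < N" "j < N" "k < N" "l < N"
  shows "of_nat N * (\<Sum>e\<in>coords. ent_coeff i j e * (of_real ((dev e)\<^sup>2) * ent_coeff k l e)) =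
    (if i = l \<and> j = k then 1 else 0)"
  unfolding sum_ent_coeff [OF assms(1,2)]
  using N_pos
  by (cases i j rule: linorder_cases; cases k l rule: linorder_cases)
     (auto simp: dev_sq ent_coeff_def field_simps)

text \<open>Normalised so that integration by parts against the entry (i, j) produces exactly 1 / N
  times this quantity; by \<open>covariance\<close> it is the derivative with respect to the entry
  (j, i).\<close>

definition grad :: "(nat \<times> nat \<Rightarrow> point \<Rightarrow> complex) \<Rightarrow>
    nat \<Rightarrow> nat \<Rightarrow> point \<Rightarrow> complex" where
  "grad D i j x = of_nat N * (\<Sum>e\<in>coords. ent_coeff i j e * (of_real ((dev e)\<^sup>2) * D e x))"

text \<open>\<open>gradp f G\<close>: \<open>f\<close> is a polynomial in the matrix entries, with \<open>G i j\<close> its derivative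
  with respect to the entry \<open>(j, i)\<close>.\<close>

definition gradp :: "(point \<Rightarrow> complex) \<Rightarrow>
    (nat \<Rightarrow> nat \<Rightarrow> point \<Rightarrow> complex) \<Rightarrow> bool" where
  "gradp f G \<longleftrightarrow> (\<exists>D. multd f D \<and> (\<forall>i<N. \<forall>j<N. \<forall>x. G i j x = grad D i j x))"

lemma gradp_cong: "gradp f G \<Longrightarrow> (\<And>x. f x = f' x) \<Longrightarrow>
    (\<And>i j x. i < N \<Longrightarrow> j < N \<Longrightarrow> G i j x = G' i j x) \<Longrightarrow> gradp f' G'"
  unfolding gradp_def by (metis ext)

lemma gradp_const: "gradp (\<lambda>x. c) (\<lambda>i j x. 0)"
  unfolding gradp_def by (intro exI conjI, rule multd_const) (simp add: grad_def)

lemma gradp_add: "gradp f G \<Longrightarrow> gradp g G' \<Longrightarrow> gradp (\<lambda>x. f x + g x) (\<lambda>i j x. G i j x + G' i j x)"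
  unfolding gradp_def
  by (elim exE conjE, intro exI conjI, erule (1) multd_add)
     (simp add: grad_def distrib_left sum.distrib)

lemma gradp_mult: "gradp f G \<Longrightarrow> gradp g G' \<Longrightarrow>
    gradp (\<lambda>x. f x * g x) (\<lambda>i j x. G i j x * g x + f x * G' i j x)"
  unfolding gradp_def
proof (elim exE conjE, intro exI conjI, erule (1) multd_mult, intro allI impI)
  fix D D' i j x
  assume "\<forall>i<N. \<forall>j<N. \<forall>x. G i j x = grad D i j x" "\<forall>i<N. \<forall>j<N. \<forall>x. G' i j x = grad D' i j x"
    "i < N" "j < N"
  then have "G i j x = grad D i j x" "G' i j x = grad D' i j x"
    by auto
  then show "G i j x * g x + f x * G' i j x = grad (\<lambda>e x. D e x * g x + f x * D' e x) i j x"
    by (simp add: grad_def sum_distrib_left sum_distrib_right distrib_left sum.distrib mult_ac)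
qed

lemma gradp_scale: "gradp f G \<Longrightarrow> gradp (\<lambda>x. c * f x) (\<lambda>i j x. c * G i j x)"
  using gradp_mult [OF gradp_const] by simp

lemma gradp_sum:
  "(\<And>a. a \<in> A \<Longrightarrow> gradp (f a) (G a)) \<Longrightarrow> gradp (\<lambda>x. \<Sum>a\<in>A. f a x) (\<lambda>i j x. \<Sum>a\<in>A. G a i j x)"
proof (induction A rule: infinite_finite_induct)
  case (insert a A)
  then show ?case
    using gradp_add [of "f a" "G a" "\<lambda>x. \<Sum>a\<in>A. f a x"] by simp
qed (simp_all add: gradp_const)

lemma gradp_ent:
  assumes "k < N" "l < N"
  shows "gradp (ent k l) (\<lambda>i j x. if i = l \<and> j = k then 1 else 0)"
  unfolding gradp_def
proof (intro exI conjI allI impI)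
  have eq: "(\<Sum>e'\<in>coords. ent_coeff k l e' * (if e = e' then 1 else 0)) = ent_coeff k l e" if "e \<in> coords" for e
  proof -
    have "(\<Sum>e'\<in>coords. ent_coeff k l e' * (if e = e' then 1 else 0)) =
        (\<Sum>e'\<in>coords. if e' = e then ent_coeff k l e' else 0)"
      by (intro sum.cong) auto
    then show ?thesis
      using that by simp
  qed
  show "multd (ent k l) (\<lambda>e x. \<Sum>e'\<in>coords. ent_coeff k l e' * (if e = e' then 1 else 0))"
    unfolding ent_eq [OF assms, abs_def]
    by (intro multd_sum multd_scale multd_coord)
  fix i j x
  assume "i < N" "j < N"
  then show "(if i = l \<and> j = k then 1 else 0) =
      grad (\<lambda>e x. \<Sum>e'\<in>coords. ent_coeff k l e' * (if e = e' then 1 else 0)) i j x"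
    using covariance [OF _ _ assms, of i j] by (simp add: grad_def eq)
qed

lemma gradp_gint: "gradp f G \<Longrightarrow> gint f"
  unfolding gradp_def using multd_polyd polyd_gint by blast

lemma gradp_gint_deriv:
  assumes "gradp f G" "i < N" "j < N"
  shows "gint (G i j)"
proof -
  obtain D where D: "multd f D" "G i j = grad D i j"
    using assms unfolding gradp_def by blast
  show ?thesis
    unfolding D(2) grad_def [abs_def]
    by (intro gint_scale gint_sum polyd_gint_deriv [OF multd_polyd [OF D(1)]])
qed

lemma gradp_stein:
  assumes "gradp f G" "i < N" "j < N"
  shows "expect (\<lambda>x. ent i j x * f x) = 1 / of_nat N * expect (G i j)"
proof -
  obtain D where D: "multd f D" "G i j = grad D i j"
    using assms unfolding gradp_def by blast
  note P = multd_polyd [OF D(1)]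
  have "expect (\<lambda>x. ent i j x * f x) = expect (\<lambda>x. \<Sum>e\<in>coords. ent_coeff i j e * (complex_of_real (x e) * f x))"
    unfolding ent_eq [OF assms(2,3)] by (simp only: sum_distrib_right mult.assoc)
  also have "\<dots> = (\<Sum>e\<in>coords. ent_coeff i j e * (of_real ((dev e)\<^sup>2) * expect (D e)))"
    using polyd_stein [OF P] by (subst expect_sum) (auto intro!: gint_scale simp: expect_scale)
  also have "\<dots> = expect (\<lambda>x. \<Sum>e\<in>coords. ent_coeff i j e * (of_real ((dev e)\<^sup>2) * D e x))"
    by (subst expect_sum) (auto intro!: gint_scale polyd_gint_deriv [OF P] simp: expect_scale)
  also have "\<dots> = 1 / of_nat N * expect (G i j)"
    unfolding D(2) grad_def [abs_def] expect_scale using N_pos by simp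
  finally show ?thesis .
qed

section \<open>The normalised Hermitian integral as a Gaussian expectation\<close>

lemma expect_one: "expect (\<lambda>x. 1) = 1"
  using expect_mono [of "\<lambda>_. 0"] by (simp add: mono_fun_def dev_pos)

lemma mat_trace_sq:
  "mat_trace (hermitian_mat N x ^\<^sub>m 2) =
     complex_of_real (\<Sum>e\<in>coords. (if fst e = snd e then 1 else 2) * (x e)\<^sup>2)"
proof -
  have "mat_trace (hermitian_mat N x ^\<^sub>m 2) = (\<Sum>i<N. \<Sum>j<N. ent i j x * ent j i x)"
    by (simp add: mat_trace_def numeral_2_eq_2 scalar_prod_def ent_def hermitian_mat_def
        lessThan_atLeast0)
  also have "\<dots> = (\<Sum>i<N. \<Sum>j<N. complex_of_real (if i = j then (x (i, i))\<^sup>2 else (x (i, j))\<^sup>2 + (x (j, i))\<^sup>2))"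
    by (intro sum.cong refl) (auto simp: ent_def hermitian_mat_def complex_eq_iff power2_eq_square)
  also have "\<dots> = complex_of_real (\<Sum>i<N. \<Sum>j<N. if i = j then (x (i, i))\<^sup>2 else (x (i, j))\<^sup>2 + (x (j, i))\<^sup>2)"
    by simp
  also have "(\<Sum>i<N. \<Sum>j<N. if i = j then (x (i, i))\<^sup>2 else (x (i, j))\<^sup>2 + (x (j, i))\<^sup>2) =
     (\<Sum>i<N. \<Sum>j<N. if i = j then (x (i, i))\<^sup>2 else (x (i, j))\<^sup>2) +
     (\<Sum>i<N. \<Sum>j<N. if i = j then 0 else (x (j, i))\<^sup>2)"
    by (simp only: sum.distrib [symmetric]) (intro sum.cong refl, auto)
  also have "(\<Sum>i<N. \<Sum>j<N. if i = j then 0 else (x (j, i))\<^sup>2) =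
     (\<Sum>i<N. \<Sum>j<N. if i = j then 0 else (x (i, j))\<^sup>2)"
    by (subst sum.swap) (intro sum.cong refl, auto)
  also have "(\<Sum>i<N. \<Sum>j<N. if i = j then (x (i, i))\<^sup>2 else (x (i, j))\<^sup>2) + \<dots> =
     (\<Sum>i<N. \<Sum>j<N. (if i = j then 1 else 2) * (x (i, j))\<^sup>2)"
    by (simp only: sum.distrib [symmetric]) (intro sum.cong refl, auto)
  finally show ?thesis
    by (simp add: coords_def sum.cartesian_product case_prod_unfold)
qed

lemma gauss_weight_eq:
  "gauss_weight N (hermitian_mat N x) =
     complex_of_real (\<Prod>e\<in>coords. sqrt (2 * pi * (dev e)\<^sup>2)) * complex_of_real (dens x)"
proof -
  have e: "exp (- (x e)\<^sup>2 / (2 * (dev e)\<^sup>2)) =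
      sqrt (2 * pi * (dev e)\<^sup>2) * normal_density 0 (dev e) (x e)" for e
    using dev_pos [of e] by (simp add: normal_density_def real_sqrt_mult)
  have "gauss_weight N (hermitian_mat N x) =
     complex_of_real (exp (\<Sum>e\<in>coords. - real N * ((if fst e = snd e then 1 else 2) * (x e)\<^sup>2) / 2))"
    unfolding gauss_weight_def mat_trace_sq
    by (simp add: exp_of_real [symmetric] sum_distrib_left sum_negf sum_divide_distrib)
  also have "(\<Sum>e\<in>coords. - real N * ((if fst e = snd e then 1 else 2) * (x e)\<^sup>2) / 2) =
     (\<Sum>e\<in>coords. - (x e)\<^sup>2 / (2 * (dev e)\<^sup>2))"
    by (intro sum.cong refl) (auto simp: dev_sq)
  also have "exp \<dots> = (\<Prod>e\<in>coords. exp (- (x e)\<^sup>2 / (2 * (dev e)\<^sup>2)))"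
    by (rule exp_sum) simp
  finally show ?thesis
    unfolding e by (simp add: dens_def prod.distrib)
qed

text \<open>By \<open>gauss_weight_eq\<close> the weight is a nonzero constant times the probability
  density, and the constant cancels in the quotient.\<close>

lemma hermitian_expectation:
  "hermitian_integral N (\<lambda>M. gauss_weight N M * f M) / hermitian_integral N (gauss_weight N)
    = expect (\<lambda>x. f (hermitian_mat N x))"
proof -
  let ?C = "complex_of_real (\<Prod>e\<in>coords. sqrt (2 * pi * (dev e)\<^sup>2))"
  have C: "?C \<noteq> 0"
    using dev_pos by (simp add: less_imp_neq [symmetric])
  have "hermitian_integral N (\<lambda>M. gauss_weight N M * f M) = ?C * expect (\<lambda>x. f (hermitian_mat N x))" for f
    unfolding hermitian_integral_def expect_def gauss_weight_eq mult.assoc coords_def [symmetric]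
    by (rule integral_mult_right_zero)
  from this [of f] this [of "\<lambda>_. 1"] show ?thesis
    using C by (simp add: expect_one)
qed

end

section \<open>Loop equations\<close>

lemma add_var_mon_eq_iff: "m + var_mon b = var_mon a \<longleftrightarrow> m = 0 \<and> a = b"
proof
  assume *: "m + var_mon b = var_mon a"
  then have "expo (m + var_mon b) b = expo (var_mon a) b"
    by simp
  then have "a = b"
    by (auto simp: lookup_add lookup_single when_def split: if_splits)
  with * show "m = 0 \<and> a = b"
    by simp
qed auto

lemma pd_indet: "pd b (indet (Suc a)) = (if a = b then 1 else 0)"
proof (rule mps_eqI)
  fix m :: monomial
  show "mps_coeff (pd b (indet (Suc a))) m = mps_coeff (if a = b then 1 else 0) m"
    by (auto simp: mps_coeff_pd mps_coeff_indet mps_coeff_one add_var_mon_eq_iff)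
qed

lemma mps_coeff_indet_0 [simp]: "mps_coeff (indet (Suc a)) 0 = 0"
  using mps_coeff_indet [of a 0] by (metis wt_0 wt_var_mon nat.distinct(1))

text \<open>Multiplication by an indeterminate either kills a coefficient or moves it. The monomial
  m' is the same for all f, so expectations pass through such a product.\<close>

lemma indet_mult_cases:
  obtains "expo m i = 0" "\<And>f :: 'a::comm_ring_1 mps. mps_coeff (indet (Suc i) * f) m = 0"
  | m' where "m = m' + var_mon i" "\<And>f :: 'a::comm_ring_1 mps. mps_coeff (indet (Suc i) * f) m = mps_coeff f m'"
proof (cases "expo m i")
  case 0
  then show ?thesis
    using that(1) mps_coeff_indet_mult_eq_0 by blast
next
  case (Suc k)
  then obtain m' where "m = m' + var_mon i"
    using monomial_split [of m i] by auto
  then show ?thesis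
    using that(2) mps_coeff_indet_mult by blast
qed

lemma mps_coeff_mult_cong:
  assumes "\<And>q. wt q \<le> wt m \<Longrightarrow> mps_coeff g q = mps_coeff h q"
  shows "mps_coeff (f * g) m = mps_coeff (f * h) m"
  unfolding mps_coeff_mult using assms by (intro sum.cong) auto

lemma coeff_mps_Sum_indet:
  assumes "wt m \<le> K"
  shows "mps_coeff (mps_Sum {1..} (\<lambda>n. indet n * f n)) m =
    (\<Sum>a<K. mps_coeff (indet (Suc a) * f (Suc a)) m)"
proof -
  have "mps_coeff (mps_Sum {1..} (\<lambda>n. indet n * f n)) m =
      (\<Sum>n\<in>{1..} \<inter> {..K}. mps_coeff (indet n * f n) m)"
    by (rule coeff_mps_Sum [OF _ assms]) (intro vanish_below_mult_left vanish_below_indet)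
  also have "{1..} \<inter> {..K} = Suc ` {..<K}"
    unfolding image_Suc_lessThan by auto
  finally show ?thesis
    by (simp add: sum.reindex)
qed

context gue
begin

section \<open>Powers and traces of the random matrix\<close>

definition pw :: "nat \<Rightarrow> nat \<Rightarrow> nat \<Rightarrow> point \<Rightarrow> complex" where
  "pw n i j x = (hermitian_mat N x ^\<^sub>m n) $$ (i, j)"

definition tr :: "nat \<Rightarrow> point \<Rightarrow> complex" where
  "tr n x = mat_trace (hermitian_mat N x ^\<^sub>m n)"

lemma herm_carrier: "hermitian_mat N x \<in> carrier_mat N N"
  by (simp add: hermitian_mat_def)

lemma pow_carrier: "hermitian_mat N x ^\<^sub>m n \<in> carrier_mat N N"
  by (rule pow_carrier_mat [OF herm_carrier])

lemma tr_eq: "tr n x = (\<Sum>i<N. pw n i i x)"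
  using pow_carrier [of x n] herm_carrier [of x] by (simp add: tr_def mat_trace_def pw_def)

lemma pw_0: "i < N \<Longrightarrow> j < N \<Longrightarrow> pw 0 i j x = (if i = j then 1 else 0)"
  using herm_carrier [of x] by (simp add: pw_def)

lemma pw_Suc:
  assumes "i < N" "j < N"
  shows "pw (Suc n) i j x = (\<Sum>a<N. pw n i a x * ent a j x)"
  using assms herm_carrier [of x] pow_carrier [of x n]
  by (auto simp: pw_def ent_def scalar_prod_def lessThan_atLeast0 intro!: sum.cong)

lemma pw_add:
  assumes "i < N" "j < N"
  shows "pw (m + n) i j x = (\<Sum>a<N. pw m i a x * pw n a j x)"
  using assms(2)
proof (induction n arbitrary: j)
  case 0
  have "(\<Sum>a<N. pw m i a x * pw 0 a j x) = (\<Sum>a<N. if a = j then pw m i a x else 0)"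
    using 0 by (intro sum.cong) (auto simp: pw_0)
  then show ?case
    using 0 by simp
next
  case (Suc n)
  have "pw (m + Suc n) i j x = (\<Sum>b<N. (\<Sum>a<N. pw m i a x * pw n a b x) * ent b j x)"
    using assms(1) Suc by (simp add: pw_Suc)
  also have "\<dots> = (\<Sum>a<N. \<Sum>b<N. pw m i a x * (pw n a b x * ent b j x))"
    by (subst sum.swap) (simp add: sum_distrib_right mult.assoc)
  finally show ?case
    using Suc.prems by (simp add: pw_Suc sum_distrib_left)
qed

lemma pw_1:
  assumes "i < N" "j < N"
  shows "pw (Suc 0) i j x = ent i j x"
proof -
  have "pw (Suc 0) i j x = (\<Sum>a<N. if a = i then ent a j x else 0)"
    unfolding pw_Suc [OF assms] using assms by (intro sum.cong) (auto simp: pw_0)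
  then show ?thesis
    using assms by simp
qed

lemma pw_Suc_left:
  assumes "i < N" "j < N"
  shows "pw (Suc n) i j x = (\<Sum>a<N. ent i a x * pw n a j x)"
proof -
  have "pw (Suc n) i j x = pw (Suc 0 + n) i j x"
    by simp
  also have "\<dots> = (\<Sum>a<N. pw (Suc 0) i a x * pw n a j x)"
    by (rule pw_add [OF assms])
  also have "\<dots> = (\<Sum>a<N. ent i a x * pw n a j x)"
    using assms by (intro sum.cong) (auto simp: pw_1)
  finally show ?thesis .
qed

text \<open>Noncommutative Leibniz rule: the derivative removes one of the n factors and cuts the
  product into M^p and M^(n-1-p).\<close>

lemma gradp_pw:
  assumes "k < N" "l < N"
  shows "gradp (pw n k l) (\<lambda>i j x. \<Sum>p<n. pw p k j x * pw (n - 1 - p) i l x)"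
  using assms(2)
proof (induction n arbitrary: l)
  case 0
  show ?case
    by (rule gradp_cong [OF gradp_const [of "if k = l then 1 else 0"]])
       (use assms 0 in \<open>auto simp: pw_0\<close>)
next
  case (Suc n)
  have "gradp (\<lambda>x. \<Sum>a<N. pw n k a x * ent a l x)
     (\<lambda>i j x. \<Sum>a<N. (\<Sum>p<n. pw p k j x * pw (n - 1 - p) i a x) * ent a l x
        + pw n k a x * (if i = l \<and> j = a then 1 else 0))"
    by (intro gradp_sum gradp_mult Suc.IH gradp_ent) (use Suc.prems in auto)
  then show ?case
  proof (rule gradp_cong)
    fix i j x
    assume ij: "i < N" "j < N"
    have "(\<Sum>a<N. (\<Sum>p<n. pw p k j x * pw (n - 1 - p) i a x) * ent a l x
        + pw n k a x * (if i = l \<and> j = a then 1 else 0))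
      = (\<Sum>a<N. \<Sum>p<n. pw p k j x * (pw (n - 1 - p) i a x * ent a l x))
        + (\<Sum>a<N. if a = j then (if i = l then pw n k a x else 0) else 0)"
      unfolding sum.distrib sum_distrib_right mult.assoc
      by (intro arg_cong2 [where f = "(+)"] sum.cong refl) auto
    also have "(\<Sum>a<N. \<Sum>p<n. pw p k j x * (pw (n - 1 - p) i a x * ent a l x)) =
       (\<Sum>p<n. pw p k j x * pw (n - p) i l x)"
    proof (subst sum.swap, intro sum.cong refl)
      fix p assume "p \<in> {..<n}"
      then have "n - p = Suc (n - 1 - p)"
        by auto
      then show "(\<Sum>a<N. pw p k j x * (pw (n - 1 - p) i a x * ent a l x)) = pw p k j x * pw (n - p) i l x"
        using pw_Suc [OF ij(1) Suc.prems, of "n - 1 - p" x] by (simp add: sum_distrib_left)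
    qed
    also have "(\<Sum>a<N. if a = j then (if i = l then pw n k a x else 0) else 0) = pw n k j x * pw 0 i l x"
      using ij Suc.prems by (simp add: pw_0)
    finally show "(\<Sum>a<N. (\<Sum>p<n. pw p k j x * pw (n - 1 - p) i a x) * ent a l x
        + pw n k a x * (if i = l \<and> j = a then 1 else 0)) =
       (\<Sum>p<Suc n. pw p k j x * pw (Suc n - 1 - p) i l x)"
      by simp
  qed (use assms Suc.prems in \<open>simp add: pw_Suc\<close>)
qed

text \<open>Closing up the trace glues the two pieces of each of the n cuts in
  \<open>gradp_pw\<close> to the same entry of M^(n-1).\<close>

lemma gradp_tr: "gradp (tr n) (\<lambda>i j x. of_nat n * pw (n - 1) i j x)"
proof (rule gradp_cong)
  show "gradp (\<lambda>x. \<Sum>k<N. pw n k k x)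
     (\<lambda>i j x. \<Sum>k<N. \<Sum>p<n. pw p k j x * pw (n - 1 - p) i k x)"
    by (intro gradp_sum gradp_pw) auto
  fix i j x
  assume ij: "i < N" "j < N"
  have "(\<Sum>k<N. \<Sum>p<n. pw p k j x * pw (n - 1 - p) i k x) =
      (\<Sum>p<n. \<Sum>k<N. pw (n - 1 - p) i k x * pw p k j x)"
    by (subst sum.swap) (simp add: mult.commute)
  also have "\<dots> = (\<Sum>p<n. pw (n - 1) i j x)"
  proof (intro sum.cong refl)
    fix p assume "p \<in> {..<n}"
    then have "n - 1 - p + p = n - 1"
      by auto
    then show "(\<Sum>k<N. pw (n - 1 - p) i k x * pw p k j x) = pw (n - 1) i j x"
      using pw_add [OF ij, of "n - 1 - p" p x] by simp
  qed
  finally show "(\<Sum>k<N. \<Sum>p<n. pw p k j x * pw (n - 1 - p) i k x) = of_nat n * pw (n - 1) i j x"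
    by simp
qed (simp add: tr_eq)

text \<open>Tr M^(k+1) is the sum of M_ij (M^k)_ji, and the factor M_ij is integrated by parts. The
  derivative of M^k splits one trace into two; the derivative of g remains as
  \<open>G\<close>.\<close>

lemma schwinger_dyson:
  assumes g: "gradp g G"
  shows "expect (\<lambda>x. tr (Suc k) x * g x) = 1 / of_nat N *
    ((\<Sum>p<k. expect (\<lambda>x. tr p x * tr (k - 1 - p) x * g x)) +
     expect (\<lambda>x. \<Sum>i<N. \<Sum>j<N. pw k j i x * G i j x))"
proof -
  let ?D = "\<lambda>i j x. (\<Sum>p<k. pw p j j x * pw (k - 1 - p) i i x) * g x + pw k j i x * G i j x"
  have gp: "gradp (\<lambda>x. pw k b a x * g x)
     (\<lambda>i j x. (\<Sum>p<k. pw p b j x * pw (k - 1 - p) i a x) * g x + pw k b a x * G i j x)"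
    if "a < N" "b < N" for a b
    by (intro gradp_mult gradp_pw that g)
  have "expect (\<lambda>x. tr (Suc k) x * g x) =
      expect (\<lambda>x. \<Sum>i<N. \<Sum>j<N. ent i j x * (pw k j i x * g x))"
    by (intro arg_cong [where f = expect] ext)
       (simp add: tr_eq pw_Suc_left sum_distrib_right mult.assoc)
  also have "\<dots> = (\<Sum>i<N. \<Sum>j<N. expect (\<lambda>x. ent i j x * (pw k j i x * g x)))"
  proof -
    have "gint (\<lambda>x. ent i j x * (pw k j i x * g x))" if "i < N" "j < N" for i j
      using gradp_gint [OF gradp_mult [OF gradp_ent gp]] that by blast
    then show ?thesis
      by (subst expect_sum; (intro sum.cong refl expect_sum gint_sum)?) auto
  qed
  also have "\<dots> = (\<Sum>i<N. \<Sum>j<N. 1 / of_nat N * expect (?D i j))"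
    by (intro sum.cong refl gradp_stein [OF gp]) auto
  also have "\<dots> = 1 / of_nat N * expect (\<lambda>x. \<Sum>i<N. \<Sum>j<N. ?D i j x)"
  proof -
    have "gint (?D i j)" if "i < N" "j < N" for i j
      using gradp_gint_deriv [OF gp] that by blast
    then have "expect (\<lambda>x. \<Sum>i<N. \<Sum>j<N. ?D i j x) = (\<Sum>i<N. \<Sum>j<N. expect (?D i j))"
      by (subst expect_sum; (intro sum.cong refl expect_sum gint_sum)?) auto
    then show ?thesis
      by (simp add: sum_distrib_left)
  qed
  also have "expect (\<lambda>x. \<Sum>i<N. \<Sum>j<N. ?D i j x) =
      expect (\<lambda>x. (\<Sum>p<k. tr p x * tr (k - 1 - p) x * g x) + (\<Sum>i<N. \<Sum>j<N. pw k j i x * G i j x))"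
  proof (intro arg_cong [where f = expect] ext)
    fix x
    have "(\<Sum>i<N. \<Sum>j<N. (\<Sum>p<k. pw p j j x * pw (k - 1 - p) i i x) * g x) =
       (\<Sum>i<N. \<Sum>p<k. \<Sum>j<N. pw p j j x * pw (k - 1 - p) i i x * g x)"
      by (simp add: sum_distrib_right sum.swap [of _ "{..<k}"])
    also have "\<dots> = (\<Sum>p<k. \<Sum>i<N. tr p x * pw (k - 1 - p) i i x * g x)"
      by (subst sum.swap) (simp add: tr_eq sum_distrib_right)
    also have "\<dots> = (\<Sum>p<k. tr p x * tr (k - 1 - p) x * g x)"
      by (simp add: tr_eq sum_distrib_left sum_distrib_right)
    finally show "(\<Sum>i<N. \<Sum>j<N. ?D i j x) =
        (\<Sum>p<k. tr p x * tr (k - 1 - p) x * g x) + (\<Sum>i<N. \<Sum>j<N. pw k j i x * G i j x)"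
      by (simp add: sum.distrib)
  qed
  also have "\<dots> = (\<Sum>p<k. expect (\<lambda>x. tr p x * tr (k - 1 - p) x * g x)) +
     expect (\<lambda>x. \<Sum>i<N. \<Sum>j<N. pw k j i x * G i j x)"
  proof -
    have 1: "gint (\<lambda>x. tr p x * tr (k - 1 - p) x * g x)" for p
      by (rule gradp_gint [OF gradp_mult [OF gradp_mult [OF gradp_tr gradp_tr] g]])
    \<comment> \<open>\<open>gp\<close> yields integrability of the derivative of the whole product;
      the part with \<open>G\<close> is its difference from the integrable cut term.\<close>
    have 2: "gint (\<lambda>x. pw k j i x * G i j x)" if "i < N" "j < N" for i j
    proof -
      have "gint (\<lambda>x. (\<Sum>p<k. pw p j j x * pw (k - 1 - p) i i x) * g x)"
        by (rule gradp_gint [OF gradp_mult [OF gradp_sum g]],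
            rule gradp_mult [OF gradp_pw gradp_pw]) (use that in auto)
      then have "gint (\<lambda>x. ?D i j x + - 1 * ((\<Sum>p<k. pw p j j x * pw (k - 1 - p) i i x) * g x))"
        using that by (intro gint_add gint_scale gradp_gint_deriv [OF gp])
      then show ?thesis
        by simp
    qed
    show ?thesis
    proof (subst expect_add)
      show "gint (\<lambda>x. \<Sum>p<k. tr p x * tr (k - 1 - p) x * g x)"
        by (intro gint_sum 1)
      show "gint (\<lambda>x. \<Sum>i<N. \<Sum>j<N. pw k j i x * G i j x)"
        using 2 by (intro gint_sum) auto
    qed (simp only: expect_sum 1)
  qed
  finally show ?thesis .
qed

section \<open>The formal interaction weight and its correlators\<close>

definition wexp :: "point \<Rightarrow> complex mps" where
  "wexp x = mps_exp (interaction N (hermitian_mat N x))"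

lemma mps_coeff_interaction:
  "mps_coeff (interaction N (hermitian_mat N x)) m =
     of_nat N * (\<Sum>a<wt m. if m = var_mon a then tr (Suc a) x / of_nat (Suc a) else 0)"
proof -
  have "mps_coeff (interaction N (hermitian_mat N x)) m = of_nat N *
    mps_coeff (mps_Sum {1..} (\<lambda>n. indet n * mps_const (tr n x / of_nat n))) m"
    by (simp add: interaction_def tr_def mult.commute [of _ "indet _"])
  also have "\<dots> = of_nat N * (\<Sum>a<wt m. mps_coeff (mps_const (tr (Suc a) x / of_nat (Suc a)) * indet (Suc a)) m)"
    by (simp only: coeff_mps_Sum_indet [OF order_refl] mult.commute)
  also have "\<dots> = of_nat N * (\<Sum>a<wt m. if m = var_mon a then tr (Suc a) x / of_nat (Suc a) else 0)"
    by (intro arg_cong2 [where f = "(*)"] sum.cong refl) (simp add: mps_coeff_indet)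
  finally show ?thesis .
qed

lemma mps_coeff_wexp_0: "mps_coeff (wexp x) 0 = 1"
  unfolding wexp_def by (rule coeff_mps_exp_0) (simp add: mps_coeff_interaction)

lemma pd_wexp: "pd b (wexp x) = mps_const (of_nat N / of_nat (Suc b) * tr (Suc b) x) * wexp x"
proof -
  have "pd b (interaction N (hermitian_mat N x)) = mps_const (of_nat N / of_nat (Suc b) * tr (Suc b) x)"
  proof (rule mps_eqI)
    fix m :: monomial
    have "(\<Sum>a<wt (m + var_mon b). if m + var_mon b = var_mon a then tr (Suc a) x / of_nat (Suc a) else 0)
      = (\<Sum>a<wt m + Suc b. if a = b then (if m = 0 then tr (Suc a) x / of_nat (Suc a) else 0) else 0)"
      by (rule sum.cong) (auto simp: add_var_mon_eq_iff simp del: add_Suc_right)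
    then show "mps_coeff (pd b (interaction N (hermitian_mat N x))) m =
        mps_coeff (mps_const (of_nat N / of_nat (Suc b) * tr (Suc b) x)) m"
      unfolding mps_coeff_pd mps_coeff_interaction coeff_mps_const by simp
  qed
  moreover have "mps_coeff (interaction N (hermitian_mat N x)) 0 = 0"
    by (simp add: mps_coeff_interaction)
  ultimately show ?thesis
    unfolding wexp_def by (simp add: pd_mps_exp)
qed

lemma mps_coeff_wexp_Suc:
  "of_nat (Suc (expo m b)) * mps_coeff (wexp x) (m + var_mon b) =
     of_nat N / of_nat (Suc b) * tr (Suc b) x * mps_coeff (wexp x) m"
  using arg_cong [OF pd_wexp, of "\<lambda>f. mps_coeff f m" b x] by (simp add: mps_coeff_pd)

lemma mps_coeff_indet_wexp_Suc:
  "of_nat (Suc (expo m b)) * mps_coeff (indet (Suc a) * wexp x) (m + var_mon b) =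
     (if a = b then mps_coeff (wexp x) m else 0) +
     of_nat N / of_nat (Suc b) * tr (Suc b) x * mps_coeff (indet (Suc a) * wexp x) m"
proof -
  have "pd b (indet (Suc a) * wexp x) = (if a = b then wexp x else 0) +
      mps_const (of_nat N / of_nat (Suc b) * tr (Suc b) x) * (indet (Suc a) * wexp x)"
    by (simp add: pd_mult pd_indet pd_wexp mult.left_commute)
  from arg_cong [OF this, of "\<lambda>f. mps_coeff f m"] show ?thesis
    by (simp add: mps_coeff_pd if_distrib [of "\<lambda>f. mps_coeff f m"] cong: if_cong)
qed

text \<open>The matrix derivative of N times the sum of (a_n / n) Tr M^n is N times the sum of a_n
  M^(n-1), and it multiplies the exponential. Coefficientwise this is an induction on the weight,
  removing one indeterminate at a time; the free bound \<open>K\<close> lets the induction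
  hypothesis keep the same range of summation.\<close>

lemma gradp_wexp:
  "wt m \<le> K \<Longrightarrow> gradp (\<lambda>x. mps_coeff (wexp x) m)
     (\<lambda>i j x. \<Sum>a<K. of_nat N * pw a i j x * mps_coeff (indet (Suc a) * wexp x) m)"
proof (induction "wt m" arbitrary: m rule: less_induct)
  case less
  show ?case
  proof (cases "m = 0")
    case True
    show ?thesis
      by (rule gradp_cong [OF gradp_const [of 1]])
         (auto simp: True mps_coeff_wexp_0 mps_coeff_indet_mult_eq_0)
  next
    case False
    then obtain b where "expo m b > 0"
      by (rule monomial_nonzero_key)
    then obtain m' where m: "m = m' + var_mon b"
      using monomial_split by blast
    \<comment> \<open>r is the exponent of a_(b+1) in m, and kappa is the factor of Tr M^(b+1) in
      \<open>pd_wexp\<close>; together they express the coefficient at m by the one at m'.\<close>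
    define r where "r = (of_nat (Suc (expo m' b)) :: complex)"
    define \<kappa> where "\<kappa> = (of_nat N / of_nat (Suc b) :: complex)"
    have r: "r \<noteq> 0" and \<kappa>: "\<kappa> * of_nat (Suc b) = of_nat N"
      unfolding r_def \<kappa>_def by (simp_all del: of_nat_Suc)
    have e: "r * mps_coeff (wexp x) m = \<kappa> * tr (Suc b) x * mps_coeff (wexp x) m'" for x
      unfolding r_def m \<kappa>_def by (rule mps_coeff_wexp_Suc)
    have ia: "r * mps_coeff (indet (Suc a) * wexp x) m =
      (if a = b then mps_coeff (wexp x) m' else 0) +
      \<kappa> * tr (Suc b) x * mps_coeff (indet (Suc a) * wexp x) m'" for a x
      unfolding r_def m \<kappa>_def by (rule mps_coeff_indet_wexp_Suc)
    have b: "b < K"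
      using less.prems m by simp
    have IH: "gradp (\<lambda>x. mps_coeff (wexp x) m')
       (\<lambda>i j x. \<Sum>a<K. of_nat N * pw a i j x * mps_coeff (indet (Suc a) * wexp x) m')"
      by (rule less.hyps) (use m less.prems in auto)
    show ?thesis
    proof (rule gradp_cong [OF gradp_scale [OF gradp_mult [OF gradp_tr IH], of "\<kappa> / r" "Suc b"]])
      fix x
      show "\<kappa> / r * (tr (Suc b) x * mps_coeff (wexp x) m') = mps_coeff (wexp x) m"
        using e [of x] r by (simp add: field_simps)
    next
      fix i j x
      let ?S = "\<Sum>a<K. of_nat N * pw a i j x * mps_coeff (indet (Suc a) * wexp x) m"
      let ?S' = "\<Sum>a<K. of_nat N * pw a i j x * mps_coeff (indet (Suc a) * wexp x) m'"
      have "r * ?S = (\<Sum>a<K. of_nat N * pw a i j x * (r * mps_coeff (indet (Suc a) * wexp x) m))"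
        by (simp add: sum_distrib_left mult_ac)
      also have "\<dots> = (\<Sum>a<K. (if a = b then of_nat N * pw a i j x * mps_coeff (wexp x) m' else 0) +
          \<kappa> * tr (Suc b) x * (of_nat N * pw a i j x * mps_coeff (indet (Suc a) * wexp x) m'))"
        unfolding ia by (intro sum.cong) (auto simp: algebra_simps)
      also have "\<dots> = of_nat N * pw b i j x * mps_coeff (wexp x) m' + \<kappa> * tr (Suc b) x * ?S'"
        using b by (simp add: sum.distrib sum_distrib_left)
      also have "\<dots> = \<kappa> * (of_nat (Suc b) * pw (Suc b - 1) i j x * mps_coeff (wexp x) m' + tr (Suc b) x * ?S')"
        unfolding \<kappa> [symmetric] by (simp add: algebra_simps)
      finally show "\<kappa> / r * (of_nat (Suc b) * pw (Suc b - 1) i j x * mps_coeff (wexp x) m' + tr (Suc b) x * ?S') = ?S"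
        using r by (simp add: field_simps)
    qed
  qed
qed

text \<open>Here and in \<open>Z1\<close> and \<open>Z2\<close>: the unnormalised correlators of no,
  one and two traces, with expectations taken coefficientwise.\<close>

definition Z0 :: "complex mps" where
  "Z0 = Abs_mps (\<lambda>m. expect (\<lambda>x. mps_coeff (wexp x) m))"

definition Z1 :: "nat \<Rightarrow> complex mps" where
  "Z1 n = Abs_mps (\<lambda>m. expect (\<lambda>x. tr n x * mps_coeff (wexp x) m))"

definition Z2 :: "nat \<Rightarrow> nat \<Rightarrow> complex mps" where
  "Z2 p q = Abs_mps (\<lambda>m. expect (\<lambda>x. tr p x * tr q x * mps_coeff (wexp x) m))"

lemma partition_function_eq: "partition_function N = Z0"
  unfolding partition_function_def Z0_def wexp_def
  by (simp only: hermitian_expectation)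

lemma mps_coeff_Z0_0: "mps_coeff Z0 0 = 1"
  by (simp add: Z0_def mps_coeff_wexp_0 expect_one)

lemma tr_0: "tr 0 x = of_nat N"
  by (simp add: tr_eq pw_0)

lemma Z1_0: "Z1 0 = of_nat N * Z0"
  by (rule mps_eqI) (simp add: Z1_def Z0_def tr_0 expect_scale)

lemma Z2_0: "Z2 0 q = of_nat N * Z1 q"
  by (rule mps_eqI) (simp add: Z1_def Z2_def tr_0 mult.assoc expect_scale)

lemma pd_Z0: "pd b Z0 = mps_const (of_nat N / of_nat (Suc b)) * Z1 (Suc b)"
proof (rule mps_eqI)
  fix m
  have "of_nat (Suc (expo m b)) * mps_coeff (wexp x) (m + var_mon b) =
    of_nat N / of_nat (Suc b) * (tr (Suc b) x * mps_coeff (wexp x) m)" for x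
    using mps_coeff_wexp_Suc [of m b x] by (simp only: mult.assoc)
  then show "mps_coeff (pd b Z0) m = mps_coeff (mps_const (of_nat N / of_nat (Suc b)) * Z1 (Suc b)) m"
    by (simp only: mps_coeff_pd mps_coeff_const_mult Z0_def Z1_def expect_scale [symmetric] Suc_eq_plus1 [symmetric]
        mps_coeff_Abs)
qed

lemma pd_Z1: "pd b (Z1 q) = mps_const (of_nat N / of_nat (Suc b)) * Z2 (Suc b) q"
proof (rule mps_eqI)
  fix m
  have "of_nat (Suc (expo m b)) * (tr q x * mps_coeff (wexp x) (m + var_mon b)) =
    of_nat N / of_nat (Suc b) * (tr (Suc b) x * tr q x * mps_coeff (wexp x) m)" for x
    using mps_coeff_wexp_Suc [of m b x] by (metis mult.assoc mult.left_commute)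
  then show "mps_coeff (pd b (Z1 q)) m = mps_coeff (mps_const (of_nat N / of_nat (Suc b)) * Z2 (Suc b) q) m"
    by (simp only: mps_coeff_pd mps_coeff_const_mult Z1_def Z2_def expect_scale [symmetric] Suc_eq_plus1 [symmetric]
        mps_coeff_Abs)
qed

text \<open>\<open>schwinger_dyson\<close> with g a coefficient of the weight: its gradient inserts
  N a_(a+1) M^a, which merges with M^k into Tr M^(a+k).\<close>

lemma loop_equation_Z:
  "Z1 (Suc k) = mps_const (1 / of_nat N) * (\<Sum>p<k. Z2 p (k - 1 - p))
     + mps_Sum {1..} (\<lambda>n. indet n * Z1 (n - 1 + k))"
proof (rule mps_eqI)
  fix m
  have ind: "mps_coeff (indet (Suc a) * Z1 q) m = expect (\<lambda>x. tr q x * mps_coeff (indet (Suc a) * wexp x) m)"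
    for a q
    by (rule indet_mult_cases [where m = m and i = a and ?'a = complex]) (auto simp: Z1_def expect_0)
  have gi: "gint (\<lambda>x. tr q x * mps_coeff (indet (Suc a) * wexp x) m)" for a q
  proof (rule indet_mult_cases [where m = m and i = a and ?'a = complex])
    assume "\<And>f :: complex mps. mps_coeff (indet (Suc a) * f) m = 0"
    then show ?thesis
      by (simp add: gint_0)
  next
    fix m' assume "\<And>f :: complex mps. mps_coeff (indet (Suc a) * f) m = mps_coeff f m'"
    then show ?thesis
      using gradp_gint [OF gradp_mult [OF gradp_tr gradp_wexp [OF order_refl]]] by simp
  qed
  have "expect (\<lambda>x. \<Sum>i<N. \<Sum>j<N. pw k j i x *
       (\<Sum>a<wt m. of_nat N * pw a i j x * mps_coeff (indet (Suc a) * wexp x) m))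
     = expect (\<lambda>x. \<Sum>a<wt m. of_nat N * (tr (a + k) x * mps_coeff (indet (Suc a) * wexp x) m))"
  proof (intro arg_cong [where f = expect] ext)
    fix x
    have "(\<Sum>i<N. \<Sum>j<N. pw k j i x * (\<Sum>a<wt m. of_nat N * pw a i j x * mps_coeff (indet (Suc a) * wexp x) m))
      = (\<Sum>i<N. \<Sum>j<N. \<Sum>a<wt m. of_nat N * mps_coeff (indet (Suc a) * wexp x) m * (pw a i j x * pw k j i x))"
      by (simp add: sum_distrib_left mult_ac)
    also have "\<dots> = (\<Sum>a<wt m. \<Sum>i<N. \<Sum>j<N. of_nat N * mps_coeff (indet (Suc a) * wexp x) m * (pw a i j x * pw k j i x))"
      by (simp add: sum.swap [of _ "{..<wt m}"])
    also have "\<dots> = (\<Sum>a<wt m. of_nat N * mps_coeff (indet (Suc a) * wexp x) m * tr (a + k) x)"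
      by (simp add: tr_eq pw_add sum_distrib_left)
    finally show "(\<Sum>i<N. \<Sum>j<N. pw k j i x * (\<Sum>a<wt m. of_nat N * pw a i j x * mps_coeff (indet (Suc a) * wexp x) m))
      = (\<Sum>a<wt m. of_nat N * (tr (a + k) x * mps_coeff (indet (Suc a) * wexp x) m))"
      by (simp add: mult_ac)
  qed
  also have "\<dots> = of_nat N * (\<Sum>a<wt m. mps_coeff (indet (Suc a) * Z1 (a + k)) m)"
    by (simp add: ind expect_sum expect_scale gi gint_scale sum_distrib_left)
  finally have eq: "expect (\<lambda>x. \<Sum>i<N. \<Sum>j<N. pw k j i x *
       (\<Sum>a<wt m. of_nat N * pw a i j x * mps_coeff (indet (Suc a) * wexp x) m))
     = of_nat N * (\<Sum>a<wt m. mps_coeff (indet (Suc a) * Z1 (a + k)) m)" .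
  show "mps_coeff (Z1 (Suc k)) m = mps_coeff (mps_const (1 / of_nat N) * (\<Sum>p<k. Z2 p (k - 1 - p))
     + mps_Sum {1..} (\<lambda>n. indet n * Z1 (n - 1 + k))) m"
    unfolding mps_coeff_add mps_coeff_const_mult mps_coeff_sum coeff_mps_Sum_indet [OF order_refl]
    using schwinger_dyson [OF gradp_wexp [OF order_refl, of m], of k] N_pos
    unfolding eq by (simp add: Z1_def [of "Suc k"] Z2_def distrib_left)
qed

definition logZ :: "complex mps" where
  "logZ = mps_log (partition_function N)"

definition U :: "nat \<Rightarrow> complex mps" where
  "U n = (if n = 0 then 1 else mps_const (of_nat n / (of_nat N)\<^sup>2) * pd (n - 1) logZ)"

lemma U_0 [simp]: "U 0 = 1"
  by (simp add: U_def)

text \<open>The derivative of log Z is that of Z divided by Z, so \<open>U n\<close> is the mean of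
  Tr M^n / N in the interacting ensemble. This is also why its value at n = 0 is set to 1.\<close>

lemma Z1_U: "Z1 n = mps_const (of_nat N) * (Z0 * U n)"
proof (cases n)
  case 0
  then show ?thesis
    by (simp add: Z1_0 of_nat_mps)
next
  case (Suc b)
  have "Z0 * pd b logZ = pd b Z0"
    unfolding logZ_def partition_function_eq by (rule pd_mps_log [OF mps_coeff_Z0_0])
  then have *: "mps_coeff (Z0 * pd b logZ) m = of_nat N / of_nat (Suc b) * mps_coeff (Z1 (Suc b)) m" for m
    by (simp add: pd_Z0)
  show ?thesis
    by (rule mps_eqI)
       (use N_pos in \<open>simp add: Suc U_def mult.left_commute [of Z0] * power2_eq_square del: of_nat_Suc\<close>)
qed

text \<open>Differentiate N Z U_q with respect to a_p. The derivative of Z gives the disconnected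
  product of means, that of U_q the connected part, which is smaller by a factor N^2.\<close>

lemma Z2_U:
  "Z2 p q = mps_const ((of_nat N)\<^sup>2) * (Z0 * (U p * U q)) + mps_const (of_nat p) * (Z0 * pd (p - 1) (U q))"
proof (cases p)
  case 0
  then show ?thesis
    by (intro mps_eqI) (simp add: Z2_0 Z1_U power2_eq_square)
next
  case (Suc b)
  have "pd b (Z1 q) = mps_const (of_nat N) * (pd b Z0 * U q + Z0 * pd b (U q))"
    unfolding Z1_U pd_const_mult by (simp add: pd_mult)
  also have "pd b Z0 = mps_const (of_nat N / of_nat (Suc b)) * (mps_const (of_nat N) * (Z0 * U (Suc b)))"
    by (simp only: pd_Z0 Z1_U)
  finally have "mps_coeff (mps_const (of_nat N / of_nat (Suc b)) * Z2 (Suc b) q) m =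
     mps_coeff (mps_const (of_nat N) * (mps_const (of_nat N / of_nat (Suc b)) *
       (mps_const (of_nat N) * (Z0 * U (Suc b))) * U q + Z0 * pd b (U q))) m" for m
    by (simp only: pd_Z1)
  then have *: "of_nat N / of_nat (Suc b) * mps_coeff (Z2 (Suc b) q) m =
     of_nat N * (of_nat N / of_nat (Suc b) * (of_nat N * mps_coeff (Z0 * (U (Suc b) * U q)) m)
        + mps_coeff (Z0 * pd b (U q)) m)" for m
    by (simp only: mps_coeff_const_mult mps_coeff_add mult.assoc)
  have alg: "z = a\<^sup>2 * u + b * w" if "a / b * z = a * (a / b * (a * u) + w)" "a \<noteq> 0" "b \<noteq> 0"
    for a b z u w :: complex
  proof -
    have "a / b * z = a / b * (a\<^sup>2 * u + b * w)"
      unfolding that(1) using that(3) by (simp add: power2_eq_square algebra_simps)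
    then show ?thesis
      using that(2,3) by (metis divide_eq_0_iff mult_cancel_left)
  qed
  have "mps_coeff (Z2 (Suc b) q) m = (of_nat N)\<^sup>2 * mps_coeff (Z0 * (U (Suc b) * U q)) m
        + of_nat (Suc b) * mps_coeff (Z0 * pd b (U q)) m" for m
  proof (rule alg)
    show "of_nat N / of_nat (Suc b) * mps_coeff (Z2 (Suc b) q) m =
     of_nat N * (of_nat N / of_nat (Suc b) * (of_nat N * mps_coeff (Z0 * (U (Suc b) * U q)) m)
        + mps_coeff (Z0 * pd b (U q)) m)"
      by (fact *)
  qed (use N_pos in \<open>simp_all del: of_nat_Suc\<close>)
  then show ?thesis
    by (intro mps_eqI) (simp add: Suc del: of_nat_Suc)
qed

lemma loop_equation:
  "U (Suc k) = (\<Sum>p<k. U p * U (k - 1 - p) + mps_const (of_nat p / (of_nat N)\<^sup>2) * pd (p - 1) (U (k - 1 - p)))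
     + mps_Sum {1..} (\<lambda>n. indet n * U (n - 1 + k))"
    (is "_ = ?A + ?B")
proof (rule unit_mult_cancel [OF mps_coeff_Z0_0], rule mps_eqI)
  fix m
  \<comment> \<open>The infinite sum is cut at the weight of m before the product with Z is
    distributed over it.\<close>
  have B: "mps_coeff (mps_Sum {1..} (\<lambda>n. indet n * Z1 (n - 1 + k))) m = of_nat N * mps_coeff (Z0 * ?B) m"
  proof -
    have "mps_coeff (Z0 * ?B) m = mps_coeff (Z0 * (\<Sum>a<wt m. indet (Suc a) * U (a + k))) m"
    proof (rule mps_coeff_mult_cong)
      fix q assume "wt q \<le> wt m"
      from coeff_mps_Sum_indet [OF this, of "\<lambda>n. U (n - 1 + k)"]
      show "mps_coeff ?B q = mps_coeff (\<Sum>a<wt m. indet (Suc a) * U (a + k)) q"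
        by (simp only: mps_coeff_sum diff_Suc_1)
    qed
    also have "\<dots> = (\<Sum>a<wt m. mps_coeff (Z0 * (indet (Suc a) * U (a + k))) m)"
      by (simp add: sum_distrib_left mps_coeff_sum)
    finally have *: "mps_coeff (Z0 * ?B) m = (\<Sum>a<wt m. mps_coeff (Z0 * (indet (Suc a) * U (a + k))) m)" .
    show ?thesis
      unfolding * coeff_mps_Sum_indet [OF order_refl] Z1_U
      by (simp add: mult.left_commute [of "indet _"] sum_distrib_left)
  qed
  have "of_nat N * mps_coeff (Z0 * U (Suc k)) m = mps_coeff (Z1 (Suc k)) m"
    by (simp add: Z1_U)
  also have "\<dots> = 1 / of_nat N * (\<Sum>p<k. mps_coeff (Z2 p (k - 1 - p)) m) + of_nat N * mps_coeff (Z0 * ?B) m"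
    unfolding loop_equation_Z mps_coeff_add mps_coeff_const_mult mps_coeff_sum B ..
  also have "1 / of_nat N * (\<Sum>p<k. mps_coeff (Z2 p (k - 1 - p)) m) = of_nat N * mps_coeff (Z0 * ?A) m"
    unfolding sum_distrib_left mps_coeff_sum Z2_U
  proof (intro sum.cong refl)
    fix p
    show "1 / of_nat N * mps_coeff (mps_const ((of_nat N)\<^sup>2) * (Z0 * (U p * U (k - 1 - p))) +
          mps_const (of_nat p) * (Z0 * pd (p - 1) (U (k - 1 - p)))) m =
       of_nat N * mps_coeff (Z0 * (U p * U (k - 1 - p) +
          mps_const (of_nat p / (of_nat N)\<^sup>2) * pd (p - 1) (U (k - 1 - p)))) m"
    proof -
      have "1 / n * (n\<^sup>2 * a + q * b) = n * (a + q / n\<^sup>2 * b)" if "n \<noteq> 0" for n a q b :: complex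
        using that by (simp add: field_simps power2_eq_square)
      then show ?thesis
        using N_pos by (simp only: distrib_left [of Z0] mult.left_commute [of Z0 "mps_const _"]
            mps_coeff_add mps_coeff_const_mult) simp
    qed
  qed
  finally show "mps_coeff (Z0 * U (Suc k)) m = mps_coeff (Z0 * (?A + ?B)) m"
    using N_pos by (simp add: distrib_left [symmetric] del: of_nat_Suc) (simp add: distrib_left)
qed

end

section \<open>Genus expansion and planar limit\<close>

lemma gue_Suc: "gue (Suc N)"
  by unfold_locales simp

text \<open>Taken at matrix size \<open>Suc N\<close>, so that sequences indexed by all naturals run
  through exactly the positive sizes.\<close>

abbreviation hbar :: "nat \<Rightarrow> 'a::field_char_0" where
  "hbar N \<equiv> 1 / (of_nat (Suc N))\<^sup>2"

definition pfun :: "(nat \<Rightarrow> complex) \<Rightarrow> bool" where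
  "pfun f \<longleftrightarrow> (\<exists>u :: rat poly. \<forall>N. f N = of_rat (poly u (hbar N)))"

lemma pfunI: "(\<And>N. f N = of_rat (poly u (hbar N))) \<Longrightarrow> pfun f"
  unfolding pfun_def by blast

lemma pfun_const: "pfun (\<lambda>N. of_rat c)"
  by (rule pfunI [of _ "[:c:]"]) simp

lemma pfun_0: "pfun (\<lambda>N. 0)" and pfun_1: "pfun (\<lambda>N. 1)" and pfun_nat: "pfun (\<lambda>N. of_nat n)"
  using pfun_const [of 0] pfun_const [of 1] pfun_const [of "of_nat n"] by simp_all

lemma pfun_hbar: "pfun (\<lambda>N. hbar N)"
  by (rule pfunI [of _ "[:0, 1:]"]) (simp add: of_rat_divide of_rat_power of_rat_add)

lemma pfun_add: "pfun f \<Longrightarrow> pfun g \<Longrightarrow> pfun (\<lambda>N. f N + g N)"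
  unfolding pfun_def by (metis of_rat_add poly_add)

lemma pfun_mult: "pfun f \<Longrightarrow> pfun g \<Longrightarrow> pfun (\<lambda>N. f N * g N)"
  unfolding pfun_def by (metis of_rat_mult poly_mult)

lemma pfun_sum: "(\<And>a. a \<in> A \<Longrightarrow> pfun (f a)) \<Longrightarrow> pfun (\<lambda>N. \<Sum>a\<in>A. f a N)"
  by (induction A rule: infinite_finite_induct) (auto intro: pfun_add pfun_0)

text \<open>With n = k + 1, every term of the loop equation has smaller index plus weight: the two
  factors of the product share at most k - 1 + wt m; the derivative by a_p adds p to the weight
  while the index is k - 1 - p; and the factor a_n takes n from the weight while the index becomes n
  + k - 1. At p = 0 the derivative term has factor 0, and the measure still drops.\<close>

lemma pfun_U: "pfun (\<lambda>N. mps_coeff (gue.U (Suc N) n) m)"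
proof (induction "n + wt m" arbitrary: n m rule: less_induct)
  case less
  show ?case
  proof (cases n)
    case 0
    then show ?thesis
      by (simp add: gue.U_0 [OF gue_Suc] mps_coeff_one pfun_0 pfun_1)
  next
    case (Suc k)
    have 1: "pfun (\<lambda>N. mps_coeff (gue.U (Suc N) p) a * mps_coeff (gue.U (Suc N) (k - 1 - p)) b)"
      if "p < k" "a + b = m" for p a b
      by (intro pfun_mult less) (use that Suc in auto)
    have 2: "pfun (\<lambda>N. of_nat p * (hbar N) * (of_nat (expo m (p - 1) + 1) *
         mps_coeff (gue.U (Suc N) (k - 1 - p)) (m + var_mon (p - 1))))" if "p < k" for p
      by (intro pfun_mult pfun_nat pfun_hbar less) (use that Suc in auto)
    have 3: "pfun (\<lambda>N. mps_coeff (indet (Suc a) * gue.U (Suc N) (a + k)) m)" for a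
    proof (rule indet_mult_cases [where m = m and i = a and ?'a = complex])
      fix m'
      assume *: "m = m' + var_mon a" "\<And>f :: complex mps. mps_coeff (indet (Suc a) * f) m = mps_coeff f m'"
      have "pfun (\<lambda>N. mps_coeff (gue.U (Suc N) (a + k)) m')"
        by (rule less) (use * Suc in simp)
      then show ?thesis
        using * by simp
    qed (simp add: pfun_0)
    have "mps_coeff (gue.U (Suc N) n) m =
       (\<Sum>p<k. (\<Sum>x\<in>{(a, b). a + b = m}. mps_coeff (gue.U (Suc N) p) (fst x) * mps_coeff (gue.U (Suc N) (k - 1 - p)) (snd x))
         + of_nat p * (hbar N) * (of_nat (expo m (p - 1) + 1) *
           mps_coeff (gue.U (Suc N) (k - 1 - p)) (m + var_mon (p - 1))))
       + (\<Sum>a<wt m. mps_coeff (indet (Suc a) * gue.U (Suc N) (a + k)) m)" for N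
      unfolding Suc gue.loop_equation [OF gue_Suc, of N k] mps_coeff_add mps_coeff_sum coeff_mps_Sum_indet [OF order_refl]
      by (simp add: mps_coeff_mult [of "gue.U (Suc N) _"] mps_coeff_pd case_prod_unfold)
    moreover have "pfun (\<lambda>N. (\<Sum>p<k. (\<Sum>x\<in>{(a, b). a + b = m}. mps_coeff (gue.U (Suc N) p) (fst x) * mps_coeff (gue.U (Suc N) (k - 1 - p)) (snd x))
         + of_nat p * (hbar N) * (of_nat (expo m (p - 1) + 1) *
           mps_coeff (gue.U (Suc N) (k - 1 - p)) (m + var_mon (p - 1))))
       + (\<Sum>a<wt m. mps_coeff (indet (Suc a) * gue.U (Suc N) (a + k)) m))"
      by (intro pfun_add pfun_sum 1 2 3) auto
    ultimately show ?thesis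
      by simp
  qed
qed

lemma mps_coeff_logZ_0: "mps_coeff (gue.logZ (Suc N)) 0 = 0"
  unfolding gue.logZ_def [OF gue_Suc] gue.partition_function_eq [OF gue_Suc]
  by (rule coeff_mps_log_0) (rule gue.mps_coeff_Z0_0 [OF gue_Suc])

lemma mps_coeff_logZ_Suc:
  "mps_coeff (gue.logZ (Suc N)) (m + var_mon i) / (of_nat (Suc N))\<^sup>2 =
     1 / (of_nat (Suc i) * of_nat (Suc (expo m i))) * mps_coeff (gue.U (Suc N) (Suc i)) m"
  by (simp add: gue.U_def [OF gue_Suc] mps_coeff_pd power2_eq_square del: of_nat_Suc)

lemma pfun_logZ: "pfun (\<lambda>N. mps_coeff (gue.logZ (Suc N)) m / (of_nat (Suc N))\<^sup>2)"
proof (cases "m = 0")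
  case True
  then show ?thesis
    by (simp add: mps_coeff_logZ_0 pfun_0)
next
  case False
  then obtain i where "expo m i > 0"
    by (rule monomial_nonzero_key)
  then obtain m' where m: "m = m' + var_mon i"
    using monomial_split by blast
  have "pfun (\<lambda>N. of_rat (1 / (of_nat (Suc i) * of_nat (Suc (expo m' i)))) *
      mps_coeff (gue.U (Suc N) (Suc i)) m')"
    by (intro pfun_mult pfun_const pfun_U)
  then show ?thesis
    unfolding m mps_coeff_logZ_Suc by (simp add: of_rat_divide of_rat_mult del: of_nat_Suc)
qed

text \<open>Division by N^2 turns the powers N^(2 - 2 g) into powers of 1 / N^2, so for each
  monomial a genus expansion is a polynomial in 1 / N^2.\<close>

lemma genus_expansion_iff:
  "genus_expansion F \<longleftrightarrow> (\<forall>m. finite {g. mps_coeff (F g) m \<noteq> 0} \<and>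
     (\<forall>N. mps_coeff (gue.logZ (Suc N)) m / (of_nat (Suc N))\<^sup>2 =
        (\<Sum>g | mps_coeff (F g) m \<noteq> 0. hbar N ^ g * of_rat (mps_coeff (F g) m))))"
proof -
  have p: "of_nat (Suc N) powi (2 - 2 * int g) = (of_nat (Suc N))\<^sup>2 * (hbar N :: complex) ^ g" for N g
  proof -
    have "of_nat (Suc N) powi (2 - 2 * int g) = (of_nat (Suc N)) powi 2 / (of_nat (Suc N) :: complex) powi (int (2 * g))"
      by (subst power_int_diff) (simp_all del: of_nat_Suc)
    also have "\<dots> = (of_nat (Suc N))\<^sup>2 * hbar N ^ g"
      by (simp only: power_int_of_nat power_mult power_one_over) (simp add: power_int_def nat_numeral)
    finally show ?thesis .
  qed
  have q: "(a = (\<Sum>g | mps_coeff (F g) m \<noteq> 0. of_nat (Suc N) powi (2 - 2 * int g) * of_rat (mps_coeff (F g) m)))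
     \<longleftrightarrow> a / (of_nat (Suc N))\<^sup>2 = (\<Sum>g | mps_coeff (F g) m \<noteq> 0. hbar N ^ g * of_rat (mps_coeff (F g) m))"
    for a :: complex and m N
    unfolding p mult.assoc sum_distrib_left [symmetric]
    by (auto simp: field_simps simp del: of_nat_Suc)
  have r: "(\<forall>N\<ge>1. P N) \<longleftrightarrow> (\<forall>N. P (Suc N))" for P :: "nat \<Rightarrow> bool"
    by (metis One_nat_def Suc_le_D Suc_le_mono le0)
  show ?thesis
    unfolding genus_expansion_def r q gue.logZ_def [OF gue_Suc] ..
qed

lemma ex_genus_expansion: "\<exists>F. genus_expansion F"
proof -
  from pfun_logZ obtain u :: "monomial \<Rightarrow> rat poly" where
    u: "mps_coeff (gue.logZ (Suc N)) m / (of_nat (Suc N))\<^sup>2 = of_rat (poly (u m) (hbar N))" for m N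
    unfolding pfun_def by metis
  have "genus_expansion (\<lambda>g. Abs_mps (\<lambda>m. coeff (u m) g))"
    unfolding genus_expansion_iff mps_coeff_Abs
  proof (intro allI conjI)
    fix m N
    have sub: "{g. coeff (u m) g \<noteq> 0} \<subseteq> {..degree (u m)}"
      by (auto intro: le_degree)
    then show "finite {g. coeff (u m) g \<noteq> 0}"
      by (rule finite_subset) simp
    have "mps_coeff (gue.logZ (Suc N)) m / (of_nat (Suc N))\<^sup>2 =
        (\<Sum>g\<le>degree (u m). hbar N ^ g * of_rat (coeff (u m) g))"
      unfolding u poly_altdef
      by (simp add: of_rat_sum of_rat_mult of_rat_divide of_rat_power of_rat_add mult.commute)
    also have "\<dots> = (\<Sum>g | coeff (u m) g \<noteq> 0. hbar N ^ g * of_rat (coeff (u m) g))"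
      by (rule sum.mono_neutral_right) (use sub in auto)
    finally show "mps_coeff (gue.logZ (Suc N)) m / (of_nat (Suc N))\<^sup>2 =
        (\<Sum>g | coeff (u m) g \<noteq> 0. hbar N ^ g * of_rat (coeff (u m) g))" .
  qed
  then show ?thesis
    by blast
qed

text \<open>For each monomial the difference of two expansions is a polynomial with zeros at the
  infinitely many points 1 / N^2.\<close>

lemma genus_expansion_unique:
  assumes "genus_expansion F" "genus_expansion G"
  shows "F = G"
proof (intro ext mps_eqI)
  fix g m
  define A where "A = {g. mps_coeff (F g) m \<noteq> 0} \<union> {g. mps_coeff (G g) m \<noteq> 0}"
  define d where "d g = mps_coeff (F g) m - mps_coeff (G g) m" for g
  have fin: "finite A"
    using assms unfolding A_def genus_expansion_iff by blast
  define p where "p = (\<Sum>g\<in>A. monom (d g) g)"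
  have ev: "(\<Sum>g | mps_coeff (H g) m \<noteq> 0. x ^ g * of_rat (mps_coeff (H g) m)) =
      (\<Sum>g\<in>A. x ^ g * (of_rat (mps_coeff (H g) m) :: complex))"
    if "H = F \<or> H = G" for H x
    by (rule sum.mono_neutral_left) (use fin that in \<open>auto simp: A_def\<close>)
  have "poly p (hbar N) = 0" for N
  proof -
    let ?h = "hbar N :: complex"
    have "(\<Sum>g\<in>A. ?h ^ g * of_rat (mps_coeff (F g) m)) = (\<Sum>g\<in>A. ?h ^ g * of_rat (mps_coeff (G g) m))"
      using assms unfolding genus_expansion_iff ev [of F, simplified, symmetric] ev [of G, simplified, symmetric]
      by metis
    then have "(\<Sum>g\<in>A. ?h ^ g * of_rat (d g)) = 0"
      by (simp add: d_def of_rat_diff right_diff_distrib sum_subtractf)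
    moreover have "of_rat (poly p (hbar N)) = (\<Sum>g\<in>A. ?h ^ g * of_rat (d g))"
      by (simp add: p_def poly_sum poly_monom of_rat_sum of_rat_mult of_rat_divide of_rat_power of_rat_add mult.commute)
    ultimately show ?thesis
      by simp
  qed
  then have sub: "range (\<lambda>N. hbar N) \<subseteq> {x. poly p x = 0}"
    by auto
  have "inj (\<lambda>N. hbar N :: rat)"
  proof (rule injI)
    fix a b
    assume "1 / (of_nat (Suc a))\<^sup>2 = 1 / (of_nat (Suc b) :: rat)\<^sup>2"
    then have "(of_nat (Suc a))\<^sup>2 = (of_nat (Suc b) :: rat)\<^sup>2"
      by (simp del: of_nat_Suc)
    then show "a = b"
      by (metis nat.inject of_nat_0_le_iff of_nat_eq_iff power2_eq_imp_eq)
  qed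
  then have "infinite (range (\<lambda>N. hbar N :: rat))"
    by (rule range_inj_infinite)
  then have "p = 0"
    using sub poly_roots_finite finite_subset by blast
  moreover have "coeff p g = (if g \<in> A then d g else 0)"
    using fin by (simp add: p_def Polynomial.coeff_sum)
  ultimately have "(if g \<in> A then d g else 0) = 0"
    by simp
  then show "mps_coeff (F g) m = mps_coeff (G g) m"
    by (auto simp: d_def A_def split: if_splits)
qed

lemma genus_expansion_free_energy: "genus_expansion free_energy"
  unfolding free_energy_def
  by (rule theI' [of genus_expansion]) (use ex_genus_expansion genus_expansion_unique in blast)

section \<open>The planar limit\<close>

definition planar_lim :: "(nat \<Rightarrow> complex mps) \<Rightarrow> rat mps \<Rightarrow> bool" where
  "planar_lim f h \<longleftrightarrow> (\<forall>m. (\<lambda>N. mps_coeff (f N) m) \<longlonglongrightarrow> of_rat (mps_coeff h m))"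

lemma planar_limD: "planar_lim f h \<Longrightarrow> (\<lambda>N. mps_coeff (f N) m) \<longlonglongrightarrow> of_rat (mps_coeff h m)"
  by (simp add: planar_lim_def)

lemma planar_lim_unique: "planar_lim f h \<Longrightarrow> planar_lim f h' \<Longrightarrow> h = h'"
  unfolding planar_lim_def by (intro mps_eqI) (metis LIMSEQ_unique of_rat_eq_iff)

lemma planar_lim_add: "planar_lim f h \<Longrightarrow> planar_lim f' h' \<Longrightarrow> planar_lim (\<lambda>N. f N + f' N) (h + h')"
  unfolding planar_lim_def by (auto simp: of_rat_add intro: tendsto_add)

lemma planar_lim_0: "planar_lim (\<lambda>N. 0) 0"
  unfolding planar_lim_def by simp

lemma planar_lim_sum:
  "(\<And>a. a \<in> A \<Longrightarrow> planar_lim (f a) (h a)) \<Longrightarrow> planar_lim (\<lambda>N. \<Sum>a\<in>A. f a N) (\<Sum>a\<in>A. h a)"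
  by (induction A rule: infinite_finite_induct) (auto intro: planar_lim_add planar_lim_0)

lemma planar_lim_mult: "planar_lim f h \<Longrightarrow> planar_lim f' h' \<Longrightarrow> planar_lim (\<lambda>N. f N * f' N) (h * h')"
  unfolding planar_lim_def mps_coeff_mult
  by (auto simp: of_rat_sum of_rat_mult case_prod_unfold intro!: tendsto_sum tendsto_mult)

lemma planar_lim_indet_sum:
  assumes "\<And>n. planar_lim (f n) (h n)"
  shows "planar_lim (\<lambda>N. mps_Sum {1..} (\<lambda>n. indet n * f n N)) (mps_Sum {1..} (\<lambda>n. indet n * h n))"
  unfolding planar_lim_def coeff_mps_Sum_indet [OF order_refl]
proof (intro allI, unfold of_rat_sum, rule tendsto_sum)
  fix m a
  show "(\<lambda>N. mps_coeff (indet (Suc a) * f (Suc a) N) m) \<longlonglongrightarrow> of_rat (mps_coeff (indet (Suc a) * h (Suc a)) m)"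
  proof (cases "expo m a")
    case 0
    then show ?thesis
      by (simp add: mps_coeff_indet_mult_eq_0)
  next
    case (Suc k)
    then obtain m' where "m = m' + var_mon a"
      using monomial_split [of m a] by auto
    then show ?thesis
      using assms by (simp add: mps_coeff_indet_mult planar_limD)
  qed
qed

lemma hbar_tendsto_0: "(\<lambda>N. hbar N :: complex) \<longlonglongrightarrow> 0"
proof -
  have "(\<lambda>N. (inverse (of_nat (Suc N)) :: complex)\<^sup>2) \<longlonglongrightarrow> 0\<^sup>2"
    by (intro tendsto_power LIMSEQ_Suc [OF lim_inverse_n])
  then show ?thesis
    by (simp add: inverse_eq_divide power_divide)
qed

text \<open>The connected two-trace term has the factor 1 / N^2 and is lost in the limit; this is
  what closes the planar loop equations.\<close>

lemma planar_lim_hbar: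
  assumes "planar_lim f h"
  shows "planar_lim (\<lambda>N. mps_const (of_nat p / (of_nat (Suc N))\<^sup>2) * pd i (f N)) 0"
  unfolding planar_lim_def
proof
  fix m
  have "(\<lambda>N. of_nat p * (hbar N) * (of_nat (expo m i + 1) * mps_coeff (f N) (m + var_mon i)))
     \<longlonglongrightarrow> of_nat p * 0 * (of_nat (expo m i + 1) * of_rat (mps_coeff h (m + var_mon i)))"
    by (intro tendsto_mult tendsto_const hbar_tendsto_0 planar_limD assms)
  then show "(\<lambda>N. mps_coeff (mps_const (of_nat p / (of_nat (Suc N))\<^sup>2) * pd i (f N)) m) \<longlonglongrightarrow> of_rat (mps_coeff 0 m)"
    by (simp add: mps_coeff_pd)
qed

text \<open>The planar resolvent moments \<open>lim \<langle>Tr M\<^sup>n\<rangle> / N\<close>.\<close>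

definition moment :: "nat \<Rightarrow> rat mps" where
  "moment n = (if n = 0 then 1 else mps_const (of_nat n) * pd (n - 1) (free_energy 0))"

lemma moment_0 [simp]: "moment 0 = 1"
  by (simp add: moment_def)

text \<open>For a fixed monomial the sum over genera is finite, and all terms except genus 0 carry a
  positive power of 1 / N^2.\<close>

lemma free_energy_limit:
  "(\<lambda>N. mps_coeff (gue.logZ (Suc N)) m / (of_nat (Suc N))\<^sup>2) \<longlonglongrightarrow> of_rat (mps_coeff (free_energy 0) m)"
proof -
  let ?A = "{g. mps_coeff (free_energy g) m \<noteq> 0}"
  have A: "finite ?A" "mps_coeff (gue.logZ (Suc N)) m / (of_nat (Suc N))\<^sup>2 =
      (\<Sum>g\<in>?A. hbar N ^ g * of_rat (mps_coeff (free_energy g) m))" for N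
    using genus_expansion_free_energy unfolding genus_expansion_iff by blast+
  have "(\<lambda>N. \<Sum>g\<in>?A. hbar N ^ g * of_rat (mps_coeff (free_energy g) m))
     \<longlonglongrightarrow> (\<Sum>g\<in>?A. 0 ^ g * of_rat (mps_coeff (free_energy g) m) :: complex)"
    by (intro tendsto_sum tendsto_mult tendsto_power tendsto_const hbar_tendsto_0)
  also have "(\<Sum>g\<in>?A. 0 ^ g * of_rat (mps_coeff (free_energy g) m)) =
      (\<Sum>g\<in>?A. if g = 0 then of_rat (mps_coeff (free_energy g) m) else (0 :: complex))"
    by (intro sum.cong) (auto simp: power_0_left)
  also have "\<dots> = of_rat (mps_coeff (free_energy 0) m)"
    using A(1) by (simp add: sum.delta)
  finally show ?thesis
    unfolding A(2) .
qed

lemma moment_limit: "planar_lim (\<lambda>N. gue.U (Suc N) n) (moment n)"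
proof (cases n)
  case 0
  then show ?thesis
    by (simp add: gue.U_0 [OF gue_Suc] planar_lim_def mps_coeff_one)
next
  case (Suc i)
  show ?thesis
    unfolding planar_lim_def
  proof
    fix m
    let ?r = "of_nat (Suc i) * of_nat (Suc (expo m i)) :: complex"
    have "(\<lambda>N. ?r * (mps_coeff (gue.logZ (Suc N)) (m + var_mon i) / (of_nat (Suc N))\<^sup>2))
       \<longlonglongrightarrow> ?r * of_rat (mps_coeff (free_energy 0) (m + var_mon i))"
      by (intro tendsto_mult tendsto_const free_energy_limit)
    moreover have "?r * (mps_coeff (gue.logZ (Suc N)) (m + var_mon i) / (of_nat (Suc N))\<^sup>2)
       = mps_coeff (gue.U (Suc N) n) m" for N
      unfolding mps_coeff_logZ_Suc Suc by (simp del: of_nat_Suc)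
    moreover have "?r * of_rat (mps_coeff (free_energy 0) (m + var_mon i)) = of_rat (mps_coeff (moment n) m)"
      by (simp add: moment_def Suc mps_coeff_pd of_rat_mult of_rat_add)
    ultimately show "(\<lambda>N. mps_coeff (gue.U (Suc N) n) m) \<longlonglongrightarrow> of_rat (mps_coeff (moment n) m)"
      by (simp only:)
  qed
qed

lemma planar_loop_equation:
  "moment (Suc k) = (\<Sum>p<k. moment p * moment (k - 1 - p)) + mps_Sum {1..} (\<lambda>n. indet n * moment (n - 1 + k))"
proof (rule planar_lim_unique [OF moment_limit])
  have "planar_lim (\<lambda>N. gue.U (Suc N) (Suc k))
     ((\<Sum>p<k. moment p * moment (k - 1 - p) + 0) + mps_Sum {1..} (\<lambda>n. indet n * moment (n - 1 + k)))"
    unfolding gue.loop_equation [OF gue_Suc]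
    by (intro planar_lim_add planar_lim_sum planar_lim_mult planar_lim_hbar [OF moment_limit]
        planar_lim_indet_sum moment_limit)
  then show "planar_lim (\<lambda>N. gue.U (Suc N) (Suc k))
     ((\<Sum>p<k. moment p * moment (k - 1 - p)) + mps_Sum {1..} (\<lambda>n. indet n * moment (n - 1 + k)))"
    by simp
qed

section \<open>The series R and S\<close>

abbreviation agree :: "nat \<Rightarrow> 'a::comm_ring_1 mps \<Rightarrow> 'a mps \<Rightarrow> bool" where
  "agree k f g \<equiv> vanish_below k (f - g)"

lemma agree_iff: "agree k f g \<longleftrightarrow> (\<forall>m. wt m < k \<longrightarrow> mps_coeff f m = mps_coeff g m)"
  by (simp add: vanish_below_def)

lemma agree_trans: "agree k f g \<Longrightarrow> agree k g h \<Longrightarrow> agree k f h"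
  by (simp add: agree_iff)

lemma agree_eqI: "(\<And>k. agree k f g) \<Longrightarrow> f = g"
  using vanish_below_all [of "f - g"] by simp

lemma agree_sum: "(\<And>i. i \<in> I \<Longrightarrow> agree k (f i) (g i)) \<Longrightarrow> agree k (sum f I) (sum g I)"
  by (simp add: agree_iff mps_coeff_sum)

lemma agree_mult:
  assumes "agree k f f'" "agree k g g'"
  shows "agree k (f * g) (f' * g')"
proof -
  have "f * g - f' * g' = (f - f') * g + f' * (g - g')"
    by (simp add: algebra_simps)
  then show ?thesis
    using assms by (simp add: vanish_below_add vanish_below_mult_left vanish_below_mult_right)
qed

lemma agree_refl: "agree k f f"
  by simp

lemma agree_power: "agree k f g \<Longrightarrow> agree k (f ^ n) (g ^ n)"
  by (induction n) (auto intro: agree_mult)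

text \<open>Each a_n has weight at least 1, so forming the sum of a_n f_n gains one order of
  agreement.\<close>

lemma agree_indet_Sum:
  assumes "\<And>n. agree k (f n) (g n)"
  shows "agree (Suc k) (mps_Sum {1..} (\<lambda>n. indet n * f n)) (mps_Sum {1..} (\<lambda>n. indet n * g n))"
  unfolding agree_iff
proof (intro allI impI)
  fix m assume m: "wt m < Suc k"
  show "mps_coeff (mps_Sum {1..} (\<lambda>n. indet n * f n)) m = mps_coeff (mps_Sum {1..} (\<lambda>n. indet n * g n)) m"
    unfolding coeff_mps_Sum_indet [OF order_refl]
  proof (intro sum.cong refl)
    fix a
    have "vanish_below (Suc a + k) (indet (Suc a) * (f (Suc a) - g (Suc a)))"
      by (intro vanish_below_mult vanish_below_indet assms)
    then have "mps_coeff (indet (Suc a) * (f (Suc a) - g (Suc a))) m = 0"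
      by (rule vanish_belowD) (use m in simp)
    then show "mps_coeff (indet (Suc a) * f (Suc a)) m = mps_coeff (indet (Suc a) * g (Suc a)) m"
      by (simp add: right_diff_distrib)
  qed
qed

text \<open>The contraction principle for the weight filtration: the iterates from (0, 0) stabilise
  modulo every weight, and two fixed points agree modulo every weight.\<close>

lemma contraction_fixpoint:
  fixes A B :: "'a::comm_ring_1 mps \<Rightarrow> 'a mps \<Rightarrow> 'a mps"
  assumes A: "\<And>k f f' g g'. agree k f f' \<Longrightarrow> agree k g g' \<Longrightarrow> agree (Suc k) (A f g) (A f' g')"
    and B: "\<And>k f f' g g'. agree k f f' \<Longrightarrow> agree k g g' \<Longrightarrow> agree (Suc k) (B f g) (B f' g')"
  shows "\<exists>f g. f = A f g \<and> g = B f g"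
    and "f = A f g \<Longrightarrow> g = B f g \<Longrightarrow> f' = A f' g' \<Longrightarrow> g' = B f' g' \<Longrightarrow> f = f' \<and> g = g'"
proof -
  define X where "X k = ((\<lambda>(f, g). (A f g, B f g)) ^^ k) (0, 0)" for k
  have X_Suc: "fst (X (Suc k)) = A (fst (X k)) (snd (X k))" "snd (X (Suc k)) = B (fst (X k)) (snd (X k))" for k
    by (simp_all add: X_def case_prod_unfold)
  have step: "agree k (fst (X k)) (fst (X (Suc k))) \<and> agree k (snd (X k)) (snd (X (Suc k)))" for k
  proof (induction k)
    case (Suc k)
    then show ?case
      unfolding X_Suc [of "Suc k"] X_Suc [of k] using A B X_Suc by simp
  qed simp
  have mono: "agree k (fst (X k)) (fst (X j)) \<and> agree k (snd (X k)) (snd (X j))" if "k \<le> j" for k j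
    using that
  proof (induction j rule: dec_induct)
    case (step j)
    then show ?case
      using \<open>\<And>k. agree k (fst (X k)) (fst (X (Suc k))) \<and> agree k (snd (X k)) (snd (X (Suc k)))\<close> [of j]
      by (meson agree_trans vanish_below_mono)
  qed simp
  \<comment> \<open>The coefficient at m no longer changes from iterate \<open>Suc (wt m)\<close>
    on, so it can be read there.\<close>
  define f where "f = Abs_mps (\<lambda>m. mps_coeff (fst (X (Suc (wt m)))) m)"
  define g where "g = Abs_mps (\<lambda>m. mps_coeff (snd (X (Suc (wt m)))) m)"
  have f: "agree k f (fst (X k))" and g: "agree k g (snd (X k))" for k
    using mono [of "Suc (wt m)" k for m] unfolding agree_iff f_def g_def
    by (auto simp: Suc_le_eq)
  have "f = A f g"
  proof (rule agree_eqI)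
    fix k
    have "agree (Suc k) (A (fst (X k)) (snd (X k))) (A f g)"
      by (rule A; simp add: agree_iff; use f [of k] g [of k] in \<open>simp add: agree_iff\<close>)
    then show "agree k f (A f g)"
      using f [of "Suc k"] unfolding X_Suc by (auto simp: agree_iff)
  qed
  moreover have "g = B f g"
  proof (rule agree_eqI)
    fix k
    have "agree (Suc k) (B (fst (X k)) (snd (X k))) (B f g)"
      by (rule B; simp add: agree_iff; use f [of k] g [of k] in \<open>simp add: agree_iff\<close>)
    then show "agree k g (B f g)"
      using g [of "Suc k"] unfolding X_Suc by (auto simp: agree_iff)
  qed
  ultimately show "\<exists>f g. f = A f g \<and> g = B f g"
    by blast
next
  assume *: "f = A f g" "g = B f g" "f' = A f' g'" "g' = B f' g'"
  have "agree k f f' \<and> agree k g g'" for k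
  proof (induction k)
    case (Suc k)
    then have "agree (Suc k) (A f g) (A f' g')" "agree (Suc k) (B f g) (B f' g')"
      using A B by blast+
    then show ?case
      using * by metis
  qed simp
  then show "f = f' \<and> g = g'"
    using agree_eqI by blast
qed

definition RS_map1 :: "'a::comm_ring_1 mps \<Rightarrow> 'a mps \<Rightarrow> 'a mps" where
  "RS_map1 R S = 1 + mps_Sum {1..} (\<lambda>n. indet n *
           (\<Sum>j = 1..n div 2. of_nat (((n - 1) choose (j - 1)) * ((n - j) choose j))
              * R ^ j * S ^ (n - 2 * j)))"

definition RS_map2 :: "'a::comm_ring_1 mps \<Rightarrow> 'a mps \<Rightarrow> 'a mps" where
  "RS_map2 R S = mps_Sum {1..} (\<lambda>n. indet n *
           (\<Sum>j = 0..(n - 1) div 2. of_nat (((n - 1) choose (2 * j)) * ((2 * j) choose j))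
              * R ^ j * S ^ (n - 2 * j - 1)))"

lemma RS_map_contraction:
  assumes "agree k f f'" "agree k g g'"
  shows "agree (Suc k) (RS_map1 f g) (RS_map1 f' g')" "agree (Suc k) (RS_map2 f g) (RS_map2 f' g')"
  unfolding RS_map1_def RS_map2_def add_diff_cancel_left
  by (intro agree_indet_Sum agree_sum agree_mult agree_power agree_refl assms)+

lemma mps_coeff_indet_Sum_0: "mps_coeff (mps_Sum {1..} (\<lambda>n. indet n * f n)) 0 = 0"
  using coeff_mps_Sum_indet [of 0 0 f] by simp

text \<open>The sums of multiples of indeterminates have no constant term, so a fixed point
  automatically has the prescribed constant terms.\<close>

lemma solves_RS_iff: "solves_RS R S \<longleftrightarrow> R = RS_map1 R S \<and> S = RS_map2 R S"
proof
  assume *: "R = RS_map1 R S \<and> S = RS_map2 R S"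
  have "mps_coeff (RS_map1 R S) 0 = 1" "mps_coeff (RS_map2 R S) 0 = 0"
    unfolding RS_map1_def RS_map2_def mps_coeff_add mps_coeff_indet_Sum_0 by simp_all
  with * show "solves_RS R S"
    unfolding solves_RS_def RS_map1_def RS_map2_def by metis
qed (simp add: solves_RS_def RS_map1_def RS_map2_def)

lemma RS_series:
  "R_series = RS_map1 R_series S_series" "S_series = RS_map2 R_series S_series"
proof -
  obtain R S :: "rat mps" where RS: "R = RS_map1 R S \<and> S = RS_map2 R S"
    using contraction_fixpoint(1) [of "RS_map1" "RS_map2", OF RS_map_contraction] by blast
  have "RS_solution = (R, S)"
    unfolding RS_solution_def
  proof (rule the_equality)
    show "case (R, S) of (R, S) \<Rightarrow> solves_RS R S"
      using RS by (simp add: solves_RS_iff)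
    fix x :: "rat mps \<times> rat mps"
    assume "case x of (R, S) \<Rightarrow> solves_RS R S"
    then show "x = (R, S)"
      using contraction_fixpoint(2) [of "RS_map1" "RS_map2", OF RS_map_contraction, of "fst x" "snd x" R S] RS
      by (auto simp: solves_RS_iff)
  qed
  then show "R_series = RS_map1 R_series S_series" "S_series = RS_map2 R_series S_series"
    using RS unfolding R_series_def S_series_def by (metis fst_conv snd_conv)+
qed

section \<open>Specialisation of the couplings\<close>

text \<open>The value of a monomial at a_n = kappa_n; the accompanying power of X is recorded by
  \<open>wt\<close>.\<close>

definition kmon :: "(nat \<Rightarrow> rat) \<Rightarrow> monomial \<Rightarrow> rat" where
  "kmon \<kappa> m = (\<Prod>i\<in>supp m. \<kappa> (Suc i) ^ expo m i)"

lemma kmon_superset: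
  assumes "finite A" "supp m \<subseteq> A"
  shows "kmon \<kappa> m = (\<Prod>i\<in>A. \<kappa> (Suc i) ^ expo m i)"
  unfolding kmon_def using assms by (intro prod.mono_neutral_left) (auto simp: in_keys_iff)

lemma kmon_add: "kmon \<kappa> (p + q) = kmon \<kappa> p * kmon \<kappa> q"
proof -
  let ?A = "supp p \<union> supp q"
  have "kmon \<kappa> (p + q) = (\<Prod>i\<in>?A. \<kappa> (Suc i) ^ expo (p + q) i)"
    by (rule kmon_superset) (use Poly_Mapping.keys_add [of p q] in auto)
  also have "\<dots> = (\<Prod>i\<in>?A. \<kappa> (Suc i) ^ expo p i) * (\<Prod>i\<in>?A. \<kappa> (Suc i) ^ expo q i)"
    by (simp add: lookup_add power_add prod.distrib)
  also have "\<dots> = kmon \<kappa> p * kmon \<kappa> q"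
    by (subst (1 2) kmon_superset [of ?A]) auto
  finally show ?thesis .
qed

lemma kmon_0 [simp]: "kmon \<kappa> 0 = 1"
  by (simp add: kmon_def)

lemma kmon_var_mon [simp]: "kmon \<kappa> (var_mon i) = \<kappa> (Suc i)"
  by (simp add: kmon_def)

lemma finite_wt_eq [simp]: "finite {m. wt m = k}"
  by (rule finite_subset [OF _ finite_wt_le [of k]]) auto

text \<open>The substitution \<open>a\<^sub>n \<mapsto> \<kappa> n X\<^sup>n\<close>.\<close>

definition specialise :: "(nat \<Rightarrow> rat) \<Rightarrow> rat mps \<Rightarrow> rat fps" where
  "specialise \<kappa> f = Abs_fps (\<lambda>k. \<Sum>m | wt m = k. mps_coeff f m * kmon \<kappa> m)"

text \<open>A monomial m is sent to a constant times X^(wt m), so the coefficient of X^k collects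
  the finitely many monomials of weight k.\<close>

lemma mps_subst_eq_specialise:
  assumes "\<And>n. 1 \<le> n \<Longrightarrow> c n = fps_const (\<kappa> n) * fps_X ^ n"
  shows "mps_subst c f = specialise \<kappa> f"
proof -
  have "(\<Prod>i\<in>supp m. c (i + 1) ^ expo m i) =
      fps_const (kmon \<kappa> m) * fps_X ^ wt m" for m
  proof -
    have "(\<Prod>i\<in>supp m. c (i + 1) ^ expo m i) =
        (\<Prod>i\<in>supp m. fps_const (\<kappa> (Suc i) ^ expo m i) *
           fps_X ^ (Suc i * expo m i))"
      by (intro prod.cong refl)
         (simp only: assms [of "_ + 1"] le_add2 power_mult_distrib fps_const_power power_mult Suc_eq_plus1)
    moreover have "(\<Prod>i\<in>I. fps_const (g i)) = fps_const (\<Prod>i\<in>I. g i :: rat)" for I :: "nat set" and g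
      by (induction I rule: infinite_finite_induct) simp_all
    ultimately show ?thesis
      by (simp only: prod.distrib kmon_def wt_def power_sum)
  qed
  then have t: "fps_nth (fps_const (mps_coeff f m) *
        (\<Prod>i\<in>supp m. c (i + 1) ^ expo m i)) k =
      (if wt m = k then mps_coeff f m * kmon \<kappa> m else 0)" for m k
    by (simp add: fps_X_power_nth)
  show ?thesis
    unfolding mps_subst_def Let_def t specialise_def
  proof (rule fps_ext, simp only: fps_nth_Abs_fps)
    fix k
    show "(\<Sum>m | (if wt m = k then mps_coeff f m * kmon \<kappa> m else 0) \<noteq> 0.
         if wt m = k then mps_coeff f m * kmon \<kappa> m else 0) = (\<Sum>m | wt m = k. mps_coeff f m * kmon \<kappa> m)"
      by (rule sum.mono_neutral_cong_left) (auto split: if_splits)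
  qed
qed

lemma specialise_add: "specialise \<kappa> (f + g) = specialise \<kappa> f + specialise \<kappa> g"
  by (rule fps_ext) (simp add: specialise_def distrib_right sum.distrib)

lemma specialise_0 [simp]: "specialise \<kappa> 0 = 0"
  by (rule fps_ext) (simp add: specialise_def)

lemma specialise_sum: "specialise \<kappa> (\<Sum>i\<in>I. f i) = (\<Sum>i\<in>I. specialise \<kappa> (f i))"
  by (induction I rule: infinite_finite_induct) (simp_all add: specialise_add)

lemma specialise_1 [simp]: "specialise \<kappa> 1 = 1"
proof (rule fps_ext)
  fix k
  have "fps_nth (specialise \<kappa> 1) k = (\<Sum>m | wt m = k. if m = 0 then 1 else 0)"
    unfolding specialise_def fps_nth_Abs_fps by (intro sum.cong) (auto simp: mps_coeff_one)
  then show "fps_nth (specialise \<kappa> 1) k = fps_nth 1 k"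
    by (simp add: sum.delta)
qed

text \<open>Both sides sum over the pairs of monomials of total weight k, grouped once by their
  product and once by the weight of the first.\<close>

lemma specialise_mult: "specialise \<kappa> (f * g) = specialise \<kappa> f * specialise \<kappa> g"
proof (rule fps_ext)
  fix k
  define T where "T = {x :: monomial \<times> monomial. wt (fst x) + wt (snd x) = k}"
  let ?h = "\<lambda>x. mps_coeff f (fst x) * kmon \<kappa> (fst x) * (mps_coeff g (snd x) * kmon \<kappa> (snd x))"
  have fin: "finite T"
    by (rule finite_subset [of _ "{m. wt m \<le> k} \<times> {m. wt m \<le> k}"]) (auto simp: T_def finite_wt_le)
  have "fps_nth (specialise \<kappa> (f * g)) k = (\<Sum>m | wt m = k. \<Sum>x\<in>{x \<in> T. fst x + snd x = m}. ?h x)"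
    unfolding specialise_def fps_nth_Abs_fps mps_coeff_mult sum_distrib_right
    by (intro sum.cong) (auto simp: T_def kmon_add)
  also have "\<dots> = sum ?h T"
    by (rule sum.group [OF fin]) (auto simp: T_def)
  also have "\<dots> = (\<Sum>i\<in>{0..k}. \<Sum>x\<in>{x \<in> T. wt (fst x) = i}. ?h x)"
    by (rule sum.group [OF fin, symmetric]) (auto simp: T_def)
  also have "\<dots> = (\<Sum>i\<in>{0..k}. \<Sum>x\<in>{m. wt m = i} \<times> {m. wt m = k - i}. ?h x)"
    by (intro sum.cong) (auto simp: T_def)
  also have "\<dots> = fps_nth (specialise \<kappa> f * specialise \<kappa> g) k"
    by (simp add: fps_mult_nth specialise_def sum_product sum.cartesian_product case_prod_unfold)
  finally show "fps_nth (specialise \<kappa> (f * g)) k = fps_nth (specialise \<kappa> f * specialise \<kappa> g) k" .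
qed

lemma specialise_power: "specialise \<kappa> (f ^ n) = specialise \<kappa> f ^ n"
  by (induction n) (simp_all add: specialise_mult)

lemma specialise_of_nat: "specialise \<kappa> (of_nat n) = of_nat n"
  by (induction n) (simp_all add: specialise_add)

lemma specialise_indet: "specialise \<kappa> (indet (Suc i)) = fps_const (\<kappa> (Suc i)) * fps_X ^ Suc i"
proof (rule fps_ext)
  fix k
  have "fps_nth (specialise \<kappa> (indet (Suc i))) k = (\<Sum>m | wt m = k. if m = var_mon i then \<kappa> (Suc i) else 0)"
    unfolding specialise_def fps_nth_Abs_fps by (intro sum.cong) (auto simp: mps_coeff_indet)
  then show "fps_nth (specialise \<kappa> (indet (Suc i))) k = fps_nth (fps_const (\<kappa> (Suc i)) * fps_X ^ Suc i) k"
    by (simp add: sum.delta fps_X_power_nth del: power_Suc)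
qed

lemma specialise_nth_cong:
  assumes "\<And>m. wt m = k \<Longrightarrow> mps_coeff f m = mps_coeff g m"
  shows "fps_nth (specialise \<kappa> f) k = fps_nth (specialise \<kappa> g) k"
  unfolding specialise_def fps_nth_Abs_fps using assms by (intro sum.cong) auto

lemma specialise_indet_Sum:
  assumes "k \<le> K"
  shows "fps_nth (specialise \<kappa> (mps_Sum {1..} (\<lambda>n. indet n * f n))) k =
    fps_nth (\<Sum>a<K. fps_const (\<kappa> (Suc a)) * fps_X ^ Suc a * specialise \<kappa> (f (Suc a))) k"
proof -
  have "fps_nth (specialise \<kappa> (mps_Sum {1..} (\<lambda>n. indet n * f n))) k =
      fps_nth (specialise \<kappa> (\<Sum>a<K. indet (Suc a) * f (Suc a))) k"
  proof (rule specialise_nth_cong)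
    fix m :: monomial assume "wt m = k"
    with assms have "wt m \<le> K" by simp
    from coeff_mps_Sum_indet [OF this, of f]
    show "mps_coeff (mps_Sum {1..} (\<lambda>n. indet n * f n)) m = mps_coeff (\<Sum>a<K. indet (Suc a) * f (Suc a)) m"
      by (simp only: mps_coeff_sum)
  qed
  then show ?thesis
    by (simp only: specialise_sum specialise_mult specialise_indet)
qed

text \<open>The operator that sums n a_n d/da_n multiplies each monomial by its weight. After
  specialisation it becomes X d/dX.\<close>

lemma euler_relation:
  "mps_coeff (mps_Sum {1..} (\<lambda>n. indet n * (mps_const (of_nat n) * pd (n - 1) f))) m = of_nat (wt m) * mps_coeff f m"
proof -
  have "mps_coeff (mps_Sum {1..} (\<lambda>n. indet n * (mps_const (of_nat n) * pd (n - 1) f))) m =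
    (\<Sum>a<wt m. of_nat (Suc a * expo m a) * mps_coeff f m)"
    unfolding coeff_mps_Sum_indet [OF order_refl]
  proof (intro sum.cong refl)
    fix a
    show "mps_coeff (indet (Suc a) * (mps_const (of_nat (Suc a)) * pd (Suc a - 1) f)) m =
        of_nat (Suc a * expo m a) * mps_coeff f m"
    proof (cases "expo m a")
      case 0
      then show ?thesis
        by (simp add: mps_coeff_indet_mult_eq_0)
    next
      case (Suc l)
      then obtain m' where m': "m = m' + var_mon a" "expo m' a + 1 = expo m a"
        using monomial_split [of m a] by auto
      have "mps_coeff (indet (Suc a) * (mps_const (of_nat (Suc a)) * pd (Suc a - 1) f)) m =
          of_nat (Suc a) * (of_nat (expo m' a + 1) * mps_coeff f m)"
        unfolding m'(1) mps_coeff_indet_mult by (simp add: mps_coeff_pd del: of_nat_Suc)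
      then show ?thesis
        unfolding m'(2) by (simp only: of_nat_mult mult.assoc)
    qed
  qed
  also have "\<dots> = of_nat (\<Sum>a<wt m. Suc a * expo m a) * mps_coeff f m"
    by (simp only: of_nat_sum sum_distrib_right)
  also have "(\<Sum>a<wt m. Suc a * expo m a) = wt m"
  proof (rule wt_superset [symmetric])
    show "supp m \<subseteq> {..<wt m}"
    proof
      fix i assume "i \<in> supp m"
      then have "Suc i * 1 \<le> Suc i * expo m i"
        by (intro mult_le_mono2) (simp add: in_keys_iff)
      then show "i \<in> {..<wt m}"
        using lookup_le_wt [of i m] by simp
    qed
  qed simp
  finally show ?thesis .
qed

lemma deriv_free_energy:
  "fps_X * fps_deriv (specialise \<kappa> (free_energy 0)) = specialise \<kappa> (moment 2) - 1"
proof -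
  \<comment> \<open>The loop equation at \<open>k = 1\<close>, where the quadratic term is the
    square of the zeroth moment.\<close>
  have "mps_coeff (moment 2) m = mps_coeff (1 + mps_Sum {1..} (\<lambda>n. indet n * (mps_const (of_nat n) * pd (n - 1) (free_energy 0)))) m" for m
    unfolding numeral_2_eq_2 planar_loop_equation mps_coeff_add coeff_mps_Sum_indet [OF order_refl]
    by (simp add: moment_def)
  then have m2: "moment 2 = 1 + mps_Sum {1..} (\<lambda>n. indet n * (mps_const (of_nat n) * pd (n - 1) (free_energy 0)))"
    by (rule mps_eqI)
  show ?thesis
  proof (rule fps_ext)
    fix k
    have "fps_nth (specialise \<kappa> (moment 2) - 1) k =
        fps_nth (specialise \<kappa> (mps_Sum {1..} (\<lambda>n. indet n * (mps_const (of_nat n) * pd (n - 1) (free_energy 0))))) k"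
      by (simp only: m2 specialise_add specialise_1 add_diff_cancel_left')
    also have "\<dots> = (\<Sum>m | wt m = k. of_nat (wt m) * mps_coeff (free_energy 0) m * kmon \<kappa> m)"
      unfolding specialise_def fps_nth_Abs_fps euler_relation ..
    also have "\<dots> = of_nat k * fps_nth (specialise \<kappa> (free_energy 0)) k"
      by (simp add: specialise_def sum_distrib_left mult.assoc)
    finally show "fps_nth (fps_X * fps_deriv (specialise \<kappa> (free_energy 0))) k = fps_nth (specialise \<kappa> (moment 2) - 1) k"
      by (cases k) (simp_all add: fps_X_mult_nth)
  qed
qed

lemma mps_coeff_free_energy_0: "mps_coeff (free_energy 0) 0 = 0"
  using free_energy_limit [of 0] by (simp add: mps_coeff_logZ_0 LIMSEQ_const_iff)

lemma specialise_nth_0: "fps_nth (specialise \<kappa> f) 0 = mps_coeff f 0"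
  by (simp add: specialise_def)

lemma specialised_loop_equation:
  assumes "r \<le> K"
  shows "fps_nth (specialise \<kappa> (moment (Suc k))) r =
    fps_nth ((\<Sum>p<k. specialise \<kappa> (moment p) * specialise \<kappa> (moment (k - 1 - p))) +
      (\<Sum>a<K. fps_const (\<kappa> (Suc a)) * fps_X ^ Suc a * specialise \<kappa> (moment (a + k)))) r"
  unfolding planar_loop_equation specialise_add fps_add_nth specialise_indet_Sum [OF assms]
  by (simp only: specialise_sum specialise_mult diff_Suc_1)

section \<open>R and S for the two potentials\<close>

lemma fps_mult_nth_cong:
  assumes "\<And>i. i \<le> r \<Longrightarrow> fps_nth g i = fps_nth h i"
  shows "fps_nth (f * g) r = fps_nth (f * h) r"
  unfolding fps_mult_nth using assms by (intro sum.cong) auto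

lemma specialise_R:
  fixes \<kappa> defines "R \<equiv> specialise \<kappa> R_series" and "S \<equiv> specialise \<kappa> S_series"
  assumes "r \<le> K"
  shows "fps_nth R r = fps_nth (1 + (\<Sum>a<K. fps_const (\<kappa> (Suc a)) * fps_X ^ Suc a *
     (\<Sum>j = 1..Suc a div 2. of_nat ((a choose (j - 1)) * ((Suc a - j) choose j)) * R ^ j * S ^ (Suc a - 2 * j)))) r"
proof -
  have "fps_nth (specialise \<kappa> (RS_map1 R_series S_series)) r = fps_nth (1 + (\<Sum>a<K. fps_const (\<kappa> (Suc a)) * fps_X ^ Suc a *
     (\<Sum>j = 1..Suc a div 2. of_nat ((a choose (j - 1)) * ((Suc a - j) choose j)) * R ^ j * S ^ (Suc a - 2 * j)))) r"
    unfolding RS_map1_def specialise_add specialise_1 fps_add_nth specialise_indet_Sum [OF assms(3)]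
      specialise_sum specialise_mult specialise_power specialise_of_nat R_def S_def diff_Suc_1 ..
  then show ?thesis
    unfolding RS_series(1) [symmetric] R_def [symmetric] .
qed

lemma specialise_S:
  fixes \<kappa> defines "R \<equiv> specialise \<kappa> R_series" and "S \<equiv> specialise \<kappa> S_series"
  assumes "r \<le> K"
  shows "fps_nth S r = fps_nth (\<Sum>a<K. fps_const (\<kappa> (Suc a)) * fps_X ^ Suc a *
     (\<Sum>j = 0..a div 2. of_nat ((a choose (2 * j)) * ((2 * j) choose j)) * R ^ j * S ^ (a - 2 * j))) r"
proof -
  have *: "Suc a - 2 * j - 1 = a - 2 * j" for a j
    by simp
  have "fps_nth (specialise \<kappa> (RS_map2 R_series S_series)) r = fps_nth (\<Sum>a<K. fps_const (\<kappa> (Suc a)) * fps_X ^ Suc a *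
     (\<Sum>j = 0..a div 2. of_nat ((a choose (2 * j)) * ((2 * j) choose j)) * R ^ j * S ^ (a - 2 * j))) r"
    unfolding RS_map2_def specialise_indet_Sum [OF assms(3)] specialise_sum specialise_mult
      specialise_power specialise_of_nat R_def S_def * diff_Suc_1 ..
  then show ?thesis
    unfolding RS_series(2) [symmetric] S_def [symmetric] .
qed

section \<open>The central binomial series\<close>

definition central_fps :: "rat fps" where
  "central_fps = Abs_fps (\<lambda>n. of_nat ((2 * n) choose n))"

lemma central_binomial_Suc: "Suc n * ((2 * Suc n) choose Suc n) = 2 * (2 * n + 1) * ((2 * n) choose n)"
proof -
  have "Suc n * ((2 * Suc n) choose Suc n) = Suc (2 * n + 1) * ((2 * n + 1) choose n)"
    using Suc_times_binomial [of n "2 * n + 1"] by simp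
  also have "\<dots> = 2 * (Suc n * (Suc (2 * n) choose Suc n))"
    using binomial_symmetric [of n "2 * n + 1"] by simp
  also have "Suc n * (Suc (2 * n) choose Suc n) = Suc (2 * n) * ((2 * n) choose n)"
    by (rule Suc_times_binomial)
  finally show ?thesis
    by simp
qed

text \<open>The recurrence of the central binomials is the differential equation (1 - 4 X) B' = 2 B,
  which makes the derivative of B^2 (1 - 4 X) vanish.\<close>

lemma central_fps_sq: "central_fps ^ 2 * (1 - 4 * fps_X) = 1"
proof -
  let ?B = central_fps
  have ode: "(1 - 4 * fps_X) * fps_deriv ?B = 2 * ?B"
  proof (rule fps_ext)
    fix n
    have rec: "of_nat (Suc k) * fps_nth ?B (Suc k) = 2 * (2 * of_nat k + 1) * fps_nth ?B k" for k
      using arg_cong [OF central_binomial_Suc, of "of_nat :: nat \<Rightarrow> rat" k]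
      by (simp only: central_fps_def fps_nth_Abs_fps of_nat_mult of_nat_add of_nat_numeral of_nat_1)
    have n4: "fps_nth (4 * (fps_X * fps_deriv ?B)) n = 4 * fps_nth (fps_X * fps_deriv ?B) n"
      by (simp add: numeral_fps_const)
    have n2: "fps_nth (2 * ?B) n = 2 * fps_nth ?B n"
      by (simp add: numeral_fps_const)
    have "fps_nth ((1 - 4 * fps_X) * fps_deriv ?B) n = of_nat (Suc n) * fps_nth ?B (Suc n) - 4 * (of_nat n * fps_nth ?B n)"
      unfolding left_diff_distrib mult.assoc fps_sub_nth n4
      by (cases n) (simp_all add: fps_X_mult_nth)
    also have "\<dots> = 2 * fps_nth ?B n"
      unfolding rec by (simp add: algebra_simps)
    finally show "fps_nth ((1 - 4 * fps_X) * fps_deriv ?B) n = fps_nth (2 * ?B) n"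
      unfolding n2 .
  qed
  have "fps_deriv (?B ^ 2 * (1 - 4 * fps_X)) = 2 * ?B * ((1 - 4 * fps_X) * fps_deriv ?B) - 4 * ?B ^ 2"
    by (simp add: power2_eq_square algebra_simps)
  also have "\<dots> = fps_deriv 1"
    unfolding ode by (simp add: power2_eq_square algebra_simps)
  finally show ?thesis
    unfolding fps_deriv_eq_iff by (simp add: central_fps_def power2_eq_square numeral_fps_const)
qed

lemma central_fps_compose_sq:
  assumes "fps_nth q 0 = 0"
  shows "(central_fps oo q) ^ 2 * (1 - 4 * q) = 1"
proof -
  have "(central_fps ^ 2 * (1 - 4 * fps_X)) oo q = 1 oo q"
    unfolding central_fps_sq ..
  then show ?thesis
    using assms by (simp add: fps_compose_mult_distrib fps_compose_power fps_compose_sub_distrib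
        numeral_fps_const)
qed

section \<open>R and S for the even potential\<close>

definition even_weight :: "nat \<Rightarrow> rat" where
  "even_weight n = (if even n then 1 else 0)"

text \<open>Only even n contribute, and then the exponent n - 2 j - 1 of S is positive. Hence S is a
  multiple of X S, and its coefficients vanish by strong induction.\<close>

lemma even_S_eq_0: "specialise even_weight S_series = 0"
proof (rule fps_ext)
  let ?S = "specialise even_weight S_series" and ?R = "specialise even_weight R_series"
  fix r
  show "fps_nth ?S r = fps_nth 0 r"
  proof (induction r rule: less_induct)
    case (less r)
    have "fps_nth (fps_const (even_weight (Suc a)) * fps_X ^ Suc a *
       (\<Sum>j = 0..a div 2. of_nat ((a choose (2 * j)) * ((2 * j) choose j)) * ?R ^ j * ?S ^ (a - 2 * j))) r = 0" for a
    proof (cases "odd a")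
      case True
      have "?S dvd (\<Sum>j = 0..a div 2. of_nat ((a choose (2 * j)) * ((2 * j) choose j)) * ?R ^ j * ?S ^ (a - 2 * j))"
      proof (intro dvd_sum dvd_mult dvd_power)
        fix j assume "j \<in> {0..a div 2}"
        then have "2 * j \<le> a"
          by auto
        moreover have "2 * j \<noteq> a"
          using True by auto
        ultimately show "0 < a - 2 * j \<or> ?S = 1"
          by simp
      qed
      then obtain h where h: "(\<Sum>j = 0..a div 2. of_nat ((a choose (2 * j)) * ((2 * j) choose j)) * ?R ^ j * ?S ^ (a - 2 * j)) = ?S * h"
        by (elim dvdE)
      have "fps_nth (fps_X ^ Suc a * (?S * h)) r = 0"
        unfolding fps_X_power_mult_nth fps_mult_nth using less by (auto intro!: sum.neutral)
      then show ?thesis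
        unfolding h by (simp only: mult.assoc fps_mult_left_const_nth mult_zero_right)
    qed (simp add: even_weight_def)
    then show ?case
      unfolding specialise_S [OF order_refl] by (simp only: fps_sum_nth) simp
  qed
qed

lemma half_central_binomial:
  assumes "1 \<le> l"
  shows "(2 * l) choose l = 2 * ((2 * l - 1) choose (l - 1))"
proof -
  obtain k where l: "l = Suc k"
    using assms by (cases l) auto
  have "Suc k * ((2 * Suc k) choose Suc k) = Suc k * (2 * ((2 * k + 1) choose k))"
    using Suc_times_binomial [of k "2 * k + 1"] by (simp add: algebra_simps)
  then show ?thesis
    unfolding l by (simp only: mult_cancel1) simp
qed

text \<open>With S = 0 and 0 ^ 0 = 1 only j = n / 2 survives, so R - 1 is the sum of binom(2l-1,
  l-1) (X^2 R)^l over l at least 1. These binomials are half the central ones.\<close>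

lemma even_R_compose:
  "2 * specialise even_weight R_series - 1 = central_fps oo (fps_X ^ 2 * specialise even_weight R_series)"
proof (rule fps_ext)
  let ?R = "specialise even_weight R_series"
  fix r
  have *: "(\<Sum>j = 1..Suc a div 2. of_nat ((a choose (j - 1)) * ((Suc a - j) choose j)) * ?R ^ j * 0 ^ (Suc a - 2 * j)) =
     of_nat (a choose (l - 1)) * ?R ^ l" if "Suc a = 2 * l" for a l
  proof -
    have "(\<Sum>j = 1..Suc a div 2. of_nat ((a choose (j - 1)) * ((Suc a - j) choose j)) * ?R ^ j * 0 ^ (Suc a - 2 * j)) =
      (\<Sum>j = 1..l. if j = l then of_nat (a choose (l - 1)) * ?R ^ l else 0)"
      by (rule sum.cong) (use that in \<open>auto simp: power_0_left\<close>)
    moreover have "1 \<le> l"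
      using that by simp
    ultimately show ?thesis
      by simp
  qed
  let ?f = "\<lambda>a. fps_nth (fps_const (even_weight (Suc a)) * fps_X ^ Suc a *
     (\<Sum>j = 1..Suc a div 2. of_nat ((a choose (j - 1)) * ((Suc a - j) choose j)) * ?R ^ j * 0 ^ (Suc a - 2 * j))) r"
  have "fps_nth ?R r = fps_nth 1 r + (\<Sum>a<2 * r. ?f a)"
    using specialise_R [of r "2 * r" even_weight] unfolding even_S_eq_0 by (simp add: fps_sum_nth)
  also have "(\<Sum>a<2 * r. ?f a) = (\<Sum>a | a < 2 * r \<and> odd a. ?f a)"
    by (rule sum.mono_neutral_right) (auto simp: even_weight_def)
  also have "\<dots> = (\<Sum>l = 1..r. of_nat ((2 * l - 1) choose (l - 1)) * fps_nth ((fps_X ^ 2 * ?R) ^ l) r)"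
  proof (rule sum.reindex_bij_witness [where i = "\<lambda>l. 2 * l - 1" and j = "\<lambda>a. Suc a div 2"])
    fix a assume a: "a \<in> {a. a < 2 * r \<and> odd a}"
    then obtain b where "a = 2 * b + 1"
      by (auto elim: oddE)
    then obtain l where l: "Suc a = 2 * l"
      by (metis add_Suc_right add.commute mult_Suc_right one_add_one plus_1_eq_Suc)
    then have la: "a = 2 * l - 1" "Suc a div 2 = l"
      by simp_all
    have "?f a = fps_nth (of_nat (a choose (l - 1)) * (fps_X ^ 2 * ?R) ^ l) r"
      unfolding * [OF l] using l by (simp add: even_weight_def power_mult_distrib power_mult [symmetric] mult_ac del: power_Suc)
    then show "of_nat ((2 * (Suc a div 2) - 1) choose (Suc a div 2 - 1)) * fps_nth ((fps_X ^ 2 * ?R) ^ (Suc a div 2)) r = ?f a"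
      unfolding la(2) by (simp add: la(1) fps_of_nat [symmetric])
  qed auto
  finally have R: "fps_nth ?R r = fps_nth 1 r +
     (\<Sum>l = 1..r. of_nat ((2 * l - 1) choose (l - 1)) * fps_nth ((fps_X ^ 2 * ?R) ^ l) r)" .
  have "fps_nth (central_fps oo (fps_X ^ 2 * ?R)) r = fps_nth 1 r +
     (\<Sum>l = 1..r. of_nat ((2 * l) choose l) * fps_nth ((fps_X ^ 2 * ?R) ^ l) r)"
    by (simp add: fps_compose_nth central_fps_def sum.atLeast_Suc_atMost)
  also have "\<dots> = fps_nth 1 r + 2 * (\<Sum>l = 1..r. of_nat ((2 * l - 1) choose (l - 1)) * fps_nth ((fps_X ^ 2 * ?R) ^ l) r)"
    unfolding sum_distrib_left by (intro arg_cong2 [where f = "(+)"] sum.cong refl) (simp add: half_central_binomial)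
  also have "\<dots> = 2 * fps_nth ?R r - fps_nth 1 r"
    unfolding R by simp
  finally show "fps_nth (2 * ?R - 1) r = fps_nth (central_fps oo (fps_X ^ 2 * ?R)) r"
    by (simp add: numeral_fps_const)
qed

text \<open>Squaring \<open>even_R_compose\<close> removes the square root: (2 R - 1)^2 (1 - 4 X^2
  R) = 1. Subtracting 1 leaves a multiple of 4 R, which cancels.\<close>

lemma even_R_equation:
  fixes r defines "r \<equiv> specialise even_weight R_series - 1"
  shows "r = fps_X ^ 2 * (1 + 2 * r) ^ 2"
proof -
  let ?R = "specialise even_weight R_series"
  have "(2 * ?R - 1) ^ 2 * (1 - 4 * (fps_X ^ 2 * ?R)) = 1"
    unfolding even_R_compose by (rule central_fps_compose_sq) (simp add: power2_eq_square)
  then have "4 * ?R * (r - fps_X ^ 2 * (1 + 2 * r) ^ 2) = 0"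
    unfolding r_def by (simp add: algebra_simps power2_eq_square)
  moreover have "?R \<noteq> 0"
  proof
    assume "?R = 0"
    then have "fps_nth ?R 0 = 0"
      by simp
    then show False
      using specialise_R [of 0 0 even_weight] by simp
  qed
  ultimately show ?thesis
    by simp
qed


section \<open>R and S for the potential with all couplings\<close>

lemma binomial_series_mult:
  "Abs_fps (\<lambda>i. of_nat ((i + e) choose i)) * (1 - fps_X) ^ Suc e = (1 :: rat fps)"
proof (induction e)
  case 0
  show ?case
    by (rule fps_ext) (simp add: right_diff_distrib fps_X_mult_right_nth)
next
  case (Suc e)
  have "Abs_fps (\<lambda>i. of_nat ((i + Suc e) choose i)) * (1 - fps_X) = (Abs_fps (\<lambda>i. of_nat ((i + e) choose i)) :: rat fps)"
  proof (rule fps_ext)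
    fix n
    show "fps_nth (Abs_fps (\<lambda>i. of_nat ((i + Suc e) choose i)) * (1 - fps_X)) n =
        fps_nth (Abs_fps (\<lambda>i. of_nat ((i + e) choose i)) :: rat fps) n"
      by (cases n) (simp_all add: right_diff_distrib fps_X_mult_right_nth)
  qed
  then show ?case
    using Suc by (simp add: mult.assoc [symmetric])
qed

text \<open>Summation over \<open>i\<close> by the negative binomial series; the sum is only finite modulo \<open>X\<^bsup>K + 1\<^esup>\<close>.\<close>

lemma double_binomial_sum:
  fixes R S w :: "rat fps" and c e :: "nat \<Rightarrow> nat"
  assumes w: "w * (1 - fps_X * S) = 1" and r: "r \<le> K"
  shows "fps_nth (\<Sum>n\<le>K. \<Sum>j\<in>{j. 2 * j \<le> n}. of_nat (c j * ((n - 2 * j + e j) choose (n - 2 * j))) *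
      ((fps_X ^ 2 * R) ^ j * (fps_X * S) ^ (n - 2 * j))) r =
    fps_nth (\<Sum>j\<le>K. of_nat (c j) * ((fps_X ^ 2 * R) ^ j * w ^ Suc (e j))) r"
proof -
  let ?y = "fps_X * S" and ?q = "fps_X ^ 2 * R"
  let ?t = "\<lambda>j i. of_nat (c j * ((i + e j) choose i)) * (?q ^ j * ?y ^ i)"
  have fin: "finite {j. 2 * j \<le> n}" for n :: nat
    by (rule finite_subset [of _ "{..n}"]) auto
  have zero: "fps_nth (?t j i) r = 0" if "K < 2 * j + i" for i j
  proof -
    have "?q ^ j * ?y ^ i = fps_X ^ (2 * j + i) * (R ^ j * S ^ i)"
      unfolding power_mult_distrib power_add power_mult by (simp only: mult_ac)
    then have "?t j i = fps_X ^ (2 * j + i) * (of_nat (c j * ((i + e j) choose i)) * (R ^ j * S ^ i))"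
      by (simp only: mult_ac)
    then show ?thesis
      using that r by (simp only: fps_X_power_mult_nth) simp
  qed
  have geo: "fps_nth (\<Sum>i\<le>K. of_nat ((i + e j) choose i) * ?y ^ i) s = fps_nth (w ^ Suc (e j)) s" if "s \<le> K" for j s
  proof -
    let ?h = "Abs_fps (\<lambda>i. of_nat ((i + e j) choose i)) :: rat fps"
    have y0: "fps_nth ?y 0 = 0"
      by simp
    have "(?h * (1 - fps_X) ^ Suc (e j)) oo ?y = 1 oo ?y"
      unfolding binomial_series_mult ..
    then have "(?h oo ?y) * (1 - ?y) ^ Suc (e j) = 1 oo ?y"
      unfolding fps_compose_mult_distrib [OF y0] fps_compose_power [OF y0, symmetric]
        fps_compose_sub_distrib by simp
    moreover have "w ^ Suc (e j) * (1 - ?y) ^ Suc (e j) = 1"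
      by (simp only: power_mult_distrib [symmetric] w power_one)
    ultimately have hw: "?h oo ?y = w ^ Suc (e j)"
    proof -
      assume a: "(?h oo ?y) * (1 - ?y) ^ Suc (e j) = 1 oo ?y" and b: "w ^ Suc (e j) * (1 - ?y) ^ Suc (e j) = 1"
      have "?h oo ?y = (?h oo ?y) * (w ^ Suc (e j) * (1 - ?y) ^ Suc (e j))"
        by (simp only: b mult_1_right)
      also have "\<dots> = w ^ Suc (e j) * ((?h oo ?y) * (1 - ?y) ^ Suc (e j))"
        by (simp only: mult_ac)
      finally show ?thesis
        by (simp only: a fps_compose_1 mult_1_right)
    qed
    have "fps_nth (\<Sum>i\<le>K. of_nat ((i + e j) choose i) * ?y ^ i) s =
        (\<Sum>i\<le>K. of_nat ((i + e j) choose i) * fps_nth (?y ^ i) s)"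
      by (simp add: fps_sum_nth fps_of_nat [symmetric])
    also have "\<dots> = (\<Sum>i = 0..s. of_nat ((i + e j) choose i) * fps_nth (?y ^ i) s)"
      by (rule sum.mono_neutral_right)
         (use that in \<open>auto simp: power_mult_distrib fps_X_power_mult_nth\<close>)
    finally show ?thesis
      unfolding hw [symmetric] by (simp add: fps_compose_nth)
  qed
  have "(\<Sum>n\<le>K. \<Sum>j\<in>{j. 2 * j \<le> n}. fps_nth (?t j (n - 2 * j)) r) =
      (\<Sum>(n, j)\<in>Sigma {..K} (\<lambda>n. {j. 2 * j \<le> n}). fps_nth (?t j (n - 2 * j)) r)"
    by (rule sum.Sigma) (use fin in auto)
  also have "\<dots> = (\<Sum>(j, i) | 2 * j + i \<le> K. fps_nth (?t j i) r)"
    by (rule sum.reindex_bij_witness [where i = "\<lambda>(j, i). (2 * j + i, j)" and j = "\<lambda>(n, j). (j, n - 2 * j)"]) auto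
  \<comment> \<open>The triangle is completed to a square, since the added terms have order above r;
    the two summations then separate.\<close>
  also have "\<dots> = (\<Sum>(j, i)\<in>{..K} \<times> {..K}. fps_nth (?t j i) r)"
  proof (rule sum.mono_neutral_left)
    show "\<forall>x\<in>{..K} \<times> {..K} - {(j, i). 2 * j + i \<le> K}. (case x of (j, i) \<Rightarrow> fps_nth (?t j i) r) = 0"
    proof
      fix x assume x: "x \<in> {..K} \<times> {..K} - {(j, i). 2 * j + i \<le> K}"
      obtain j i where ji: "x = (j, i)"
        by (cases x)
      show "(case x of (j, i) \<Rightarrow> fps_nth (?t j i) r) = 0"
        unfolding ji case_prod_conv by (rule zero) (use x ji in auto)
    qed
  qed auto
  also have "\<dots> = (\<Sum>j\<le>K. fps_nth (\<Sum>i\<le>K. ?t j i) r)"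
    unfolding fps_sum_nth sum.cartesian_product ..
  also have "\<dots> = (\<Sum>j\<le>K. fps_nth (of_nat (c j) * ?q ^ j * (\<Sum>i\<le>K. of_nat ((i + e j) choose i) * ?y ^ i)) r)"
    by (simp add: sum_distrib_left mult_ac)
  also have "\<dots> = (\<Sum>j\<le>K. fps_nth (of_nat (c j) * ?q ^ j * w ^ Suc (e j)) r)"
    by (intro sum.cong refl fps_mult_nth_cong geo) (use r in auto)
  finally show ?thesis
    unfolding fps_sum_nth by (simp add: mult.assoc del: power_Suc)
qed

lemma compose_nth_upto:
  fixes q :: "rat fps"
  assumes "fps_nth q 0 = 0" "r \<le> K"
  shows "fps_nth (f oo q) r = (\<Sum>j\<le>K. fps_nth f j * fps_nth (q ^ j) r)"
proof -
  have "fps_nth (q ^ j) r = 0" if "r < j" for j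
    using startsby_zero_power_prefix [OF assms(1), of j] that by simp
  then show ?thesis
    unfolding fps_compose_nth by (intro sum.mono_neutral_left) (use assms(2) in auto)
qed

context
  fixes R S w :: "rat fps"
  defines "R \<equiv> specialise (\<lambda>_. 1) R_series" and "S \<equiv> specialise (\<lambda>_. 1) S_series"
    and "w \<equiv> inverse (1 - fps_X * S)"
begin

lemma w_mult: "w * (1 - fps_X * S) = 1"
  unfolding w_def by (rule inverse_mult_eq_1) simp

lemma all_q_0: "fps_nth (fps_X ^ 2 * R * w ^ 2) 0 = 0"
  by (simp add: power2_eq_square)

text \<open>For fixed j, summing binom(a, 2j) (X S)^(a-2j) over a gives w^(2j+1). What remains is
  the central binomial series in X^2 R w^2.\<close>

lemma all_S_compose: "S = fps_X * (w * (central_fps oo (fps_X ^ 2 * R * w ^ 2)))"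
proof (rule fps_ext)
  fix r
  let ?y = "fps_X * S" and ?q = "fps_X ^ 2 * R"
  have eq: "fps_X ^ Suc a * (\<Sum>j = 0..a div 2. of_nat ((a choose (2 * j)) * ((2 * j) choose j)) * R ^ j * S ^ (a - 2 * j))
    = fps_X * (\<Sum>j\<in>{j. 2 * j \<le> a}. of_nat (((2 * j) choose j) * ((a - 2 * j + 2 * j) choose (a - 2 * j))) *
      (?q ^ j * ?y ^ (a - 2 * j)))" for a
  proof -
    have "{0..a div 2} = {j. 2 * j \<le> a}"
      by auto
    moreover have *: "fps_X ^ a * (of_nat ((a choose (2 * j)) * ((2 * j) choose j)) * R ^ j * S ^ (a - 2 * j)) =
       of_nat (((2 * j) choose j) * ((a - 2 * j + 2 * j) choose (a - 2 * j))) * (?q ^ j * ?y ^ (a - 2 * j))"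
      if "2 * j \<le> a" for j
    proof -
      have "fps_X ^ a = fps_X ^ (2 * j) * (fps_X ^ (a - 2 * j) :: rat fps)"
        unfolding power_add [symmetric] using that by simp
      moreover have "a choose (a - 2 * j) = a choose (2 * j)"
        using binomial_symmetric [OF that] by simp
      ultimately show ?thesis
        using that unfolding power_mult_distrib power_mult by (simp only: of_nat_mult le_add_diff_inverse2) (simp only: mult_ac)
    qed
    ultimately have "fps_X ^ Suc a * (\<Sum>j = 0..a div 2. of_nat ((a choose (2 * j)) * ((2 * j) choose j)) * R ^ j * S ^ (a - 2 * j))
      = fps_X * (\<Sum>j\<in>{j. 2 * j \<le> a}. fps_X ^ a * (of_nat ((a choose (2 * j)) * ((2 * j) choose j)) * R ^ j * S ^ (a - 2 * j)))"
      by (simp only: power_Suc sum_distrib_left mult.assoc)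
    also have "\<dots> = fps_X * (\<Sum>j\<in>{j. 2 * j \<le> a}. of_nat (((2 * j) choose j) * ((a - 2 * j + 2 * j) choose (a - 2 * j))) *
      (?q ^ j * ?y ^ (a - 2 * j)))"
      by (intro arg_cong2 [where f = "(*)"] refl sum.cong *) simp
    finally show ?thesis .
  qed
  have "fps_nth S r = fps_nth (fps_X * (\<Sum>a\<le>r. \<Sum>j\<in>{j. 2 * j \<le> a}.
      of_nat (((2 * j) choose j) * ((a - 2 * j + 2 * j) choose (a - 2 * j))) * (?q ^ j * ?y ^ (a - 2 * j)))) r"
  proof -
    have "fps_nth S r = fps_nth (\<Sum>a<Suc r. fps_const 1 * fps_X ^ Suc a *
     (\<Sum>j = 0..a div 2. of_nat ((a choose (2 * j)) * ((2 * j) choose j)) * R ^ j * S ^ (a - 2 * j))) r"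
      unfolding R_def S_def by (rule specialise_S) simp
    then show ?thesis
      unfolding fps_const_1_eq_1 mult_1_left eq lessThan_Suc_atMost sum_distrib_left [of "fps_X", symmetric] .
  qed
  also have "\<dots> = fps_nth (fps_X * (\<Sum>j\<le>r. of_nat ((2 * j) choose j) * (?q ^ j * w ^ Suc (2 * j)))) r"
    by (intro fps_mult_nth_cong double_binomial_sum w_mult)
  also have "\<dots> = fps_nth (fps_X * (w * (central_fps oo (?q * w ^ 2)))) r"
  proof (rule fps_mult_nth_cong)
    fix i assume i: "i \<le> r"
    have "fps_nth (\<Sum>j\<le>r. of_nat ((2 * j) choose j) * (?q ^ j * w ^ Suc (2 * j))) i =
      fps_nth (w * (\<Sum>j\<le>r. of_nat ((2 * j) choose j) * (?q * w ^ 2) ^ j)) i"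
      unfolding sum_distrib_left power_mult_distrib power_mult power_Suc by (simp only: mult_ac)
    also have "\<dots> = fps_nth (w * (central_fps oo (?q * w ^ 2))) i"
      by (rule fps_mult_nth_cong)
         (use i in \<open>simp add: compose_nth_upto [OF all_q_0, where K = r] fps_sum_nth central_fps_def fps_of_nat [symmetric]\<close>)
    finally show "fps_nth (\<Sum>j\<le>r. of_nat ((2 * j) choose j) * (?q ^ j * w ^ Suc (2 * j))) i =
      fps_nth (w * (central_fps oo (?q * w ^ 2))) i" .
  qed
  finally show "fps_nth S r = fps_nth (fps_X * (w * (central_fps oo (?q * w ^ 2)))) r" .
qed

text \<open>Trinomial revision rewrites the coefficient as binom(2j-1, j) binom(n-1, 2j-1), and the
  sum over n gives w^(2j). Doubling turns binom(2j-1, j) into a central binomial, so the same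
  composite as for S appears.\<close>

lemma all_R_compose: "2 * R - 1 = central_fps oo (fps_X ^ 2 * R * w ^ 2)"
proof (rule fps_ext)
  fix r
  let ?y = "fps_X * S" and ?q = "fps_X ^ 2 * R"
  \<comment> \<open>Zero at j = 0 because the sum in the equation for R starts at j = 1.\<close>
  let ?c = "\<lambda>j. if j = 0 then 0 else (2 * j - 1) choose j"
  have eq: "fps_X ^ n * (\<Sum>j = 1..n div 2. of_nat (((n - 1) choose (j - 1)) * ((n - j) choose j)) * R ^ j * S ^ (n - 2 * j))
    = (\<Sum>j\<in>{j. 2 * j \<le> n}. of_nat (?c j * ((n - 2 * j + (2 * j - 1)) choose (n - 2 * j))) * (?q ^ j * ?y ^ (n - 2 * j)))" for n
  proof -
    have "{1..n div 2} = {j. 2 * j \<le> n} - {0}"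
      by auto
    moreover have "finite {j. 2 * j \<le> n}"
      by (rule finite_subset [of _ "{..n}"]) auto
    moreover have "fps_X ^ n * (of_nat (((n - 1) choose (j - 1)) * ((n - j) choose j)) * R ^ j * S ^ (n - 2 * j)) =
       of_nat (?c j * ((n - 2 * j + (2 * j - 1)) choose (n - 2 * j))) * (?q ^ j * ?y ^ (n - 2 * j))"
      if j: "2 * j \<le> n" "1 \<le> j" for j
    proof -
      have X: "fps_X ^ n = fps_X ^ (2 * j) * (fps_X ^ (n - 2 * j) :: rat fps)"
        unfolding power_add [symmetric] using j by simp
      have "((n - 1) choose (2 * j - 1)) * ((2 * j - 1) choose (j - 1)) =
         ((n - 1) choose (j - 1)) * ((n - 1 - (j - 1)) choose (2 * j - 1 - (j - 1)))"
        by (rule choose_mult) (use j in auto)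
      moreover have "n - 1 - (j - 1) = n - j" "2 * j - 1 - (j - 1) = j" "n - 2 * j + (2 * j - 1) = n - 1"
        using j by auto
      moreover have "(n - 1) choose (2 * j - 1) = (n - 1) choose (n - 2 * j)"
        using binomial_symmetric [of "2 * j - 1" "n - 1"] j by simp
      moreover have "(2 * j - 1) choose (j - 1) = (2 * j - 1) choose j"
      proof -
        have "2 * j - 1 - (j - 1) = j"
          using j by simp
        then show ?thesis
          using binomial_symmetric [of "j - 1" "2 * j - 1"] j by simp
      qed
      ultimately have b: "((n - 1) choose (j - 1)) * ((n - j) choose j) = ?c j * ((n - 2 * j + (2 * j - 1)) choose (n - 2 * j))"
        using j by (simp add: mult.commute)
      show ?thesis
        unfolding b X power_mult_distrib power_mult by (simp only: mult_ac)
    qed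
    ultimately show ?thesis
      by (subst sum.mono_neutral_right [of "{j. 2 * j \<le> n}" "{1..n div 2}"])
         (auto simp: sum_distrib_left intro!: sum.cong)
  qed
  have "fps_nth R r = fps_nth (1 + (\<Sum>a<r. fps_const 1 * fps_X ^ Suc a *
     (\<Sum>j = 1..Suc a div 2. of_nat ((a choose (j - 1)) * ((Suc a - j) choose j)) * R ^ j * S ^ (Suc a - 2 * j)))) r"
    unfolding R_def S_def by (rule specialise_R) simp
  also have "\<dots> = fps_nth (1 + (\<Sum>n\<in>Suc ` {..<r}. fps_X ^ n *
     (\<Sum>j = 1..n div 2. of_nat (((n - 1) choose (j - 1)) * ((n - j) choose j)) * R ^ j * S ^ (n - 2 * j)))) r"
    by (simp add: sum.reindex)
  also have "(\<Sum>n\<in>Suc ` {..<r}. fps_X ^ n *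
     (\<Sum>j = 1..n div 2. of_nat (((n - 1) choose (j - 1)) * ((n - j) choose j)) * R ^ j * S ^ (n - 2 * j))) =
    (\<Sum>n\<le>r. fps_X ^ n *
     (\<Sum>j = 1..n div 2. of_nat (((n - 1) choose (j - 1)) * ((n - j) choose j)) * R ^ j * S ^ (n - 2 * j)))"
    unfolding image_Suc_lessThan by (rule sum.mono_neutral_left) auto
  also have "fps_nth (1 + \<dots>) r = fps_nth 1 r + fps_nth (\<Sum>j\<le>r. of_nat (?c j) * (?q ^ j * w ^ Suc (2 * j - 1))) r"
    unfolding eq fps_add_nth double_binomial_sum [OF w_mult order_refl] ..
  also have "fps_nth (\<Sum>j\<le>r. of_nat (?c j) * (?q ^ j * w ^ Suc (2 * j - 1))) r =
      (\<Sum>j\<le>r. of_nat (?c j) * fps_nth ((?q * w ^ 2) ^ j) r)"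
    unfolding fps_sum_nth
  proof (intro sum.cong refl)
    fix j
    show "fps_nth (of_nat (?c j) * (?q ^ j * w ^ Suc (2 * j - 1))) r = of_nat (?c j) * fps_nth ((?q * w ^ 2) ^ j) r"
    proof (cases j)
      case (Suc k)
      then have "Suc (2 * j - 1) = 2 * j"
        by simp
      then have "?q ^ j * w ^ Suc (2 * j - 1) = (?q * w ^ 2) ^ j"
        by (simp only: power_mult_distrib power_mult mult.assoc)
      then show ?thesis
        by (simp only: fps_of_nat [symmetric] fps_mult_left_const_nth)
    qed simp
  qed
  finally have R: "fps_nth R r = fps_nth 1 r + (\<Sum>j\<le>r. of_nat (?c j) * fps_nth ((?q * w ^ 2) ^ j) r)" .
  have "fps_nth (central_fps oo (?q * w ^ 2)) r = (\<Sum>j\<le>r. (if j = 0 then fps_nth 1 r else 0) + 2 * (of_nat (?c j) * fps_nth ((?q * w ^ 2) ^ j) r))"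
    unfolding compose_nth_upto [OF all_q_0 order_refl]
  proof (intro sum.cong refl)
    fix j
    show "fps_nth central_fps j * fps_nth ((?q * w ^ 2) ^ j) r =
       (if j = 0 then fps_nth 1 r else 0) + 2 * (of_nat (?c j) * fps_nth ((?q * w ^ 2) ^ j) r)"
    proof (cases "j = 0")
      case False
      have "(2 * j - 1) choose (j - 1) = (2 * j - 1) choose j"
        using binomial_symmetric [of "j - 1" "2 * j - 1"] False by (simp add: mult_2)
      then show ?thesis
        using False by (simp add: central_fps_def half_central_binomial)
    qed (simp add: central_fps_def)
  qed
  also have "\<dots> = fps_nth 1 r + 2 * (\<Sum>j\<le>r. of_nat (?c j) * fps_nth ((?q * w ^ 2) ^ j) r)"
    by (simp only: sum.distrib sum_distrib_left) simp
  also have "\<dots> = 2 * fps_nth R r - fps_nth 1 r"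
    unfolding R by simp
  finally show "fps_nth (2 * R - 1) r = fps_nth (central_fps oo (?q * w ^ 2)) r"
    by (simp add: numeral_fps_const)
qed

text \<open>R and S share the central binomial factor b = 2 R - 1. With y = X S the two composition
  formulas give relations among b, y and X^2; eliminating X^2 and cancelling the nonzero factors 1 +
  b and 1 - y leaves b (1 - 3 y) = 1 - y.\<close>

lemma all_equations:
  shows "S * (1 - 3 * (fps_X * S)) = fps_X" and "R * (1 - 3 * (fps_X * S)) = 1 - 2 * (fps_X * S)"
proof -
  define b where "b = 2 * R - 1"
  define y where "y = fps_X * S"
  have R: "2 * R = 1 + b"
    by (simp add: b_def)
  have w: "w * (1 - y) = 1"
    using w_mult by (simp add: y_def)
  have "b ^ 2 * (1 - 4 * (fps_X ^ 2 * R * w ^ 2)) = 1"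
    unfolding b_def all_R_compose by (rule central_fps_compose_sq [OF all_q_0])
  then have "b ^ 2 * (1 - 4 * (fps_X ^ 2 * R * w ^ 2)) * (1 - y) ^ 2 = (1 - y) ^ 2"
    by simp
  also have "b ^ 2 * (1 - 4 * (fps_X ^ 2 * R * w ^ 2)) * (1 - y) ^ 2 =
      b ^ 2 * ((1 - y) ^ 2 - 2 * fps_X ^ 2 * (2 * R) * (w * (1 - y)) ^ 2)"
    by (simp add: power2_eq_square algebra_simps)
  finally have 1: "b ^ 2 * ((1 - y) ^ 2 - 2 * fps_X ^ 2 * (1 + b)) = (1 - y) ^ 2"
    unfolding R w by simp
  have "S = fps_X * (w * b)"
    using all_S_compose unfolding all_R_compose [symmetric] b_def .
  then have "S * (1 - y) = fps_X * b * (w * (1 - y))"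
    by (simp only: mult_ac)
  then have S: "S * (1 - y) = fps_X * b"
    unfolding w by simp
  then have 2: "y * (1 - y) = fps_X ^ 2 * b"
    unfolding y_def power2_eq_square by (simp only: mult.assoc)
  have b0: "fps_nth b 0 = 1"
  proof -
    have "fps_nth R 0 = 1"
      using specialise_R [of 0 0 "\<lambda>_. 1"] by (simp add: R_def)
    then show ?thesis
      by (simp add: b_def numeral_fps_const)
  qed
  have y0: "fps_nth y 0 = 0"
    by (simp add: y_def)
  have "(1 + b) * ((b - 1) * (1 - y) ^ 2 - 2 * b * (fps_X ^ 2 * b)) = 0"
    using 1 by (simp add: power2_eq_square algebra_simps)
  moreover have "1 + b \<noteq> 0"
    using b0 by (metis fps_add_nth fps_one_nth fps_zero_nth one_add_one zero_neq_numeral)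
  ultimately have "(b - 1) * (1 - y) ^ 2 = 2 * b * (y * (1 - y))"
    unfolding 2 by simp
  then have "(1 - y) * (b * (1 - 3 * y) - (1 - y)) = 0"
    by (simp add: power2_eq_square algebra_simps)
  moreover have u: "1 - y \<noteq> 0"
    using y0 by (metis diff_zero fps_one_nth fps_sub_nth fps_zero_nth zero_neq_one)
  ultimately have 3: "b * (1 - 3 * y) = 1 - y"
    by simp
  have "fps_X * b * (1 - 3 * y) = fps_X * (1 - y)"
    by (simp only: 3 mult.assoc)
  then have "(1 - y) * (S * (1 - 3 * y)) = (1 - y) * fps_X"
    unfolding S [symmetric] by (simp only: mult_ac)
  then show "S * (1 - 3 * (fps_X * S)) = fps_X"
    using u by (simp add: y_def)
  have "2 * (R * (1 - 3 * y)) = (1 + b) * (1 - 3 * y)"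
    by (simp only: R [symmetric] mult.assoc)
  also have "\<dots> = (1 - 3 * y) + (1 - y)"
    by (simp only: distrib_right mult_1_left 3)
  also have "\<dots> = 2 * (1 - 2 * y)"
    by (simp add: algebra_simps)
  finally have "R * (1 - 3 * y) = 1 - 2 * y"
    by (metis mult_cancel_left zero_neq_numeral)
  then show "R * (1 - 3 * (fps_X * S)) = 1 - 2 * (fps_X * S)"
    unfolding y_def .
qed

end

section \<open>Planar moments for the two potentials\<close>

text \<open>The quadratic term of the loop equation; for k > 0 it is the coefficient of index k - 1
  in the square of the generating series, as \<open>conv_Suc\<close> states.\<close>

definition conv :: "(nat \<Rightarrow> 'a::comm_ring_1) \<Rightarrow> nat \<Rightarrow> 'a" where
  "conv W k = (\<Sum>p<k. W p * W (k - 1 - p))"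

lemma conv_Suc: "conv (fps_nth f) (Suc k) = fps_nth (f ^ 2) k"
  by (simp add: conv_def power2_eq_square fps_mult_nth lessThan_Suc_atMost atLeast0AtMost)

lemma conv_0 [simp]: "conv W 0 = 0"
  by (simp add: conv_def)

lemma fps_mult_nth_cong2:
  assumes "\<And>i. i \<le> r \<Longrightarrow> fps_nth f i = fps_nth f' i" "\<And>i. i \<le> r \<Longrightarrow> fps_nth g i = fps_nth g' i"
  shows "fps_nth (f * g) r = fps_nth (f' * g') r"
  unfolding fps_mult_nth using assms by (intro sum.cong) auto

lemma conv_nth_cong:
  fixes W W' :: "nat \<Rightarrow> rat fps"
  assumes "\<And>n i. n < k \<Longrightarrow> i \<le> r \<Longrightarrow> fps_nth (W n) i = fps_nth (W' n) i"
  shows "fps_nth (conv W k) r = fps_nth (conv W' k) r"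
  unfolding conv_def fps_sum_nth using assms by (intro sum.cong refl fps_mult_nth_cong2) auto

text \<open>\<open>H\<close> may involve arbitrarily late moments, but its factor X means that the
  coefficient at order r sees them only at orders below r. Hence the outer induction on r and the
  inner one on the index.\<close>

lemma loop_recursion_unique:
  fixes W W' :: "nat \<Rightarrow> rat fps"
  assumes "W 0 = W' 0"
    and "\<And>k. W (Suc k) = conv W k + fps_X * H W k" "\<And>k. W' (Suc k) = conv W' k + fps_X * H W' k"
    and H: "\<And>r k. (\<And>n i. i \<le> r \<Longrightarrow> fps_nth (W n) i = fps_nth (W' n) i) \<Longrightarrow> fps_nth (H W k) r = fps_nth (H W' k) r"
  shows "W = W'"
proof -
  have "\<forall>n. fps_nth (W n) r = fps_nth (W' n) r" for r
  proof (induction r rule: less_induct)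
    case (less r)
    have "fps_nth (W n) r = fps_nth (W' n) r" for n
    proof (induction n rule: less_induct)
      case inner: (less n)
      show ?case
      proof (cases n)
        case 0
        then show ?thesis
          using assms(1) by simp
      next
        case (Suc k)
        have "fps_nth (conv W k) r = fps_nth (conv W' k) r"
          by (rule conv_nth_cong) (use less inner Suc in \<open>auto simp: le_less\<close>)
        moreover have "fps_nth (fps_X * H W k) r = fps_nth (fps_X * H W' k) r"
          using less by (cases r) (auto intro: H)
        ultimately show ?thesis
          unfolding Suc assms(2,3) by simp
      qed
    qed
    then show ?case ..
  qed
  then show ?thesis
    by (intro ext fps_ext) blast
qed

text \<open>The coupling sum for k + 1 times X is the one for k without its first term; the
  remainder from the cutoff has order above r.\<close>

lemma telescope_all:
  fixes W :: "nat \<Rightarrow> rat fps"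
  shows "fps_nth ((\<Sum>a<Suc r. fps_X ^ Suc a * W (a + k)) - fps_X * (\<Sum>a<Suc r. fps_X ^ Suc a * W (a + Suc k))) r
    = fps_nth (fps_X * W k) r"
proof -
  have "fps_X * (\<Sum>a<n. fps_X ^ Suc a * W (a + Suc k)) = (\<Sum>a<n. fps_X ^ Suc a * W (a + k)) - fps_X * W k + fps_X ^ Suc n * W (n + k)" for n
    by (induction n) (simp_all add: algebra_simps)
  then show ?thesis
    by (simp only:) (simp add: fps_X_power_mult_nth del: power_Suc)
qed

text \<open>The loop equation at k + 1 expresses its coupling sum by W_(k+2) and a convolution.
  Inserting this into the telescoped equation at k removes the sum over couplings.\<close>

lemma moments_all_recursion:
  fixes W defines "W \<equiv> \<lambda>n. specialise (\<lambda>_. 1) (moment n)"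
  shows "W (Suc k) = conv W k + fps_X * (W (Suc (Suc k)) - conv W (Suc k) + W k)"
proof (rule fps_ext)
  fix r
  let ?T = "\<lambda>k. \<Sum>a<Suc r. fps_X ^ Suc a * W (a + k)"
  have eq: "fps_nth (W (Suc k)) i = fps_nth (conv W k + ?T k) i" if "i \<le> r" for i k
    using specialised_loop_equation [of i "Suc r" "\<lambda>_. 1" k] that by (simp add: W_def conv_def)
  have "fps_nth (fps_X * (W (Suc (Suc k)) - conv W (Suc k) + W k)) r = fps_nth (fps_X * (?T (Suc k) + W k)) r"
    by (rule fps_mult_nth_cong) (simp only: fps_add_nth fps_sub_nth eq)
  also have "\<dots> = fps_nth (?T k) r"
    using telescope_all [where r = r and W = W and k = k] by (simp only: distrib_left fps_add_nth fps_sub_nth)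
  finally show "fps_nth (W (Suc k)) r = fps_nth (conv W k + fps_X * (W (Suc (Suc k)) - conv W (Suc k) + W k)) r"
    using eq [OF order_refl] by simp
qed

text \<open>As \<open>telescope_all\<close>, but the couplings have period 2, so the shift is by two
  indices with factor X^2.\<close>

lemma telescope_even:
  fixes W :: "nat \<Rightarrow> rat fps"
  shows "fps_nth ((\<Sum>a<2 * r. fps_const (even_weight (Suc a)) * fps_X ^ Suc a * W (a + k))
      - fps_X ^ 2 * (\<Sum>a<2 * r. fps_const (even_weight (Suc a)) * fps_X ^ Suc a * W (a + Suc (Suc k)))) r
    = fps_nth (fps_X ^ 2 * W (Suc k)) r"
proof -
  have "fps_X ^ 2 * (\<Sum>a<2 * n. fps_const (even_weight (Suc a)) * fps_X ^ Suc a * W (a + Suc (Suc k))) =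
    (\<Sum>a<2 * n. fps_const (even_weight (Suc a)) * fps_X ^ Suc a * W (a + k)) - fps_X ^ 2 * W (Suc k)
      + fps_X ^ (2 * Suc n) * W (Suc (2 * n + k))" for n
    by (induction n) (simp_all add: algebra_simps even_weight_def power2_eq_square)
  then show ?thesis
    by (simp only:) (simp add: fps_X_power_mult_nth del: power_Suc)
qed

lemma moments_even_recursion:
  fixes W defines "W \<equiv> \<lambda>n. specialise even_weight (moment n)"
  shows "W (Suc k) = conv W k + fps_X * (fps_X * (W (Suc (Suc (Suc k))) - conv W (Suc (Suc k)) + W (Suc k)))"
proof (rule fps_ext)
  fix r
  let ?T = "\<lambda>k. \<Sum>a<2 * r. fps_const (even_weight (Suc a)) * fps_X ^ Suc a * W (a + k)"
  have eq: "fps_nth (W (Suc k)) i = fps_nth (conv W k + ?T k) i" if "i \<le> r" for i k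
    using specialised_loop_equation [of i "2 * r" even_weight k] that by (simp add: W_def conv_def)
  have "fps_nth (fps_X ^ 2 * (W (Suc (Suc (Suc k))) - conv W (Suc (Suc k)) + W (Suc k))) r =
      fps_nth (fps_X ^ 2 * (?T (Suc (Suc k)) + W (Suc k))) r"
    by (rule fps_mult_nth_cong) (simp only: fps_add_nth fps_sub_nth eq)
  also have "\<dots> = fps_nth (?T k) r"
    using telescope_even [where r = r and W = W and k = k] by (simp only: distrib_left fps_add_nth fps_sub_nth)
  finally have "fps_nth (fps_X * (fps_X * (W (Suc (Suc (Suc k))) - conv W (Suc (Suc k)) + W (Suc k)))) r = fps_nth (?T k) r"
    by (simp only: power2_eq_square mult.assoc)
  then show "fps_nth (W (Suc k)) r = fps_nth (conv W k +
      fps_X * (fps_X * (W (Suc (Suc (Suc k))) - conv W (Suc (Suc k)) + W (Suc k)))) r"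
    using eq [OF order_refl] by simp
qed

section \<open>Rational parametrisation of the spectral curves\<close>

fun quadratic_coeff :: "'a::comm_ring_1 \<Rightarrow> 'a \<Rightarrow> nat \<Rightarrow> 'a" where
  "quadratic_coeff A B 0 = 0"
| "quadratic_coeff A B (Suc n) = (if n = 0 then A else 0) + B * quadratic_coeff A B n +
     (\<Sum>i\<in>{0..n}. quadratic_coeff A B i * quadratic_coeff A B (n - i))"

text \<open>q is the branch of the uniformising parameter that vanishes at Z = 0, that is, at x =
  infinity.\<close>

lemma quadratic_fixpoint:
  obtains q :: "'a::comm_ring_1 fps" where "q = fps_X * (fps_const A + fps_const B * q + q ^ 2)"
proof
  let ?q = "Abs_fps (quadratic_coeff A B)"
  show "?q = fps_X * (fps_const A + fps_const B * ?q + ?q ^ 2)"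
  proof (rule fps_ext)
    fix n
    show "fps_nth ?q n = fps_nth (fps_X * (fps_const A + fps_const B * ?q + ?q ^ 2)) n"
      by (cases n) (simp_all add: power2_eq_square fps_mult_nth [of "Abs_fps _"])
  qed
qed

text \<open>The one-cut resolvent. With \<open>x = 1 / Z\<close> the spectral curve is uniformised by
  \<open>x = (R + \<sigma> q + q\<^sup>2) / q\<close>, where \<open>R = 1 + \<sigma>\<^sup>2\<close>.\<close>

lemma all_curve_identity:
  fixes \<sigma> q Z W F R :: "'a::idom"
  assumes "R = 1 + \<sigma> ^ 2" "F = R + \<sigma> * q + q ^ 2" "Z * F = q" "W * (R - \<sigma> * q) = F * (1 - \<sigma> * q)"
    and "F \<noteq> 0" "R - \<sigma> * q \<noteq> 0"
  shows "Z ^ 2 * (\<sigma> - (1 + 3 * \<sigma> ^ 2) * Z) * W ^ 2 + ((1 + 3 * \<sigma> ^ 2) * Z - \<sigma> - \<sigma> * Z ^ 2) * W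
    + (\<sigma> - (1 + 3 * \<sigma> ^ 2) * Z + \<sigma> * (\<sigma> * (1 - \<sigma> ^ 2)) * Z) = 0" (is "?E = 0")
proof -
  let ?k = "1 + 3 * \<sigma> ^ 2" and ?d = "R - \<sigma> * q" and ?u = "1 - \<sigma> * q"
  \<comment> \<open>Multiplication by F d^2 clears the denominators of Z = q / F and W = F (1 -
    sigma q) / d.\<close>
  have "F * ?d ^ 2 * ?E =
      (\<sigma> * F - ?k * (Z * F)) * (Z * (W * ?d)) ^ 2 + (?k * (Z * F) - \<sigma> * F - \<sigma> * Z * (Z * F)) * (W * ?d) * ?d
      + (\<sigma> * F - ?k * (Z * F) + \<sigma> * (\<sigma> * (1 - \<sigma> ^ 2)) * (Z * F)) * ?d ^ 2"
    by Groebner_Basis.algebra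
  also have "\<dots> = (\<sigma> * F - ?k * q) * ((Z * F) * ?u) ^ 2 + (?k * q * F - \<sigma> * F ^ 2 - \<sigma> * (Z * F) * q) * ?u * ?d
      + (\<sigma> * F - ?k * q + \<sigma> * (\<sigma> * (1 - \<sigma> ^ 2)) * q) * ?d ^ 2"
    unfolding assms(4) assms(3) by (simp only: assms(3) [symmetric]) Groebner_Basis.algebra
  also have "\<dots> = 0"
    unfolding assms(3) unfolding assms(2) assms(1) by Groebner_Basis.algebra
  finally show ?thesis
    using assms(5,6) by simp
qed

text \<open>The curve x = q + R / q in the squared variables Z = 1 / x^2 and Q = q^2, so x^2 = (R +
  Q)^2 / Q; \<open>V\<close> is to be the generating series of the even moments.\<close>

lemma even_curve_identity:
  fixes r Q Z V F R :: "'a::idom"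
  assumes "R = 1 + r" "F = (R + Q) ^ 2" "Z * F = Q" "V * (R ^ 2 - r * Q) = (R + Q) * (R - r * Q)"
    and "F \<noteq> 0" "R ^ 2 - r * Q \<noteq> 0"
  shows "Z * ((1 + 2 * r) ^ 2 * Z - r) * V ^ 2 + (r * Z - (1 + 2 * r) ^ 2 * Z + r) * V
    + ((1 + 2 * r) ^ 2 * Z - r - r * (1 + r - r ^ 2) * Z) = 0" (is "?E = 0")
proof -
  let ?k = "(1 + 2 * r) ^ 2" and ?d = "R ^ 2 - r * Q" and ?u = "R - r * Q"
  have "F ^ 2 * ?d ^ 2 * ?E =
      (Z * F) * (?k * (Z * F) - r * F) * (V * ?d) ^ 2 + (r * (Z * F) - ?k * (Z * F) + r * F) * F * (V * ?d) * ?d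
      + (?k * (Z * F) - r * F - r * (1 + r - r ^ 2) * (Z * F)) * F * ?d ^ 2"
    by Groebner_Basis.algebra
  also have "\<dots> = 0"
    unfolding assms(3) assms(4) unfolding assms(2) assms(1) by Groebner_Basis.algebra
  finally show ?thesis
    using assms(5,6) by simp
qed


section \<open>The second moments of the two models\<close>

lemma moment_2_all:
  fixes \<sigma> defines "\<sigma> \<equiv> specialise (\<lambda>_. 1) S_series"
  shows "fps_X * (1 + 3 * \<sigma> ^ 2) = \<sigma>" (is ?A)
    and "specialise (\<lambda>_. 1) (moment 2) = (1 - \<sigma> ^ 2) * (1 + 3 * \<sigma> ^ 2)" (is ?B)
proof -
  have "\<sigma> * (1 - 3 * (fps_X * \<sigma>)) = fps_X"
    unfolding \<sigma>_def by (rule all_equations(1))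
  then show A: ?A
    by (simp add: algebra_simps power2_eq_square)
  have "fps_nth (fps_X * (1 + 3 * \<sigma> ^ 2)) 0 = 0"
    by simp
  then have s0: "fps_nth \<sigma> 0 = 0"
    unfolding A .
  define R where "R = 1 + \<sigma> ^ 2"
  define k where "k = 1 + 3 * \<sigma> ^ 2"
  \<comment> \<open>The value required of the first moment for the generating series to satisfy its
    quadratic equation on the curve; \<open>W1\<close> confirms it.\<close>
  define w1 where "w1 = \<sigma> * (1 - \<sigma> ^ 2)"
  have R: "R * inverse R = 1"
    by (rule inverse_mult_eq_1') (simp add: R_def s0 power2_eq_square)
  then have R_nz: "R \<noteq> 0"
    by auto
  have k_nz: "k \<noteq> 0"
  proof
    assume "k = 0"
    then have "fps_nth k 0 = 0" by simp
    then show False by (simp add: k_def s0 power2_eq_square numeral_fps_const)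
  qed
  obtain q where q: "q = fps_X * (fps_const R + fps_const \<sigma> * q + q ^ 2)"
    by (rule quadratic_fixpoint)
  have q0: "fps_nth q 0 = 0"
    by (subst q) simp
  define F where "F = fps_const R + fps_const \<sigma> * q + q ^ 2"
  define d where "d = fps_const R - fps_const \<sigma> * q"
  \<comment> \<open>The candidate generating series of the moments in Z = 1 / x. Its coefficients
    are themselves power series, so the denominator is inverted through its constant term R, which
    is a unit.\<close>
  define W where "W = F * (1 - fps_const \<sigma> * q) * fps_right_inverse d (inverse R)"
  have F0: "fps_nth F 0 = R" and d0: "fps_nth d 0 = R"
    by (simp_all add: F_def d_def q0 power2_eq_square)
  have "d * fps_right_inverse d (inverse R) = 1"
    by (rule fps_right_inverse) (simp add: d0 R)
  then have Wd: "W * d = F * (1 - fps_const \<sigma> * q)"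
    unfolding W_def by (simp add: mult.assoc mult.commute [of d])
  let ?K = "fps_const k" and ?s = "fps_const \<sigma>" and ?x = "fps_const (fps_X :: rat fps)" and ?Z = "fps_X :: rat fps fps"
  have cst: "fps_const R = 1 + ?s ^ 2" "?K = 1 + 3 * ?s ^ 2" "fps_const w1 = ?s * (1 - ?s ^ 2)"
    by (simp_all add: R_def k_def w1_def numeral_fps_const fps_const_add [symmetric] fps_const_sub [symmetric]
        fps_const_mult [symmetric] fps_const_power [symmetric] del: fps_const_add fps_const_sub fps_const_mult fps_const_power)
  have sK: "?s = ?x * ?K"
    unfolding fps_const_mult k_def A ..
  have E: "?Z ^ 2 * (?s - ?K * ?Z) * W ^ 2 + (?K * ?Z - ?s - ?s * ?Z ^ 2) * W + (?s - ?K * ?Z + ?s * fps_const w1 * ?Z) = 0"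
    unfolding cst(2,3)
  proof (rule all_curve_identity)
    show "fps_X * F = q"
      unfolding F_def using q by simp
    show "W * (fps_const R - ?s * q) = F * (1 - ?s * q)"
      using Wd by (simp only: d_def)
    show "F \<noteq> 0"
      using F0 R_nz by auto
    have "d \<noteq> 0"
      using d0 R_nz by auto
    then show "fps_const R - ?s * q \<noteq> 0"
      unfolding d_def .
  qed (simp_all only: F_def cst)
  \<comment> \<open>Since sigma is X times k, the constant k factors out of the curve identity.
    After cancellation the coefficients at Z^0 and Z^1 fix the first two moments, and the later ones
    are the moment recursion.\<close>
  have "?K * (?x * (?Z ^ 2 * W ^ 2) - ?Z ^ 3 * W ^ 2 + ?Z * W - ?x * W - ?x * (?Z ^ 2 * W) + ?x - ?Z + ?x * (fps_const w1 * ?Z)) = 0"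
    using E unfolding sK by Groebner_Basis.algebra
  then have E': "?x * (?Z ^ 2 * W ^ 2) - ?Z ^ 3 * W ^ 2 + ?Z * W - ?x * W - ?x * (?Z ^ 2 * W) + ?x - ?Z + ?x * (fps_const w1 * ?Z) = 0"
    using k_nz by simp
  have co: "fps_X * fps_nth (?Z ^ 2 * W ^ 2) n - fps_nth (?Z ^ 3 * W ^ 2) n + fps_nth (?Z * W) n - fps_X * fps_nth W n
      - fps_X * fps_nth (?Z ^ 2 * W) n + fps_nth ?x n - fps_nth ?Z n + fps_X * (w1 * fps_nth ?Z n) = 0" for n
    using arg_cong [OF E', of "\<lambda>f. fps_nth f n"]
    by (simp only: fps_add_nth fps_sub_nth fps_mult_left_const_nth fps_zero_nth)
  have W0: "fps_nth W 0 = 1"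
    using co [of 0] by (simp add: fps_X_power_mult_nth)
  have W1: "fps_nth W 1 = w1"
    using co [of 1] W0 by (simp add: fps_X_power_mult_nth)
  have rec: "fps_nth W (Suc k) = conv (fps_nth W) k +
      fps_X * (fps_nth W (Suc (Suc k)) - conv (fps_nth W) (Suc k) + fps_nth W k)" for k
  proof -
    have z3: "fps_nth (?Z ^ 3 * W ^ 2) (Suc (Suc k)) = conv (fps_nth W) k"
      by (cases k) (simp_all add: fps_X_power_mult_nth conv_Suc)
    have z2: "fps_nth (?Z ^ 2 * W ^ 2) (Suc (Suc k)) = conv (fps_nth W) (Suc k)"
      by (simp add: fps_X_power_mult_nth conv_Suc)
    have z1: "fps_nth (?Z ^ 2 * W) (Suc (Suc k)) = fps_nth W k"
      by (simp add: fps_X_power_mult_nth)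
    have z0: "fps_nth (?Z * W) (Suc (Suc k)) = fps_nth W (Suc k)"
      by simp
    show ?thesis
      using co [of "Suc (Suc k)"] unfolding z0 z1 z2 z3 by (simp add: algebra_simps)
  qed
  have eq: "(\<lambda>n. specialise (\<lambda>_. 1) (moment n)) = fps_nth W"
  proof (rule loop_recursion_unique [where H = "\<lambda>W k. W (Suc (Suc k)) - conv W (Suc k) + W k"])
    show "specialise (\<lambda>_. 1) (moment 0) = fps_nth W 0"
      by (simp add: W0)
    show "fps_nth (specialise (\<lambda>_. 1) (moment (Suc (Suc k))) - conv (\<lambda>n. specialise (\<lambda>_. 1) (moment n)) (Suc k)
        + specialise (\<lambda>_. 1) (moment k)) r
      = fps_nth (fps_nth W (Suc (Suc k)) - conv (fps_nth W) (Suc k) + fps_nth W k) r"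
      if "\<And>n i. i \<le> r \<Longrightarrow> fps_nth (specialise (\<lambda>_. 1) (moment n)) i = fps_nth (fps_nth W n) i" for r k
      unfolding fps_add_nth fps_sub_nth
      by (intro arg_cong2 [where f = "(+)"] arg_cong2 [where f = "(-)"] conv_nth_cong that) auto
  qed (rule moments_all_recursion rec)+
  \<comment> \<open>At k = 0 the convolution and the zeroth moment cancel, so the second moment is
    the first divided by X.\<close>
  have "fps_nth W 1 = fps_X * fps_nth W 2"
    using rec [of 0] by (simp add: conv_def W0 numeral_2_eq_2)
  then have "fps_X * fps_nth W 2 = fps_X * ((1 + 3 * \<sigma> ^ 2) * (1 - \<sigma> ^ 2))"
    unfolding W1 w1_def mult.assoc [symmetric] A by simp
  then show ?B
    using fun_cong [OF eq, of 2] by (simp add: mult.commute)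
qed

text \<open>In the variable Z = 1 / x^2 the second moment is the linear coefficient of the
  generating series, so the unknown \<open>v1\<close> of the quadratic equation is already the
  answer.\<close>

lemma moment_2_even:
  fixes r defines "r \<equiv> specialise even_weight R_series - 1"
  shows "specialise even_weight (moment 2) = 1 + r - r ^ 2"
proof -
  have A: "fps_X ^ 2 * (1 + 2 * r) ^ 2 = r"
    unfolding r_def by (rule even_R_equation [symmetric])
  have r0: "fps_nth r 0 = 0"
    by (subst A [symmetric]) (simp add: power2_eq_square)
  define R where "R = 1 + r"
  define k where "k = (1 + 2 * r) ^ 2"
  define v1 where "v1 = 1 + r - r ^ 2"
  have R: "R ^ 2 * inverse (R ^ 2) = 1"
    by (rule inverse_mult_eq_1') (simp add: R_def r0 power2_eq_square)
  then have R_nz: "R ^ 2 \<noteq> 0"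
    by auto
  have k_nz: "k \<noteq> 0"
  proof
    assume "k = 0"
    then have "fps_nth k 0 = 0" by simp
    then show False by (simp add: k_def r0 power2_eq_square numeral_fps_const)
  qed
  obtain q where q: "q = fps_X * (fps_const (R ^ 2) + fps_const (2 * R) * q + q ^ 2)"
    by (rule quadratic_fixpoint)
  have q0: "fps_nth q 0 = 0"
    by (subst q) simp
  let ?K = "fps_const k" and ?r = "fps_const r" and ?x = "fps_const (fps_X ^ 2 :: rat fps)" and ?Z = "fps_X :: rat fps fps"
  define F where "F = (fps_const R + q) ^ 2"
  define d where "d = fps_const R ^ 2 - ?r * q"
  define V where "V = (fps_const R + q) * (fps_const R - ?r * q) * fps_right_inverse d (inverse (R ^ 2))"
  have F0: "fps_nth F 0 = R ^ 2" and d0: "fps_nth d 0 = R ^ 2"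
    by (simp_all add: F_def d_def q0 power2_eq_square)
  have "d * fps_right_inverse d (inverse (R ^ 2)) = 1"
    by (rule fps_right_inverse) (simp only: d0 R)
  then have Vd: "V * d = (fps_const R + q) * (fps_const R - ?r * q)"
    unfolding V_def by (simp add: mult.assoc mult.commute [of d])
  have cst: "fps_const R = 1 + ?r" "?K = (1 + 2 * ?r) ^ 2" "fps_const v1 = 1 + ?r - ?r ^ 2"
    by (simp_all add: R_def k_def v1_def numeral_fps_const fps_const_add [symmetric] fps_const_sub [symmetric]
        fps_const_mult [symmetric] fps_const_power [symmetric] del: fps_const_add fps_const_sub fps_const_mult fps_const_power)
  have rK: "?r = ?x * ?K"
    unfolding fps_const_mult k_def A ..
  have E: "?Z * (?K * ?Z - ?r) * V ^ 2 + (?r * ?Z - ?K * ?Z + ?r) * V + (?K * ?Z - ?r - ?r * fps_const v1 * ?Z) = 0"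
    unfolding cst(2,3)
  proof (rule even_curve_identity)
    have "F = fps_const (R ^ 2) + fps_const (2 * R) * q + q ^ 2"
      unfolding F_def by (simp add: power2_eq_square algebra_simps numeral_fps_const fps_const_mult [symmetric] del: fps_const_mult)
    then show "fps_X * F = q"
      using q by simp
    show "V * (fps_const R ^ 2 - ?r * q) = (fps_const R + q) * (fps_const R - ?r * q)"
      using Vd by (simp only: d_def)
    show "F \<noteq> 0"
      using F0 R_nz by auto
    have "d \<noteq> 0"
      using d0 R_nz by auto
    then show "fps_const R ^ 2 - ?r * q \<noteq> 0"
      unfolding d_def .
  qed (simp_all only: F_def cst)
  have "?K * (?Z ^ 2 * V ^ 2 - ?x * (?Z * V ^ 2) + ?x * (?Z * V) - ?Z * V + ?x * V + ?Z - ?x - ?x * (fps_const v1 * ?Z)) = 0"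
    using E unfolding rK by Groebner_Basis.algebra
  then have E': "?Z ^ 2 * V ^ 2 - ?x * (?Z * V ^ 2) + ?x * (?Z * V) - ?Z * V + ?x * V + ?Z - ?x - ?x * (fps_const v1 * ?Z) = 0"
    using k_nz by simp
  let ?t = "fps_X ^ 2 :: rat fps"
  have co: "fps_nth (?Z ^ 2 * V ^ 2) n - ?t * fps_nth (?Z * V ^ 2) n + ?t * fps_nth (?Z * V) n - fps_nth (?Z * V) n
      + ?t * fps_nth V n + fps_nth ?Z n - fps_nth ?x n - ?t * (v1 * fps_nth ?Z n) = 0" for n
    using arg_cong [OF E', of "\<lambda>f. fps_nth f n"]
    by (simp only: fps_add_nth fps_sub_nth fps_mult_left_const_nth fps_zero_nth)
  have V0: "fps_nth V 0 = 1"
    using co [of 0] by (simp add: fps_X_power_mult_nth)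
  have V1: "fps_nth V 1 = v1"
    using co [of 1] V0 by (simp add: fps_X_power_mult_nth power2_eq_square [of V])
  have rec: "fps_nth V (Suc l) = fps_nth (V ^ 2) l + ?t * (fps_nth V (Suc (Suc l)) - fps_nth (V ^ 2) (Suc l) + fps_nth V (Suc l))" for l
  proof -
    have "fps_nth (?Z ^ 2 * V ^ 2) (Suc (Suc l)) = fps_nth (V ^ 2) l"
      "fps_nth (?Z * V ^ 2) (Suc (Suc l)) = fps_nth (V ^ 2) (Suc l)"
      "fps_nth (?Z * V) (Suc (Suc l)) = fps_nth V (Suc l)"
      by (simp_all add: fps_X_power_mult_nth)
    note * = this
    show ?thesis
      using co [of "Suc (Suc l)"] unfolding * by (simp add: algebra_simps)
  qed
  \<comment> \<open>V is interleaved with zeros to obtain all moments. In the recursion both sides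
    vanish for even k; for odd k it is \<open>rec\<close>.\<close>
  define W where "W n = (if even n then fps_nth V (n div 2) else 0)" for n
  have conv_even: "conv W k = 0" if "even k" for k
    unfolding conv_def
  proof (intro sum.neutral ballI)
    fix p assume "p \<in> {..<k}"
    then have "odd p \<or> odd (k - 1 - p)"
      using that by auto
    then show "W p * W (k - 1 - p) = 0"
      by (auto simp: W_def)
  qed
  have conv_odd: "conv W (Suc (2 * l)) = fps_nth (V ^ 2) l" for l
  proof -
    have "conv W (Suc (2 * l)) = (\<Sum>p | p < Suc (2 * l) \<and> even p. W p * W (2 * l - p))"
      unfolding conv_def diff_Suc_1 by (rule sum.mono_neutral_right) (auto simp: W_def)
    also have "\<dots> = (\<Sum>i = 0..l. fps_nth V i * fps_nth V (l - i))"
      by (rule sum.reindex_bij_witness [where i = "\<lambda>i. 2 * i" and j = "\<lambda>p. p div 2"])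
         (auto simp: W_def right_diff_distrib' [symmetric] elim!: evenE)
    finally show ?thesis
      by (simp add: power2_eq_square fps_mult_nth)
  qed
  have W_rec: "W (Suc k) = conv W k + fps_X * (fps_X * (W (Suc (Suc (Suc k))) - conv W (Suc (Suc k)) + W (Suc k)))" for k
  proof (cases "even k")
    case True
    then show ?thesis
      by (simp add: conv_even W_def)
  next
    case False
    then obtain l where l: "k = Suc (2 * l)"
      by (auto elim: oddE)
    have "conv W (Suc (Suc k)) = fps_nth (V ^ 2) (Suc l)"
      using conv_odd [of "Suc l"] l by simp
    moreover have "conv W k = fps_nth (V ^ 2) l"
      using conv_odd [of l] l by simp
    moreover have "W (Suc k) = fps_nth V (Suc l)" "W (Suc (Suc (Suc k))) = fps_nth V (Suc (Suc l))"
      using l by (simp_all add: W_def)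
    ultimately show ?thesis
      using rec [of l] by (simp only: power2_eq_square [of fps_X] mult.assoc)
  qed
  have eq: "(\<lambda>n. specialise even_weight (moment n)) = W"
  proof (rule loop_recursion_unique [where H = "\<lambda>W k. fps_X * (W (Suc (Suc (Suc k))) - conv W (Suc (Suc k)) + W (Suc k))"])
    show "specialise even_weight (moment 0) = W 0"
      by (simp add: W_def V0)
    show "fps_nth (fps_X * (specialise even_weight (moment (Suc (Suc (Suc k)))) - conv (\<lambda>n. specialise even_weight (moment n)) (Suc (Suc k))
        + specialise even_weight (moment (Suc k)))) r
      = fps_nth (fps_X * (W (Suc (Suc (Suc k))) - conv W (Suc (Suc k)) + W (Suc k))) r"
      if "\<And>n i. i \<le> r \<Longrightarrow> fps_nth (specialise even_weight (moment n)) i = fps_nth (W n) i" for r k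
    proof (rule fps_mult_nth_cong, unfold fps_add_nth fps_sub_nth)
      fix i assume "i \<le> r"
      then show "fps_nth (specialise even_weight (moment (Suc (Suc (Suc k))))) i
          - fps_nth (conv (\<lambda>n. specialise even_weight (moment n)) (Suc (Suc k))) i
          + fps_nth (specialise even_weight (moment (Suc k))) i
        = fps_nth (W (Suc (Suc (Suc k)))) i - fps_nth (conv W (Suc (Suc k))) i + fps_nth (W (Suc k)) i"
        using that by (intro arg_cong2 [where f = "(+)"] arg_cong2 [where f = "(-)"] conv_nth_cong that) auto
    qed
  qed (rule moments_even_recursion W_rec)+
  show ?thesis
    using fun_cong [OF eq, of 2] V1 by (simp add: W_def v1_def)
qed

section \<open>Closed forms\<close>

lemma fps_X_power_dvd_iff: "fps_X ^ k dvd (f :: 'a::comm_ring_1 fps) \<longleftrightarrow> (\<forall>i<k. fps_nth f i = 0)"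
proof
  assume *: "\<forall>i<k. fps_nth f i = 0"
  have "f = fps_X ^ k * fps_shift k f"
    by (rule fps_ext) (use * in \<open>simp add: fps_X_power_mult_nth\<close>)
  then show "fps_X ^ k dvd f"
    by (rule dvdI)
qed (auto simp: fps_X_power_mult_nth elim!: dvdE)

text \<open>X d/dX multiplies the coefficient of X^i by i, so no order is lost once the constant
  term vanishes.\<close>

lemma fps_X_power_dvd_deriv:
  fixes f :: "rat fps"
  assumes "fps_X ^ k dvd fps_X * fps_deriv f" "fps_nth f 0 = 0"
  shows "fps_X ^ k dvd f"
  unfolding fps_X_power_dvd_iff
proof (intro allI impI)
  fix i assume "i < k"
  then have "fps_nth (fps_X * fps_deriv f) i = 0"
    using assms(1) unfolding fps_X_power_dvd_iff by blast
  then show "fps_nth f i = 0"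
    using assms(2) by (cases i) (simp_all del: of_nat_Suc)
qed

lemma fps_X_deriv_unique:
  fixes f g :: "rat fps"
  assumes "fps_X * fps_deriv f = fps_X * fps_deriv g" "fps_nth f 0 = fps_nth g 0"
  shows "f = g"
proof -
  have "fps_deriv f = fps_deriv g"
    using assms(1) by simp
  then show ?thesis
    unfolding fps_deriv_eq_iff using assms(2) by simp
qed

lemma fps_nonzeroI_nth_0: "fps_nth f 0 = 1 \<Longrightarrow> f \<noteq> (0 :: 'a::zero_neq_one fps)"
  by auto

lemma fps_sqrt_eqI:
  fixes f g :: "'a::field_char_0 fps"
  assumes "g ^ 2 = f" "fps_nth g 0 = 1"
  shows "fps_sqrt f = g"
proof -
  have "fps_nth f 0 = 1"
    using assms by (auto simp: power2_eq_square)
  then have "g ^ Suc 1 = f \<longleftrightarrow> g = fps_radical (\<lambda>_ _. 1) (Suc 1) f"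
    by (intro radical_unique) (use assms(2) in auto)
  then show ?thesis
    using assms(1) by (simp add: fps_sqrt_def numeral_2_eq_2)
qed

lemma fps_log_nth_0 [simp]: "fps_nth (fps_log f) 0 = 0"
  by (simp add: fps_log_def)

lemma fps_log_deriv:
  fixes f :: "'a::field_char_0 fps"
  assumes "fps_nth f 0 = 1"
  shows "f * fps_deriv (fps_log f) = fps_deriv f"
proof -
  have g0: "fps_nth (f - 1) 0 = 0"
    using assms by simp
  have "(inverse (1 + fps_X) * (1 + fps_X)) oo (f - 1) = (1 :: 'a fps)"
    by (subst inverse_mult_eq_1) simp_all
  then have "(inverse (1 + fps_X) oo (f - 1)) * f = 1"
    unfolding fps_compose_mult_distrib [OF g0] fps_compose_add_distrib fps_X_fps_compose_startby0 [OF g0] by simp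
  then have *: "f * ((inverse (1 + fps_X) oo (f - 1)) * h) = h" for h
  proof -
    assume e: "(inverse (1 + fps_X) oo (f - 1)) * f = 1"
    have "f * ((inverse (1 + fps_X) oo (f - 1)) * h) = ((inverse (1 + fps_X) oo (f - 1)) * f) * h"
      by (simp only: mult_ac)
    then show ?thesis
      unfolding e by simp
  qed
  show ?thesis
    unfolding fps_log_def fps_compose_deriv [OF g0] fps_ln_deriv by (simp add: *)
qed

text \<open>Both sides have the same logarithmic derivative and constant term 0.\<close>

lemma fps_log_mult:
  fixes f g :: "'a::field_char_0 fps"
  assumes "fps_nth f 0 = 1" "fps_nth g 0 = 1"
  shows "fps_log (f * g) = fps_log f + fps_log g"
proof -
  have nz: "f * g \<noteq> 0"
    using assms by auto
  have "f * g * fps_deriv (fps_log (f * g)) = fps_deriv (f * g)"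
    by (rule fps_log_deriv) (simp add: assms)
  also have "\<dots> = f * g * fps_deriv (fps_log f + fps_log g)"
    using fps_log_deriv [OF assms(1)] fps_log_deriv [OF assms(2)]
    by (simp add: algebra_simps)
  finally have "fps_deriv (fps_log (f * g)) = fps_deriv (fps_log f + fps_log g)"
    using nz by simp
  then show ?thesis
    unfolding fps_deriv_eq_iff by simp
qed

lemma fps_log_1 [simp]: "fps_log 1 = (0 :: 'a::field_char_0 fps)"
  by (simp add: fps_log_def fps_ln_def)

text \<open>The Mercator series; m = 2 and m = 1 give the two potentials.\<close>

lemma fps_log_one_minus_nth:
  fixes a :: "'a::field_char_0"
  assumes "0 < m"
  shows "fps_nth (fps_log (1 - fps_const a * fps_X ^ m)) n =
    (if 0 < n \<and> m dvd n then - (a ^ (n div m)) / of_nat (n div m) else 0)"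
proof -
  have pw: "fps_nth ((- (fps_const a * fps_X ^ m)) ^ i) n = (if n = m * i then (- a) ^ i else 0)" for i
  proof -
    have "(- (fps_const a * fps_X ^ m)) ^ i = fps_const ((- a) ^ i) * fps_X ^ (m * i)"
      by (simp only: mult_minus_left [symmetric] fps_const_neg power_mult_distrib fps_const_power power_mult)
    then show ?thesis
      by (simp only: fps_mult_left_const_nth fps_X_power_nth) simp
  qed
  have "fps_nth (fps_log (1 - fps_const a * fps_X ^ m)) n =
      (\<Sum>i = 0..n. fps_nth (fps_ln 1) i * (if n = m * i then (- a) ^ i else 0))"
    by (simp add: fps_log_def fps_compose_nth pw)
  also have "\<dots> = (\<Sum>i = 0..n. if m dvd n \<and> i = n div m then fps_nth (fps_ln 1) i * (- a) ^ i else 0)"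
    using assms by (intro sum.cong) auto
  also have "\<dots> = (if m dvd n then fps_nth (fps_ln 1) (n div m) * (- a) ^ (n div m) else 0)"
    by (cases "m dvd n") (simp_all add: sum.delta)
  also have "\<dots> = (if 0 < n \<and> m dvd n then - (a ^ (n div m)) / of_nat (n div m) else 0)"
  proof (cases "0 < n \<and> m dvd n")
    case True
    then have "n div m \<noteq> 0"
      using assms by (auto elim!: dvdE)
    then obtain l where l: "n div m = Suc l"
      by (cases "n div m") auto
    have "(- 1) ^ l * (- a) ^ Suc l = - (a ^ Suc l)"
      by (simp add: power_minus [of a] mult.assoc [symmetric] power_add [symmetric])
    then show ?thesis
      using True unfolding l fps_ln_nth by (simp del: of_nat_Suc power_Suc add: times_divide_eq_left [symmetric])
  qed auto
  finally show ?thesis .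
qed

lemma formal_potential_even:
  "formal_potential even_coeffs = fps_const (1 / 2) * fps_X ^ 2 +
     fps_const (1 / 2) * fps_log (1 - fps_const (fps_to_fls (fps_X ^ 2)) * fps_X ^ 2)"
proof -
  have "- Abs_fps (\<lambda>n. if n = 0 then 0 else fps_to_fls (even_coeffs n) / of_nat n) =
     fps_const (1 / 2) * fps_log (1 - fps_const (fps_to_fls (fps_X ^ 2)) * fps_X ^ 2)"
  proof (rule fps_ext)
    fix n
    show "fps_nth (- Abs_fps (\<lambda>n. if n = 0 then 0 else fps_to_fls (even_coeffs n) / of_nat n)) n =
       fps_nth (fps_const (1 / 2) * fps_log (1 - fps_const (fps_to_fls (fps_X ^ 2)) * fps_X ^ 2)) n"
      unfolding fps_mult_left_const_nth fps_log_one_minus_nth [OF zero_less_numeral]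
      by (auto simp: even_coeffs_def fps_to_fls_power elim!: evenE)
  qed
  then show ?thesis
    unfolding formal_potential_def diff_conv_add_uminus by simp
qed

lemma formal_potential_all:
  "formal_potential all_coeffs = fps_const (1 / 2) * fps_X ^ 2 +
     fps_log (1 - fps_const (fps_to_fls fps_X) * fps_X)"
proof -
  have "- Abs_fps (\<lambda>n. if n = 0 then 0 else fps_to_fls (all_coeffs n) / of_nat n) =
     fps_log (1 - fps_const (fps_to_fls fps_X) * fps_X)"
  proof (rule fps_ext)
    fix n
    show "fps_nth (- Abs_fps (\<lambda>n. if n = 0 then 0 else fps_to_fls (all_coeffs n) / of_nat n)) n =
       fps_nth (fps_log (1 - fps_const (fps_to_fls fps_X) * fps_X)) n"
      using fps_log_one_minus_nth [of 1 "fps_to_fls fps_X :: rat fls" n]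
      by (simp add: all_coeffs_def fps_to_fls_power)
  qed
  then show ?thesis
    unfolding formal_potential_def diff_conv_add_uminus by simp
qed

lemma mps_subst_even: "mps_subst even_coeffs f = specialise even_weight f"
  by (rule mps_subst_eq_specialise) (auto simp: even_coeffs_def even_weight_def elim!: evenE simp flip: power_mult)

lemma mps_subst_all: "mps_subst all_coeffs f = specialise (\<lambda>_. 1) f"
  by (rule mps_subst_eq_specialise) (simp add: all_coeffs_def)

text \<open>Both potentials are governed by the rational curve \<open>t = y / (1 + c y)\<^sup>2\<close>.\<close>

lemma curve_deriv:
  fixes y c :: "rat fps"
  assumes "fps_X ^ 2 * (1 + c * y) ^ 2 = y" "fps_deriv c = 0"
  shows "fps_X * fps_deriv y * (1 - c * y) = 2 * y * (1 + c * y)"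
proof -
  let ?dy = "fps_deriv y"
  have "?dy = fps_deriv (fps_X ^ 2 * (1 + c * y) ^ 2)"
    unfolding assms(1) ..
  also have "\<dots> = 2 * fps_X * (1 + c * y) ^ 2 + fps_X ^ 2 * (2 * (1 + c * y) * (c * ?dy))"
    by (simp add: power2_eq_square assms(2) algebra_simps)
  finally have "fps_X * ?dy * (1 + c * y) = 2 * (fps_X ^ 2 * (1 + c * y) ^ 2) * (1 + c * y)
      + (fps_X ^ 2 * (1 + c * y) ^ 2) * (2 * c * (fps_X * ?dy))"
    by Groebner_Basis.algebra
  then show ?thesis
    unfolding assms(1) by Groebner_Basis.algebra
qed

text \<open>On the curve 1 - 4 c t = ((1 - c y) / (1 + c y))^2, because (1 + c y)^2 - 4 c y = (1 - c
  y)^2.\<close>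

lemma curve_sqrt:
  fixes y c :: "rat fps"
  assumes "fps_X ^ 2 * (1 + c * y) ^ 2 = y"
  shows "fps_sqrt (1 - 4 * c * fps_X ^ 2) * (1 + c * y) = 1 - c * y"
proof -
  have "fps_nth (fps_X ^ 2 * (1 + c * y) ^ 2) 0 = 0"
    by (simp add: power2_eq_square)
  then have y0: "fps_nth y 0 = 0"
    unfolding assms .
  let ?u = "1 + c * y"
  have u: "inverse ?u * ?u = 1"
    by (rule inverse_mult_eq_1) (simp add: y0)
  have "fps_sqrt (1 - 4 * c * fps_X ^ 2) = (1 - c * y) * inverse ?u"
  proof (rule fps_sqrt_eqI)
    have "(1 - c * y) ^ 2 = (1 - 4 * c * fps_X ^ 2) * ?u ^ 2"
    proof -
      have "(1 - 4 * c * fps_X ^ 2) * ?u ^ 2 = ?u ^ 2 - 4 * c * (fps_X ^ 2 * ?u ^ 2)"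
        by (simp add: algebra_simps)
      then show ?thesis
        unfolding assms by (simp add: power2_eq_square algebra_simps)
    qed
    then have "((1 - c * y) * inverse ?u) ^ 2 = (1 - 4 * c * fps_X ^ 2) * (inverse ?u * ?u) ^ 2"
      by (simp only: power_mult_distrib mult_ac)
    then show "((1 - c * y) * inverse ?u) ^ 2 = 1 - 4 * c * fps_X ^ 2"
      unfolding u by simp
  qed (simp add: y0)
  then show ?thesis
    using u by (simp add: mult.assoc)
qed

text \<open>Subtracting the two equations shows that the error y - p is minus the residual of p, up
  to a unit factor. So a polynomial is certified as a truncation by its residual alone.\<close>

lemma curve_truncation:
  fixes y p t c :: "rat fps"
  assumes "t * (1 + c * y) ^ 2 = y" "D dvd p - t * (1 + c * p) ^ 2" "fps_nth t 0 = 0"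
  shows "D dvd y - p"
proof -
  let ?e = "1 - t * c * (2 + c * y + c * p)"
  have e: "?e * inverse ?e = 1"
    by (rule inverse_mult_eq_1') (simp add: assms(3))
  have "(y - p) * ?e = (y - t * (1 + c * y) ^ 2) - (p - t * (1 + c * p) ^ 2)"
    by Groebner_Basis.algebra
  also have "\<dots> = - (p - t * (1 + c * p) ^ 2)"
    unfolding assms(1) by simp
  finally have *: "(y - p) * ?e = - (p - t * (1 + c * p) ^ 2)" .
  have "y - p = ((y - p) * ?e) * inverse ?e"
    unfolding mult.assoc [of "y - p"] e by simp
  then have "y - p = - (p - t * (1 + c * p) ^ 2) * inverse ?e"
    unfolding * .
  then show ?thesis
    using assms(2) by (simp only: dvd_minus_iff dvd_mult2)
qed


lemma fps_X_deriv_monomial: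
  "fps_X * fps_deriv (fps_const c * (fps_X ^ 2) ^ n) = fps_const (2 * of_nat n * c) * (fps_X ^ 2 :: rat fps) ^ n"
proof (rule fps_ext)
  fix k
  show "fps_nth (fps_X * fps_deriv (fps_const c * (fps_X ^ 2) ^ n)) k =
      fps_nth (fps_const (2 * of_nat n * c) * (fps_X ^ 2 :: rat fps) ^ n) k"
    by (cases k) (auto simp: fps_X_power_nth simp flip: power_mult simp del: of_nat_Suc)
qed

lemma curve_nth_0:
  fixes y c :: "rat fps"
  assumes "fps_X ^ 2 * (1 + c * y) ^ 2 = y"
  shows "fps_nth y 0 = 0" "fps_nth (1 + c * y) 0 = 1"
proof -
  have "fps_nth (fps_X ^ 2 * (1 + c * y) ^ 2) 0 = 0"
    by (simp add: power2_eq_square)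
  then show y0: "fps_nth y 0 = 0"
    unfolding assms .
  then show "fps_nth (1 + c * y) 0 = 1"
    by simp
qed

text \<open>Lets the square root be eliminated from the closed forms: it is linear in y over the
  polynomials in t and c.\<close>

lemma curve_linear:
  fixes y c D :: "rat fps"
  assumes c: "fps_X ^ 2 * (1 + c * y) ^ 2 = y" and D: "D * (1 + c * y) = 1 - c * y"
  shows "D = 1 - 2 * c * fps_X ^ 2 - 2 * c ^ 2 * fps_X ^ 2 * y"
proof -
  have "(1 + c * y) * (1 - 2 * c * fps_X ^ 2 - 2 * c ^ 2 * fps_X ^ 2 * y) =
      1 + c * y - 2 * c * (fps_X ^ 2 * (1 + c * y) ^ 2)"
    by Groebner_Basis.algebra
  also have "\<dots> = (1 + c * y) * D"
    unfolding c using D by Groebner_Basis.algebra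
  finally show ?thesis
    using fps_nonzeroI_nth_0 [OF curve_nth_0(2) [OF c]] by (simp only: mult_cancel_left simp_thms)
qed

text \<open>The argument of the logarithm equals 1 / (1 + c y)^2 on the curve.\<close>

lemma curve_log:
  fixes y c D :: "rat fps"
  assumes c: "fps_X ^ 2 * (1 + c * y) ^ 2 = y" and D: "D * (1 + c * y) = 1 - c * y"
  shows "fps_log (fps_const (1 / 2) * (1 - 2 * c * fps_X ^ 2 + D)) = - (2 * fps_log (1 + c * y))"
proof -
  let ?w = "1 + c * y" and ?G = "fps_const (1 / 2) * (1 - 2 * c * fps_X ^ 2 + D)"
  have "?G * (?w * ?w) = fps_const (1 / 2) * (?w ^ 2 - 2 * c * (fps_X ^ 2 * ?w ^ 2) + (D * ?w) * ?w)"
    by Groebner_Basis.algebra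
  also have "\<dots> = fps_const (1 / 2) * 2"
    unfolding c D by Groebner_Basis.algebra
  finally have G: "?G * (?w * ?w) = 1"
    by (simp add: numeral_fps_const)
  have w0: "fps_nth ?w 0 = 1"
    by (rule curve_nth_0(2) [OF c])
  then have ww0: "fps_nth (?w * ?w) 0 = 1"
    unfolding fps_mult_nth_0 by (simp only: mult_1_left)
  have G0: "fps_nth ?G 0 = 1"
    using arg_cong [OF G, of "\<lambda>f. fps_nth f 0"] ww0 by (metis fps_mult_nth_0 fps_one_nth mult_1_right)
  have "fps_log (?G * (?w * ?w)) = fps_log ?G + (fps_log ?w + fps_log ?w)"
    by (simp only: fps_log_mult [OF G0 ww0] fps_log_mult [OF w0 w0])
  then show ?thesis
    unfolding G by (simp add: eq_neg_iff_add_eq_0)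
qed

text \<open>By \<open>curve_deriv\<close>, X y' = 2 y (1 + c y) / (1 - c y). Applying X d/dX to the
  ansatz therefore gives a rational function of y, and the hypothesis on \<open>k\<close> says that
  it equals 2 y k.\<close>

lemma curve_primitive:
  fixes y c a b d k F :: "rat fps"
  assumes c: "fps_X ^ 2 * (1 + c * y) ^ 2 = y"
    and const: "fps_deriv a = 0" "fps_deriv b = 0" "fps_deriv c = 0" "fps_deriv d = 0"
    and k: "(2 * a * y + b) * (1 + c * y) + d * c = k * (1 - c * y)"
    and F: "2 * (fps_X * fps_deriv F) = y * k" "fps_nth F 0 = 0"
  shows "4 * F = a * y ^ 2 + b * y + d * fps_log (1 + c * y)"
proof (rule fps_X_deriv_unique)
  let ?w = "1 + c * y" and ?L = "fps_log (1 + c * y)"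
  have dL: "?w * fps_deriv ?L = c * fps_deriv y"
    by (subst fps_log_deriv [OF curve_nth_0(2) [OF c]]) (simp add: const)
  have dy: "fps_X * fps_deriv y * (1 - c * y) = 2 * y * ?w"
    by (rule curve_deriv [OF c const(3)])
  have nz: "?w \<noteq> 0"
    by (rule fps_nonzeroI_nth_0 [OF curve_nth_0(2) [OF c]])
  have "?w * (fps_X * ((2 * a * y + b) * fps_deriv y + d * fps_deriv ?L)) =
      fps_X * fps_deriv y * ((2 * a * y + b) * ?w) + d * fps_X * (?w * fps_deriv ?L)"
    by Groebner_Basis.algebra
  also have "\<dots> = fps_X * fps_deriv y * ((2 * a * y + b) * ?w + d * c)"
    unfolding dL by Groebner_Basis.algebra
  also have "\<dots> = (fps_X * fps_deriv y * (1 - c * y)) * k"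
    unfolding k by Groebner_Basis.algebra
  also have "\<dots> = ?w * (2 * (y * k))"
    unfolding dy by Groebner_Basis.algebra
  finally have "fps_X * ((2 * a * y + b) * fps_deriv y + d * fps_deriv ?L) = 2 * (y * k)"
    using nz by (simp only: mult_cancel_left simp_thms)
  moreover have "fps_deriv (a * y ^ 2 + b * y + d * ?L) = (2 * a * y + b) * fps_deriv y + d * fps_deriv ?L"
    by (simp add: power2_eq_square const algebra_simps)
  moreover have "fps_X * fps_deriv (4 * F) = 2 * (2 * (fps_X * fps_deriv F))"
    by (simp add: mult.left_commute [of fps_X])
  ultimately show "fps_X * fps_deriv (4 * F) = fps_X * fps_deriv (a * y ^ 2 + b * y + d * ?L)"
    unfolding F by (simp only:)
  show "fps_nth (4 * F) 0 = fps_nth (a * y ^ 2 + b * y + d * ?L) 0"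
    by (simp add: F curve_nth_0(1) [OF c] power2_eq_square)
qed

section \<open>Closed forms and expansions for the two models\<close>

lemma proposition_even:
  defines "t \<equiv> fps_X ^ 2 :: rat fps"
  defines "T \<equiv> fps_to_fls t"
    and "D \<equiv> fps_sqrt (1 - 8 * t)"
    and "R \<equiv> specialise even_weight R_series"
    and "F0 \<equiv> specialise even_weight (free_energy 0)"
  shows "fps_to_fls R = (1 + 4 * T - fps_to_fls D) / (8 * T)"
    and "fps_to_fls F0 =
         (1 - 24 * T + 72 * T ^ 2 - (1 - 20 * T) * fps_to_fls D) / (128 * T ^ 2)
         - 3 / 8 * fps_to_fls (fps_log (fps_const (1 / 2) * (1 - 4 * t + D)))"
    and "t ^ 9 dvd F0 - (fps_const (1 / 2) * t + fps_const (3 / 4) * t ^ 2 + 2 * t ^ 3 + 7 * t ^ 4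
         + fps_const (144 / 5) * t ^ 5 + 132 * t ^ 6 + fps_const (4576 / 7) * t ^ 7 + 3432 * t ^ 8)"
proof -
  define r where "r = R - 1"
  define L where "L = fps_log (1 + 2 * r)"
  have c: "t * (1 + 2 * r) ^ 2 = r"
    unfolding r_def t_def R_def by (rule even_R_equation [symmetric])
  have dF: "fps_X * fps_deriv F0 = r - r ^ 2"
    unfolding F0_def deriv_free_energy moment_2_even r_def R_def by simp
  have F_0: "fps_nth F0 0 = 0"
    unfolding F0_def specialise_nth_0 by (rule mps_coeff_free_energy_0)
  \<comment> \<open>Here k is 2 X F0' / r; the coefficients 1, -4 and 3 result from comparing powers
    of r in the condition on k.\<close>
  have "4 * F0 = 1 * r ^ 2 + - 4 * r + 3 * L"
    unfolding L_def
  proof (rule curve_primitive [OF c [unfolded t_def], where k = "2 - 2 * r"])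
    show "(2 * 1 * r + - 4) * (1 + 2 * r) + 3 * 2 = (2 - 2 * r) * (1 - 2 * r)"
      by Groebner_Basis.algebra
    show "2 * (fps_X * fps_deriv F0) = r * (2 - 2 * r)"
      unfolding dF by Groebner_Basis.algebra
  qed (simp_all add: F_0)
  then have F: "4 * F0 = r ^ 2 - 4 * r + 3 * L"
    by simp
  have D: "D * (1 + 2 * r) = 1 - 2 * r"
    using curve_sqrt [of 2 r] c unfolding D_def t_def by simp
  have lin: "D = 1 - 4 * t - 8 * t * r"
    using curve_linear [OF c [unfolded t_def] D] unfolding t_def by simp
  have t_nz: "T \<noteq> 0"
    unfolding T_def t_def by simp
  have "R * (8 * t) = 1 + 4 * t - D"
    unfolding lin by (simp add: r_def algebra_simps)
  then have "fps_to_fls (R * (8 * t)) = fps_to_fls (1 + 4 * t - D)"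
    by simp
  then show "fps_to_fls R = (1 + 4 * T - fps_to_fls D) / (8 * T)"
    using t_nz by (simp add: fls_times_fps_to_fls T_def [symmetric] field_simps)
  define G where "G = fps_const (1 / 2) * (1 - 4 * t + D)"
  have LG: "fps_log G = - (2 * L)"
    using curve_log [OF c [unfolded t_def] D] unfolding G_def L_def t_def by simp
  \<comment> \<open>Eliminating D leaves a multiple of r^2 - 4 r up to the curve equation. The
    denominator 128 is 4 times 32, and 3/8 is half of 3/4 because log G = - 2 L.\<close>
  have N: "1 - 24 * t + 72 * t ^ 2 - (1 - 20 * t) * D = 32 * t ^ 2 * (r ^ 2 - 4 * r)"
  proof -
    have "1 - 24 * t + 72 * t ^ 2 - (1 - 20 * t) * D =
        32 * t ^ 2 * (r ^ 2 - 4 * r) + 8 * t * (r - t * (1 + 2 * r) ^ 2)"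
      unfolding lin by Groebner_Basis.algebra
    then show ?thesis
      unfolding c by simp
  qed
  have "128 * t ^ 2 * (8 * F0) = 8 * (1 - 24 * t + 72 * t ^ 2 - (1 - 20 * t) * D) - 3 * fps_log G * (128 * t ^ 2)"
    unfolding N LG using F by Groebner_Basis.algebra
  then have "fps_to_fls (128 * t ^ 2 * (8 * F0)) =
      fps_to_fls (8 * (1 - 24 * t + 72 * t ^ 2 - (1 - 20 * t) * D) - 3 * fps_log G * (128 * t ^ 2))"
    by simp
  then have "128 * T ^ 2 * (8 * fps_to_fls F0) =
      8 * (1 - 24 * T + 72 * T ^ 2 - (1 - 20 * T) * fps_to_fls D) - 3 * fps_to_fls (fps_log G) * (128 * T ^ 2)"
    by (simp only: fls_times_fps_to_fls fps_to_fls_minus fps_to_fls_plus fps_to_fls_numeral fps_to_fls_power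
        fps_one_to_fls T_def)
  then show "fps_to_fls F0 =
         (1 - 24 * T + 72 * T ^ 2 - (1 - 20 * T) * fps_to_fls D) / (128 * T ^ 2)
         - 3 / 8 * fps_to_fls (fps_log (fps_const (1 / 2) * (1 - 4 * t + D)))"
    unfolding G_def [symmetric] using t_nz by (simp add: divide_simps) (simp add: algebra_simps)
  \<comment> \<open>The solution of r = t (1 + 2 r)^2 up to t^8; the coefficient of t^n is 2^(n-1)
    times the n-th Catalan number.\<close>
  let ?p = "t + 4 * t ^ 2 + 20 * t ^ 3 + 112 * t ^ 4 + 672 * t ^ 5 + 4224 * t ^ 6 + 27456 * t ^ 7 + 183040 * t ^ 8"
  have rp: "t ^ 9 dvd r - ?p"
  proof (rule curve_truncation [OF c])
    \<comment> \<open>The multiple of t^9 is the overflow of t (1 + 2 p)^2 past t^8; its first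
      coefficient continues the pattern of \<open>?p\<close>.\<close>
    have "?p - t * (1 + 2 * ?p) ^ 2 = t ^ 9 * - (1244672 + 3620864 * t + 15841280 * t ^ 2 + 76595200 * t ^ 3
        + 382976000 * t ^ 4 + 1911816192 * t ^ 5 + 9200615424 * t ^ 6 + 40204369920 * t ^ 7 + 134014566400 * t ^ 8)"
      by Groebner_Basis.algebra
    then show "t ^ 9 dvd ?p - t * (1 + 2 * ?p) ^ 2"
      by (rule dvdI)
  qed (simp add: t_def)
  let ?P = "fps_const (1 / 2) * t + fps_const (3 / 4) * t ^ 2 + 2 * t ^ 3 + 7 * t ^ 4
         + fps_const (144 / 5) * t ^ 5 + 132 * t ^ 6 + fps_const (4576 / 7) * t ^ 7 + 3432 * t ^ 8"
  have dP: "fps_X * fps_deriv ?P = t + 3 * t ^ 2 + 12 * t ^ 3 + 56 * t ^ 4 + 288 * t ^ 5 + 1584 * t ^ 6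
      + 9152 * t ^ 7 + 54912 * t ^ 8"
  proof -
    have "?P = fps_const (1 / 2) * t ^ 1 + fps_const (3 / 4) * t ^ 2 + fps_const 2 * t ^ 3 + fps_const 7 * t ^ 4
         + fps_const (144 / 5) * t ^ 5 + fps_const 132 * t ^ 6 + fps_const (4576 / 7) * t ^ 7 + fps_const 3432 * t ^ 8"
      by (simp add: numeral_fps_const)
    then show ?thesis
      unfolding t_def by (simp only: fps_deriv_add distrib_left fps_X_deriv_monomial)
        (simp add: numeral_fps_const)
  qed
  \<comment> \<open>The product equals (r - r^2) - (p - p^2), and the added multiple of t^9 is the
    part of p - p^2 beyond t^8.\<close>
  have "t ^ 9 dvd (r - ?p) * (1 - r - ?p) +
      t ^ 9 * - (905216 + 3960320 * t + 19148800 * t ^ 2 + 95744000 * t ^ 3 + 477954048 * t ^ 4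
        + 2300153856 * t ^ 5 + 10051092480 * t ^ 6 + 33503641600 * t ^ 7)"
    using rp by (intro dvd_add dvd_mult2 dvd_triv_left)
  also have "(r - ?p) * (1 - r - ?p) +
      t ^ 9 * - (905216 + 3960320 * t + 19148800 * t ^ 2 + 95744000 * t ^ 3 + 477954048 * t ^ 4
        + 2300153856 * t ^ 5 + 10051092480 * t ^ 6 + 33503641600 * t ^ 7) = fps_X * fps_deriv (F0 - ?P)"
    unfolding fps_deriv_sub right_diff_distrib dF dP by Groebner_Basis.algebra
  finally have "fps_X ^ 18 dvd fps_X * fps_deriv (F0 - ?P)"
    by (simp add: t_def power_mult [symmetric])
  then have "fps_X ^ 18 dvd F0 - ?P"
    by (rule fps_X_power_dvd_deriv) (simp add: F_0 t_def fps_X_power_nth power_mult [symmetric] numeral_fps_const)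
  then show "t ^ 9 dvd F0 - ?P"
    by (simp add: t_def power_mult [symmetric])
qed


lemma proposition_all:
  defines "t \<equiv> fps_X ^ 2 :: rat fps"
  defines "T \<equiv> fps_to_fls t"
    and "D \<equiv> fps_sqrt (1 - 12 * t)"
    and "R \<equiv> specialise (\<lambda>_. 1) R_series"
    and "S \<equiv> specialise (\<lambda>_. 1) S_series"
    and "F0 \<equiv> specialise (\<lambda>_. 1) (free_energy 0)"
  shows "fps_to_fls S = (1 - fps_to_fls D) / (6 * fps_to_fls fps_X)"
    and "fps_to_fls R = (1 + 12 * T - fps_to_fls D) / (18 * T)"
    and "fps_to_fls F0 =
         (1 - 36 * T + 162 * T ^ 2 - (1 - 30 * T) * fps_to_fls D) / (216 * T ^ 2)
         - 1 / 2 * fps_to_fls (fps_log (fps_const (1 / 2) * (1 - 6 * t + D)))"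
    and "t ^ 8 dvd F0 - (t + fps_const (9 / 4) * t ^ 2 + 9 * t ^ 3 + fps_const (189 / 4) * t ^ 4
         + fps_const (1458 / 5) * t ^ 5 + fps_const (8019 / 4) * t ^ 6 + fps_const (104247 / 7) * t ^ 7)"
proof -
  \<comment> \<open>The curve parameter is S^2 here; it equals R - 1 by the equation for R, as
    derived below.\<close>
  define u where "u = S ^ 2"
  define L where "L = fps_log (1 + 3 * u)"
  have S: "fps_X * (1 + 3 * u) = S"
    unfolding u_def S_def by (rule moment_2_all(1))
  have c: "t * (1 + 3 * u) ^ 2 = u"
    unfolding t_def power_mult_distrib [symmetric] S by (simp only: u_def)
  have dF: "fps_X * fps_deriv F0 = 2 * u - 3 * u ^ 2"
    unfolding F0_def deriv_free_energy moment_2_all(2) u_def S_def by Groebner_Basis.algebra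
  have F_0: "fps_nth F0 0 = 0"
    unfolding F0_def specialise_nth_0 by (rule mps_coeff_free_energy_0)
  \<comment> \<open>Again k is 2 X F0' / u, and 3, -8 and 4 solve the condition on k power by power
    in u.\<close>
  have "4 * F0 = 3 * u ^ 2 + - 8 * u + 4 * L"
    unfolding L_def
  proof (rule curve_primitive [OF c [unfolded t_def], where k = "4 - 6 * u"])
    show "(2 * 3 * u + - 8) * (1 + 3 * u) + 4 * 3 = (4 - 6 * u) * (1 - 3 * u)"
      by Groebner_Basis.algebra
    show "2 * (fps_X * fps_deriv F0) = u * (4 - 6 * u)"
      unfolding dF by Groebner_Basis.algebra
  qed (simp_all add: F_0)
  then have F: "4 * F0 = 3 * u ^ 2 - 8 * u + 4 * L"
    by simp
  have D: "D * (1 + 3 * u) = 1 - 3 * u"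
    using curve_sqrt [of 3 u] c unfolding D_def t_def by simp
  have lin: "D = 1 - 6 * t - 18 * t * u"
    using curve_linear [OF c [unfolded t_def] D] unfolding t_def by simp
  have t_nz: "T \<noteq> 0"
    unfolding T_def t_def by simp
  have "S * (6 * fps_X) = 1 - D"
    unfolding lin S [symmetric] t_def by Groebner_Basis.algebra
  then have "fps_to_fls (S * (6 * fps_X)) = fps_to_fls (1 - D)"
    by simp
  then show "fps_to_fls S = (1 - fps_to_fls D) / (6 * fps_to_fls fps_X)"
    by (simp add: fls_times_fps_to_fls field_simps)
  have "R * (1 - 3 * (fps_X * S)) = 1 - 2 * (fps_X * S)"
    unfolding R_def S_def by (rule all_equations(2))
  \<comment> \<open>Multiplication by 1 + 3 u turns X S into S^2, because X (1 + 3 u) = S.\<close>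
  then have "R * ((1 + 3 * u) - 3 * S * (fps_X * (1 + 3 * u))) = (1 + 3 * u) - 2 * S * (fps_X * (1 + 3 * u))"
    by Groebner_Basis.algebra
  then have R: "R = 1 + u"
    unfolding S unfolding u_def by Groebner_Basis.algebra
  have "R * (18 * t) = 1 + 12 * t - D"
    unfolding lin R by (simp add: algebra_simps)
  then have "fps_to_fls (R * (18 * t)) = fps_to_fls (1 + 12 * t - D)"
    by simp
  then show "fps_to_fls R = (1 + 12 * T - fps_to_fls D) / (18 * T)"
    using t_nz by (simp add: fls_times_fps_to_fls T_def [symmetric] field_simps)
  define G where "G = fps_const (1 / 2) * (1 - 6 * t + D)"
  have LG: "fps_log G = - (2 * L)"
    using curve_log [OF c [unfolded t_def] D] unfolding G_def L_def t_def by simp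
  have N: "1 - 36 * t + 162 * t ^ 2 - (1 - 30 * t) * D = 54 * t ^ 2 * (3 * u ^ 2 - 8 * u)"
  proof -
    have "1 - 36 * t + 162 * t ^ 2 - (1 - 30 * t) * D =
        54 * t ^ 2 * (3 * u ^ 2 - 8 * u) + 18 * t * (u - t * (1 + 3 * u) ^ 2)"
      unfolding lin by Groebner_Basis.algebra
    then show ?thesis
      unfolding c by simp
  qed
  have "2 * (216 * t ^ 2 * (2 * F0)) =
      2 * (2 * (1 - 36 * t + 162 * t ^ 2 - (1 - 30 * t) * D) - fps_log G * (216 * t ^ 2))"
    unfolding N LG using F by Groebner_Basis.algebra
  then have "fps_to_fls (216 * t ^ 2 * (2 * F0)) =
      fps_to_fls (2 * (1 - 36 * t + 162 * t ^ 2 - (1 - 30 * t) * D) - fps_log G * (216 * t ^ 2))"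
    by (metis mult_cancel_left zero_neq_numeral)
  then have "216 * T ^ 2 * (2 * fps_to_fls F0) =
      2 * (1 - 36 * T + 162 * T ^ 2 - (1 - 30 * T) * fps_to_fls D) - fps_to_fls (fps_log G) * (216 * T ^ 2)"
    by (simp only: fls_times_fps_to_fls fps_to_fls_minus fps_to_fls_plus fps_to_fls_numeral fps_to_fls_power
        fps_one_to_fls T_def)
  then show "fps_to_fls F0 =
         (1 - 36 * T + 162 * T ^ 2 - (1 - 30 * T) * fps_to_fls D) / (216 * T ^ 2)
         - 1 / 2 * fps_to_fls (fps_log (fps_const (1 / 2) * (1 - 6 * t + D)))"
    unfolding G_def [symmetric] using t_nz by (simp add: divide_simps) (simp add: algebra_simps)
  \<comment> \<open>The coefficient of t^n is 3^(n-1) times the n-th Catalan number.\<close>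
  let ?p = "t + 6 * t ^ 2 + 45 * t ^ 3 + 378 * t ^ 4 + 3402 * t ^ 5 + 32076 * t ^ 6 + 312741 * t ^ 7"
  have rp: "t ^ 8 dvd u - ?p"
  proof (rule curve_truncation [OF c])
    have "?p - t * (1 + 3 * ?p) ^ 2 = t ^ 8 * - (3127410 + 13135122 * t + 82904796 * t ^ 2 + 575727750 * t ^ 3
        + 4092095700 * t ^ 4 + 28410835860 * t ^ 5 + 180566645688 * t ^ 6 + 880262397729 * t ^ 7)"
      by Groebner_Basis.algebra
    then show "t ^ 8 dvd ?p - t * (1 + 3 * ?p) ^ 2"
      by (rule dvdI)
  qed (simp add: t_def)
  let ?P = "t + fps_const (9 / 4) * t ^ 2 + 9 * t ^ 3 + fps_const (189 / 4) * t ^ 4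
         + fps_const (1458 / 5) * t ^ 5 + fps_const (8019 / 4) * t ^ 6 + fps_const (104247 / 7) * t ^ 7"
  have dP: "fps_X * fps_deriv ?P = 2 * t + 9 * t ^ 2 + 54 * t ^ 3 + 378 * t ^ 4 + 2916 * t ^ 5 + 24057 * t ^ 6
      + 208494 * t ^ 7"
  proof -
    have "?P = fps_const 1 * t ^ 1 + fps_const (9 / 4) * t ^ 2 + fps_const 9 * t ^ 3 + fps_const (189 / 4) * t ^ 4
         + fps_const (1458 / 5) * t ^ 5 + fps_const (8019 / 4) * t ^ 6 + fps_const (104247 / 7) * t ^ 7"
      by (simp add: numeral_fps_const)
    then show ?thesis
      unfolding t_def by (simp only: fps_deriv_add distrib_left fps_X_deriv_monomial)
        (simp add: numeral_fps_const)
  qed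
  \<comment> \<open>The product equals (2 u - 3 u^2) - (2 p - 3 p^2); the multiple of t^8 is the
    part of 2 p - 3 p^2 beyond t^7.\<close>
  have "t ^ 8 dvd (u - ?p) * (2 - 3 * u - 3 * ?p) +
      t ^ 8 * - (4378374 + 27634932 * t + 191909250 * t ^ 2 + 1364031900 * t ^ 3 + 9470278620 * t ^ 4
        + 60188881896 * t ^ 5 + 293420799243 * t ^ 6)"
    using rp by (intro dvd_add dvd_mult2 dvd_triv_left)
  also have "(u - ?p) * (2 - 3 * u - 3 * ?p) +
      t ^ 8 * - (4378374 + 27634932 * t + 191909250 * t ^ 2 + 1364031900 * t ^ 3 + 9470278620 * t ^ 4
        + 60188881896 * t ^ 5 + 293420799243 * t ^ 6) = fps_X * fps_deriv (F0 - ?P)"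
    unfolding fps_deriv_sub right_diff_distrib dF dP by Groebner_Basis.algebra
  finally have "fps_X ^ 16 dvd fps_X * fps_deriv (F0 - ?P)"
    by (simp add: t_def power_mult [symmetric])
  then have "fps_X ^ 16 dvd F0 - ?P"
    by (rule fps_X_power_dvd_deriv) (simp add: F_0 t_def fps_X_power_nth power_mult [symmetric] numeral_fps_const)
  then show "t ^ 8 dvd F0 - ?P"
    by (simp add: t_def power_mult [symmetric])
qed

text \<open>Quotients by powers of t are equations between Laurent series, whence
  \<open>fps_to_fls\<close>. An expansion with its O-term is divisibility of the difference by a
  power of t.\<close>

theorem proposition8p2:
  shows
   "(let t = fps_X ^ 2 :: rat fps;
         T = fps_to_fls t;
         D = fps_sqrt (1 - 8 * t);
         R = mps_subst even_coeffs R_series;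
         S = mps_subst even_coeffs S_series;
         F0 = mps_subst even_coeffs (free_energy 0)
     in
       formal_potential even_coeffs =
         fps_const (1 / 2) * fps_X ^ 2 + fps_const (1 / 2) * fps_log (1 - fps_const T * fps_X ^ 2) \<and>
       S = 0 \<and>
       fps_to_fls R = (1 + 4 * T - fps_to_fls D) / (8 * T) \<and>
       fps_to_fls F0 =
         (1 - 24 * T + 72 * T ^ 2 - (1 - 20 * T) * fps_to_fls D) / (128 * T ^ 2)
         - 3 / 8 * fps_to_fls (fps_log (fps_const (1 / 2) * (1 - 4 * t + D))) \<and>
       t ^ 9 dvd F0 - (fps_const (1 / 2) * t + fps_const (3 / 4) * t ^ 2 + 2 * t ^ 3 + 7 * t ^ 4
         + fps_const (144 / 5) * t ^ 5 + 132 * t ^ 6 + fps_const (4576 / 7) * t ^ 7 + 3432 * t ^ 8))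
    \<and>
    (let s = fps_X :: rat fps;
         t = s ^ 2;
         T = fps_to_fls t;
         D = fps_sqrt (1 - 12 * t);
         R = mps_subst all_coeffs R_series;
         S = mps_subst all_coeffs S_series;
         F0 = mps_subst all_coeffs (free_energy 0)
     in
       formal_potential all_coeffs =
         fps_const (1 / 2) * fps_X ^ 2 + fps_log (1 - fps_const (fps_to_fls s) * fps_X) \<and>
       fps_to_fls S = (1 - fps_to_fls D) / (6 * fps_to_fls s) \<and>
       fps_to_fls R = (1 + 12 * T - fps_to_fls D) / (18 * T) \<and>
       fps_to_fls F0 =
         (1 - 36 * T + 162 * T ^ 2 - (1 - 30 * T) * fps_to_fls D) / (216 * T ^ 2)
         - 1 / 2 * fps_to_fls (fps_log (fps_const (1 / 2) * (1 - 6 * t + D))) \<and>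
       t ^ 8 dvd F0 - (t + fps_const (9 / 4) * t ^ 2 + 9 * t ^ 3 + fps_const (189 / 4) * t ^ 4
         + fps_const (1458 / 5) * t ^ 5 + fps_const (8019 / 4) * t ^ 6
         + fps_const (104247 / 7) * t ^ 7))"
  unfolding Let_def mps_subst_even mps_subst_all
  by (intro conjI formal_potential_even formal_potential_all even_S_eq_0 proposition_even proposition_all)

end
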